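(* Let $A$ be a commutative monoid object in $(\mathbf C,\otimes,1)$ and let $\mathscr I\subseteq\mathcal E(A)$ be a finitely generated ideal. Then $\mathcal E(A/\mathscr I)=\mathcal E(A)/\mathscr I$; that is, the ring homomorphism $\mathcal E(A)\to\mathcal E(A/\mathscr I)$ induced by the canonical morphism $A\to A/\mathscr I$ induces an isomorphism $\mathcal E(A)/\mathscr I\cong\mathcal E(A/\mathscr I)$.
   Context: Standing assumptions: $(\mathbf C,\otimes,1)$ is an abelian symmetric monoidal category with small limits and small colimits such that for every object $X$ the functor $-\otimes X$ preserves colimits. $Comm(\mathbf C)$ is the category of unital commutative monoid objects in $\mathbf C$ (all monoids are unital and commutative), and $A\text{-}Mod$ is the category of modules over $A\in Comm(\mathbf C)$. For every monoid $A$, filtered colimits commute with finite limits in $A\text{-}Mod$. Moreover: (C1) $Hom_{\mathbf C}(1,-)$ preserves filtered colimits, and for every monoid $A$ and every finite (not necessarily filtered) system of $A$-modules of the form $\{A^{r_i}\}_{i\in I}$, $r_i\ge 0$, the canonical map $colim_{i}\,Hom_{A-Mod}(A,A^{r_i})\to Hom_{A-Mod}(A,colim_i A^{r_i})$ is an isomorphism. (C2) For every monoid $A$, every object of $A\text{-}Mod$ is a directed colimit of finitely presented objects, where $M$ is finitely presented if $Hom_{A-Mod}(M,-)$ preserves directed colimits. $\mathcal E(A):=Hom_{A-Mod}(A,A)$, a commutative ring under composition; a morphism $g:A\to B$ in $Comm(\mathbf C)$ induces by base change a ring homomorphism $\mathcal E(g):\mathcal E(A)\to\mathcal E(B)$.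 Quotients: for $t\in\mathcal E(A)$, $A/tA:=colim(A\overset{t}{\leftarrow}A\to 0)$ (colimit in $A\text{-}Mod$, i.e. the cokernel of $t$), which is a commutative monoid such that the canonical morphism $A\to A/tA$ is a morphism of monoids. For an ideal $\mathscr I\subseteq\mathcal E(A)$, $A/\mathscr I:=colim\{A\to A/tA\}_{t\in\mathscr I}$, the colimit taken in $Comm(\mathbf C)$ of the diagram consisting of all the canonical morphisms $A\to A/tA$, $t\in\mathscr I$, out of the single object $A$. *)

theory Defs
  imports "HOL-Algebra.Product_Groups" "HOL-Algebra.QuotRing" "HOL-Library.Equipollence"
begin

section \<open>Categories, diagrams, limits and colimits\<close>

text \<open>
  Hom-sets are not required to be pairwise disjoint. This lets module categories reuse the
  arrows of the base category: a linear map is an arrow of the base category with a property.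
\<close>

record ('o, 'm) cat =
  Obj :: "'o set"
  Hom :: "'o \<Rightarrow> 'o \<Rightarrow> 'm set"
  Ident :: "'o \<Rightarrow> 'm"
  Comp :: "'m \<Rightarrow> 'm \<Rightarrow> 'm" (infixr \<open>\<cdot>\<index>\<close> 75)

locale category =
  fixes C :: "('o, 'm, 'x) cat_scheme" (structure)
  assumes ident_in_hom: "X \<in> Obj C \<Longrightarrow> Ident C X \<in> Hom C X X"
    and comp_in_hom: "\<lbrakk>X \<in> Obj C; Y \<in> Obj C; Z \<in> Obj C; f \<in> Hom C X Y; g \<in> Hom C Y Z\<rbrakk>
      \<Longrightarrow> g \<cdot> f \<in> Hom C X Z"
    and comp_assoc: "\<lbrakk>X \<in> Obj C; Y \<in> Obj C; Z \<in> Obj C; W \<in> Obj C;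
        f \<in> Hom C X Y; g \<in> Hom C Y Z; h \<in> Hom C Z W\<rbrakk> \<Longrightarrow> (h \<cdot> g) \<cdot> f = h \<cdot> (g \<cdot> f)"
    and ident_left: "\<lbrakk>X \<in> Obj C; Y \<in> Obj C; f \<in> Hom C X Y\<rbrakk> \<Longrightarrow> Ident C Y \<cdot> f = f"
    and ident_right: "\<lbrakk>X \<in> Obj C; Y \<in> Obj C; f \<in> Hom C X Y\<rbrakk> \<Longrightarrow> f \<cdot> Ident C X = f"

definition is_inverse :: "('o, 'm, 'x) cat_scheme \<Rightarrow> 'o \<Rightarrow> 'o \<Rightarrow> 'm \<Rightarrow> 'm \<Rightarrow> bool" where
  "is_inverse C X Y f g \<longleftrightarrow> f \<in> Hom C X Y \<and> g \<in> Hom C Y X \<and>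
     g \<cdot>\<^bsub>C\<^esub> f = Ident C X \<and> f \<cdot>\<^bsub>C\<^esub> g = Ident C Y"

definition is_iso_arrow :: "('o, 'm, 'x) cat_scheme \<Rightarrow> 'o \<Rightarrow> 'o \<Rightarrow> 'm \<Rightarrow> bool" where
  "is_iso_arrow C X Y f \<longleftrightarrow> (\<exists>g. is_inverse C X Y f g)"

definition inverse_arrow :: "('o, 'm, 'x) cat_scheme \<Rightarrow> 'o \<Rightarrow> 'o \<Rightarrow> 'm \<Rightarrow> 'm" where
  "inverse_arrow C X Y f = (THE g. is_inverse C X Y f g)"

text \<open>
  A functor \<open>J \<rightarrow> C\<close> consists of an object map \<open>F\<close> and of arrow maps \<open>G i j\<close>, one for each hom-set.
\<close>

definition is_functor ::
  "('i, 'a, 'y) cat_scheme \<Rightarrow> ('o, 'm, 'x) cat_scheme \<Rightarrow> ('i \<Rightarrow> 'o) \<Rightarrow> ('i \<Rightarrow> 'i \<Rightarrow> 'a \<Rightarrow> 'm) \<Rightarrow> bool" where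
  "is_functor J C F G \<longleftrightarrow>
     (\<forall>i\<in>Obj J. F i \<in> Obj C) \<and>
     (\<forall>i\<in>Obj J. \<forall>j\<in>Obj J. \<forall>u\<in>Hom J i j. G i j u \<in> Hom C (F i) (F j)) \<and>
     (\<forall>i\<in>Obj J. G i i (Ident J i) = Ident C (F i)) \<and>
     (\<forall>i\<in>Obj J. \<forall>j\<in>Obj J. \<forall>k\<in>Obj J. \<forall>u\<in>Hom J i j. \<forall>v\<in>Hom J j k.
        G i k (v \<cdot>\<^bsub>J\<^esub> u) = G j k v \<cdot>\<^bsub>C\<^esub> G i j u)"

definition is_cocone ::
  "('i, 'a, 'y) cat_scheme \<Rightarrow> ('o, 'm, 'x) cat_scheme \<Rightarrow> ('i \<Rightarrow> 'o) \<Rightarrow> ('i \<Rightarrow> 'i \<Rightarrow> 'a \<Rightarrow> 'm)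
     \<Rightarrow> 'o \<Rightarrow> ('i \<Rightarrow> 'm) \<Rightarrow> bool" where
  "is_cocone J C F G X \<iota> \<longleftrightarrow> X \<in> Obj C \<and> (\<forall>i\<in>Obj J. \<iota> i \<in> Hom C (F i) X) \<and>
     (\<forall>i\<in>Obj J. \<forall>j\<in>Obj J. \<forall>u\<in>Hom J i j. \<iota> j \<cdot>\<^bsub>C\<^esub> G i j u = \<iota> i)"

definition is_colimit ::
  "('i, 'a, 'y) cat_scheme \<Rightarrow> ('o, 'm, 'x) cat_scheme \<Rightarrow> ('i \<Rightarrow> 'o) \<Rightarrow> ('i \<Rightarrow> 'i \<Rightarrow> 'a \<Rightarrow> 'm)
     \<Rightarrow> 'o \<Rightarrow> ('i \<Rightarrow> 'm) \<Rightarrow> bool" where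
  "is_colimit J C F G X \<iota> \<longleftrightarrow> is_cocone J C F G X \<iota> \<and>
     (\<forall>Y \<kappa>. is_cocone J C F G Y \<kappa> \<longrightarrow> (\<exists>!h. h \<in> Hom C X Y \<and> (\<forall>i\<in>Obj J. h \<cdot>\<^bsub>C\<^esub> \<iota> i = \<kappa> i)))"

definition is_cone ::
  "('i, 'a, 'y) cat_scheme \<Rightarrow> ('o, 'm, 'x) cat_scheme \<Rightarrow> ('i \<Rightarrow> 'o) \<Rightarrow> ('i \<Rightarrow> 'i \<Rightarrow> 'a \<Rightarrow> 'm)
     \<Rightarrow> 'o \<Rightarrow> ('i \<Rightarrow> 'm) \<Rightarrow> bool" where
  "is_cone J C F G X \<pi> \<longleftrightarrow> X \<in> Obj C \<and> (\<forall>i\<in>Obj J. \<pi> i \<in> Hom C X (F i)) \<and>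
     (\<forall>i\<in>Obj J. \<forall>j\<in>Obj J. \<forall>u\<in>Hom J i j. G i j u \<cdot>\<^bsub>C\<^esub> \<pi> i = \<pi> j)"

definition is_limit ::
  "('i, 'a, 'y) cat_scheme \<Rightarrow> ('o, 'm, 'x) cat_scheme \<Rightarrow> ('i \<Rightarrow> 'o) \<Rightarrow> ('i \<Rightarrow> 'i \<Rightarrow> 'a \<Rightarrow> 'm)
     \<Rightarrow> 'o \<Rightarrow> ('i \<Rightarrow> 'm) \<Rightarrow> bool" where
  "is_limit J C F G X \<pi> \<longleftrightarrow> is_cone J C F G X \<pi> \<and>
     (\<forall>Y \<kappa>. is_cone J C F G Y \<kappa> \<longrightarrow> (\<exists>!h. h \<in> Hom C Y X \<and> (\<forall>i\<in>Obj J. \<pi> i \<cdot>\<^bsub>C\<^esub> h = \<kappa> i)))"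

definition is_zero_object :: "('o, 'm, 'x) cat_scheme \<Rightarrow> 'o \<Rightarrow> bool" where
  "is_zero_object C Z \<longleftrightarrow> Z \<in> Obj C \<and> (\<forall>X\<in>Obj C. (\<exists>!f. f \<in> Hom C X Z) \<and> (\<exists>!f. f \<in> Hom C Z X))"

text \<open>\<open>P\<close> with \<open>p\<close>, \<open>q\<close> is the colimit of the span \<open>Y \<leftarrow>f\<midarrow> X \<midarrow>g\<rightarrow> Z\<close>.\<close>

definition is_pushout ::
  "('o, 'm, 'x) cat_scheme \<Rightarrow> 'o \<Rightarrow> 'o \<Rightarrow> 'o \<Rightarrow> 'm \<Rightarrow> 'm \<Rightarrow> 'o \<Rightarrow> 'm \<Rightarrow> 'm \<Rightarrow> bool" where
  "is_pushout C X Y Z f g P p q \<longleftrightarrow>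
     X \<in> Obj C \<and> Y \<in> Obj C \<and> Z \<in> Obj C \<and> f \<in> Hom C X Y \<and> g \<in> Hom C X Z \<and>
     P \<in> Obj C \<and> p \<in> Hom C Y P \<and> q \<in> Hom C Z P \<and> p \<cdot>\<^bsub>C\<^esub> f = q \<cdot>\<^bsub>C\<^esub> g \<and>
     (\<forall>W\<in>Obj C. \<forall>a\<in>Hom C Y W. \<forall>b\<in>Hom C Z W. a \<cdot>\<^bsub>C\<^esub> f = b \<cdot>\<^bsub>C\<^esub> g \<longrightarrow>
        (\<exists>!h. h \<in> Hom C P W \<and> h \<cdot>\<^bsub>C\<^esub> p = a \<and> h \<cdot>\<^bsub>C\<^esub> q = b))"

definition is_coequalizer ::
  "('o, 'm, 'x) cat_scheme \<Rightarrow> 'o \<Rightarrow> 'o \<Rightarrow> 'm \<Rightarrow> 'm \<Rightarrow> 'o \<Rightarrow> 'm \<Rightarrow> bool" where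
  "is_coequalizer C X Y f g Q q \<longleftrightarrow>
     X \<in> Obj C \<and> Y \<in> Obj C \<and> f \<in> Hom C X Y \<and> g \<in> Hom C X Y \<and>
     Q \<in> Obj C \<and> q \<in> Hom C Y Q \<and> q \<cdot>\<^bsub>C\<^esub> f = q \<cdot>\<^bsub>C\<^esub> g \<and>
     (\<forall>W\<in>Obj C. \<forall>a\<in>Hom C Y W. a \<cdot>\<^bsub>C\<^esub> f = a \<cdot>\<^bsub>C\<^esub> g \<longrightarrow> (\<exists>!h. h \<in> Hom C Q W \<and> h \<cdot>\<^bsub>C\<^esub> q = a))"


subsection \<open>Index categories\<close>

text \<open>
  The type \<open>'u\<close> plays the role of the universe: small sets are those of cardinality strictly below
  that of \<open>'u\<close>. If the cardinality of \<open>'u\<close> is strongly inaccessible, this is the usual notion for a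
  Grothendieck universe. Whenever \<open>'u\<close> is infinite, every finite category is isomorphic to one
  with objects and arrows in \<open>'u\<close>, and is small.
\<close>

definition small_category :: "('u, 'u) cat \<Rightarrow> bool" where
  "small_category J \<longleftrightarrow> category J \<and> Obj J \<prec> (UNIV :: 'u set) \<and>
     (SIGMA (i, j) : Obj J \<times> Obj J. Hom J i j) \<prec> (UNIV :: 'u set)"

definition finite_category :: "('i, 'a, 'y) cat_scheme \<Rightarrow> bool" where
  "finite_category J \<longleftrightarrow> category J \<and> finite (Obj J) \<and> (\<forall>i\<in>Obj J. \<forall>j\<in>Obj J. finite (Hom J i j))"

definition filtered_category :: "('i, 'a, 'y) cat_scheme \<Rightarrow> bool" where
  "filtered_category J \<longleftrightarrow> category J \<and> Obj J \<noteq> {} \<and>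
     (\<forall>i\<in>Obj J. \<forall>j\<in>Obj J. \<exists>k\<in>Obj J. Hom J i k \<noteq> {} \<and> Hom J j k \<noteq> {}) \<and>
     (\<forall>i\<in>Obj J. \<forall>j\<in>Obj J. \<forall>u\<in>Hom J i j. \<forall>v\<in>Hom J i j.
        \<exists>k\<in>Obj J. \<exists>w\<in>Hom J j k. w \<cdot>\<^bsub>J\<^esub> u = w \<cdot>\<^bsub>J\<^esub> v)"

definition product_category ::
  "('i, 'a, 'x) cat_scheme \<Rightarrow> ('j, 'b, 'y) cat_scheme \<Rightarrow> ('i \<times> 'j, 'a \<times> 'b) cat" where
  "product_category J K =
     \<lparr>Obj = Obj J \<times> Obj K,
      Hom = (\<lambda>(i, k) (i', k'). Hom J i i' \<times> Hom K k k'),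
      Ident = (\<lambda>(i, k). (Ident J i, Ident K k)),
      Comp = (\<lambda>(u, v) (u', v'). (u \<cdot>\<^bsub>J\<^esub> u', v \<cdot>\<^bsub>K\<^esub> v'))\<rparr>"

definition relation_category :: "'i set \<Rightarrow> 'i rel \<Rightarrow> ('i, unit) cat" where
  "relation_category I r =
     \<lparr>Obj = I, Hom = (\<lambda>i j. {u. (i, j) \<in> r}), Ident = (\<lambda>_. ()), Comp = (\<lambda>_ _. ())\<rparr>"

definition small_directed_poset :: "'u set \<Rightarrow> 'u rel \<Rightarrow> bool" where
  "small_directed_poset I r \<longleftrightarrow> I \<prec> (UNIV :: 'u set) \<and> partial_order_on I r \<and> I \<noteq> {} \<and>
     (\<forall>i\<in>I. \<forall>j\<in>I. \<exists>k\<in>I. (i, k) \<in> r \<and> (j, k) \<in> r)"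

definition discrete_category :: "'i set \<Rightarrow> ('i, unit) cat" where
  "discrete_category I = relation_category I (Id_on I)"

text \<open>The wide span: arrows from the object \<open>None\<close> to all the objects \<open>Some t\<close>, \<open>t \<in> T\<close>.\<close>

definition wide_span_category :: "'t set \<Rightarrow> ('t option, unit) cat" where
  "wide_span_category T =
     relation_category (insert None (Some ` T))
       (Id_on (insert None (Some ` T)) \<union> {None} \<times> Some ` T)"


subsection \<open>Completeness and preservation of colimits\<close>

definition has_small_limits :: "'u itself \<Rightarrow> ('o, 'm, 'x) cat_scheme \<Rightarrow> bool" where
  "has_small_limits U C \<longleftrightarrow> (\<forall>(J :: ('u, 'u) cat) F G.
     small_category J \<and> is_functor J C F G \<longrightarrow> (\<exists>X \<pi>. is_limit J C F G X \<pi>))"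

definition has_small_colimits :: "'u itself \<Rightarrow> ('o, 'm, 'x) cat_scheme \<Rightarrow> bool" where
  "has_small_colimits U C \<longleftrightarrow> (\<forall>(J :: ('u, 'u) cat) F G.
     small_category J \<and> is_functor J C F G \<longrightarrow> (\<exists>X \<iota>. is_colimit J C F G X \<iota>))"

text \<open>
  The map \<open>colim\<^sub>i Hom(M, F i) \<rightarrow> Hom(M, X)\<close> induced by a cocone \<open>\<iota>\<close> is bijective. The colimit of
  sets is the disjoint union modulo the equivalence relation generated by \<open>(i, x) \<sim> (j, G i j u \<cdot> x)\<close>.
\<close>

definition hom_colimit_comparison_bij ::
  "('o, 'm, 'x) cat_scheme \<Rightarrow> 'o \<Rightarrow> ('i, 'a, 'y) cat_scheme \<Rightarrow> ('i \<Rightarrow> 'o) \<Rightarrow> ('i \<Rightarrow> 'i \<Rightarrow> 'a \<Rightarrow> 'm)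
     \<Rightarrow> 'o \<Rightarrow> ('i \<Rightarrow> 'm) \<Rightarrow> bool" where
  "hom_colimit_comparison_bij C M J F G X \<iota> \<longleftrightarrow>
     (let S = (SIGMA i : Obj J. Hom C M (F i));
          r = {((i, x), (j, G i j u \<cdot>\<^bsub>C\<^esub> x)) | i j u x.
                 i \<in> Obj J \<and> j \<in> Obj J \<and> u \<in> Hom J i j \<and> x \<in> Hom C M (F i)};
          E = (r \<union> r\<inverse>)\<^sup>* \<inter> S \<times> S
      in \<exists>\<phi>. bij_betw \<phi> (S // E) (Hom C M X) \<and> (\<forall>(i, x)\<in>S. \<phi> (E `` {(i, x)}) = \<iota> i \<cdot>\<^bsub>C\<^esub> x))"

definition hom_preserves_filtered_colimits ::
  "'u itself \<Rightarrow> ('o, 'm, 'x) cat_scheme \<Rightarrow> 'o \<Rightarrow> bool" where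
  "hom_preserves_filtered_colimits U C M \<longleftrightarrow> (\<forall>(J :: ('u, 'u) cat) F G X \<iota>.
     small_category J \<and> filtered_category J \<and> is_functor J C F G \<and> is_colimit J C F G X \<iota> \<longrightarrow>
     hom_colimit_comparison_bij C M J F G X \<iota>)"

definition finitely_presented :: "'u itself \<Rightarrow> ('o, 'm, 'x) cat_scheme \<Rightarrow> 'o \<Rightarrow> bool" where
  "finitely_presented U C M \<longleftrightarrow> M \<in> Obj C \<and> (\<forall>(I :: 'u set) r F G X \<iota>.
     small_directed_poset I r \<and> is_functor (relation_category I r) C F G \<and>
     is_colimit (relation_category I r) C F G X \<iota> \<longrightarrow>
     hom_colimit_comparison_bij C M (relation_category I r) F G X \<iota>)"

definition directed_colimits_of_finitely_presented ::
  "'u itself \<Rightarrow> ('o, 'm, 'x) cat_scheme \<Rightarrow> bool" where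
  "directed_colimits_of_finitely_presented U C \<longleftrightarrow> (\<forall>M\<in>Obj C. \<exists>(I :: 'u set) r F G \<iota>.
     small_directed_poset I r \<and> is_functor (relation_category I r) C F G \<and>
     (\<forall>i\<in>I. finitely_presented U C (F i)) \<and> is_colimit (relation_category I r) C F G M \<iota>)"

text \<open>
  For a functor \<open>F\<close> on \<open>J \<times> K\<close>, with \<open>J\<close> filtered and \<open>K\<close> finite, the canonical arrow
  \<open>c : P = colim\<^sub>j lim\<^sub>k F(j,k) \<rightarrow> lim\<^sub>k colim\<^sub>j F(j,k) = R\<close> is an isomorphism, for any choice of
  the limits \<open>L j = lim\<^sub>k F(j,k)\<close> and colimits \<open>Q k = colim\<^sub>j F(j,k)\<close>, made into functors
  on \<open>J\<close> and \<open>K\<close> by \<open>L1\<close> and \<open>Q1\<close>.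
\<close>

definition filtered_colimits_commute_finite_limits ::
  "'u itself \<Rightarrow> ('o, 'm, 'x) cat_scheme \<Rightarrow> bool" where
  "filtered_colimits_commute_finite_limits U C \<longleftrightarrow>
   (\<forall>(J :: ('u, 'u) cat) (K :: ('u, 'u) cat) F G L L1 \<pi> P \<iota> Q Q1 \<kappa> R \<rho> c.
      small_category J \<and> filtered_category J \<and> finite_category K \<and>
      is_functor (product_category J K) C F G \<and>
      (\<forall>j\<in>Obj J. is_limit K C (\<lambda>k. F (j, k)) (\<lambda>k k' v. G (j, k) (j, k') (Ident J j, v)) (L j) (\<pi> j)) \<and>
      is_functor J C L L1 \<and>
      (\<forall>j\<in>Obj J. \<forall>j'\<in>Obj J. \<forall>u\<in>Hom J j j'. \<forall>k\<in>Obj K.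
         \<pi> j' k \<cdot>\<^bsub>C\<^esub> L1 j j' u = G (j, k) (j', k) (u, Ident K k) \<cdot>\<^bsub>C\<^esub> \<pi> j k) \<and>
      is_colimit J C L L1 P \<iota> \<and>
      (\<forall>k\<in>Obj K. is_colimit J C (\<lambda>j. F (j, k)) (\<lambda>j j' u. G (j, k) (j', k) (u, Ident K k)) (Q k) (\<kappa> k)) \<and>
      is_functor K C Q Q1 \<and>
      (\<forall>k\<in>Obj K. \<forall>k'\<in>Obj K. \<forall>v\<in>Hom K k k'. \<forall>j\<in>Obj J.
         Q1 k k' v \<cdot>\<^bsub>C\<^esub> \<kappa> k j = \<kappa> k' j \<cdot>\<^bsub>C\<^esub> G (j, k) (j, k') (Ident J j, v)) \<and>
      is_limit K C Q Q1 R \<rho> \<and>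
      c \<in> Hom C P R \<and> (\<forall>j\<in>Obj J. \<forall>k\<in>Obj K. \<rho> k \<cdot>\<^bsub>C\<^esub> (c \<cdot>\<^bsub>C\<^esub> \<iota> j) = \<kappa> k j \<cdot>\<^bsub>C\<^esub> \<pi> j k) \<longrightarrow>
      is_iso_arrow C P R c)"


section \<open>Abelian categories\<close>

record ('o, 'm) addcat = "('o, 'm) cat" +
  Add :: "'m \<Rightarrow> 'm \<Rightarrow> 'm"
  Zero :: "'o \<Rightarrow> 'o \<Rightarrow> 'm"

definition hom_group :: "('o, 'm, 'x) addcat_scheme \<Rightarrow> 'o \<Rightarrow> 'o \<Rightarrow> 'm monoid" where
  "hom_group C X Y = \<lparr>carrier = Hom C X Y, monoid.mult = Add C, one = Zero C X Y\<rparr>"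

definition is_kernel :: "('o, 'm, 'x) addcat_scheme \<Rightarrow> 'o \<Rightarrow> 'o \<Rightarrow> 'm \<Rightarrow> 'o \<Rightarrow> 'm \<Rightarrow> bool" where
  "is_kernel C X Y f K k \<longleftrightarrow> K \<in> Obj C \<and> k \<in> Hom C K X \<and> f \<cdot>\<^bsub>C\<^esub> k = Zero C K Y \<and>
     (\<forall>W\<in>Obj C. \<forall>a\<in>Hom C W X. f \<cdot>\<^bsub>C\<^esub> a = Zero C W Y \<longrightarrow> (\<exists>!h. h \<in> Hom C W K \<and> k \<cdot>\<^bsub>C\<^esub> h = a))"

definition is_cokernel :: "('o, 'm, 'x) addcat_scheme \<Rightarrow> 'o \<Rightarrow> 'o \<Rightarrow> 'm \<Rightarrow> 'o \<Rightarrow> 'm \<Rightarrow> bool" where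
  "is_cokernel C X Y f Q q \<longleftrightarrow> Q \<in> Obj C \<and> q \<in> Hom C Y Q \<and> q \<cdot>\<^bsub>C\<^esub> f = Zero C X Q \<and>
     (\<forall>W\<in>Obj C. \<forall>a\<in>Hom C Y W. a \<cdot>\<^bsub>C\<^esub> f = Zero C X W \<longrightarrow> (\<exists>!h. h \<in> Hom C Q W \<and> h \<cdot>\<^bsub>C\<^esub> q = a))"

definition is_mono :: "('o, 'm, 'x) cat_scheme \<Rightarrow> 'o \<Rightarrow> 'o \<Rightarrow> 'm \<Rightarrow> bool" where
  "is_mono C X Y f \<longleftrightarrow> (\<forall>W\<in>Obj C. \<forall>a\<in>Hom C W X. \<forall>b\<in>Hom C W X. f \<cdot>\<^bsub>C\<^esub> a = f \<cdot>\<^bsub>C\<^esub> b \<longrightarrow> a = b)"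

definition is_epi :: "('o, 'm, 'x) cat_scheme \<Rightarrow> 'o \<Rightarrow> 'o \<Rightarrow> 'm \<Rightarrow> bool" where
  "is_epi C X Y f \<longleftrightarrow> (\<forall>W\<in>Obj C. \<forall>a\<in>Hom C Y W. \<forall>b\<in>Hom C Y W. a \<cdot>\<^bsub>C\<^esub> f = b \<cdot>\<^bsub>C\<^esub> f \<longrightarrow> a = b)"

locale abelian_category = category C
  for C :: "('o, 'm, 'x) addcat_scheme" (structure) +
  assumes hom_comm_group: "\<lbrakk>X \<in> Obj C; Y \<in> Obj C\<rbrakk> \<Longrightarrow> comm_group (hom_group C X Y)"
    and comp_add_left: "\<lbrakk>X \<in> Obj C; Y \<in> Obj C; Z \<in> Obj C; f \<in> Hom C X Y; g \<in> Hom C Y Z; g' \<in> Hom C Y Z\<rbrakk>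
      \<Longrightarrow> Add C g g' \<cdot> f = Add C (g \<cdot> f) (g' \<cdot> f)"
    and comp_add_right: "\<lbrakk>X \<in> Obj C; Y \<in> Obj C; Z \<in> Obj C; f \<in> Hom C X Y; f' \<in> Hom C X Y; g \<in> Hom C Y Z\<rbrakk>
      \<Longrightarrow> g \<cdot> Add C f f' = Add C (g \<cdot> f) (g \<cdot> f')"
    and zero_object: "\<exists>Z. is_zero_object C Z"
    and biproducts: "\<lbrakk>X \<in> Obj C; Y \<in> Obj C\<rbrakk> \<Longrightarrow>
      \<exists>S\<in>Obj C. \<exists>i1\<in>Hom C X S. \<exists>i2\<in>Hom C Y S. \<exists>p1\<in>Hom C S X. \<exists>p2\<in>Hom C S Y.
        p1 \<cdot> i1 = Ident C X \<and> p2 \<cdot> i2 = Ident C Y \<and> Add C (i1 \<cdot> p1) (i2 \<cdot> p2) = Ident C S"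
    and kernels: "\<lbrakk>X \<in> Obj C; Y \<in> Obj C; f \<in> Hom C X Y\<rbrakk> \<Longrightarrow> \<exists>K k. is_kernel C X Y f K k"
    and cokernels: "\<lbrakk>X \<in> Obj C; Y \<in> Obj C; f \<in> Hom C X Y\<rbrakk> \<Longrightarrow> \<exists>Q q. is_cokernel C X Y f Q q"
    and mono_is_kernel: "\<lbrakk>X \<in> Obj C; Y \<in> Obj C; f \<in> Hom C X Y; is_mono C X Y f\<rbrakk> \<Longrightarrow>
      \<exists>Z\<in>Obj C. \<exists>g\<in>Hom C Y Z. is_kernel C Y Z g X f"
    and epi_is_cokernel: "\<lbrakk>X \<in> Obj C; Y \<in> Obj C; f \<in> Hom C X Y; is_epi C X Y f\<rbrakk> \<Longrightarrow>
      \<exists>Z\<in>Obj C. \<exists>g\<in>Hom C Z X. is_cokernel C Z X g Y f"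


section \<open>Symmetric monoidal categories\<close>

record ('o, 'm) smcat = "('o, 'm) addcat" +
  Tensor :: "'o \<Rightarrow> 'o \<Rightarrow> 'o" (infixr \<open>\<boxtimes>\<index>\<close> 80)
  TensorA :: "'m \<Rightarrow> 'm \<Rightarrow> 'm" (infixr \<open>\<boxdot>\<index>\<close> 80)
  UnitObj :: "'o"
  Assoc :: "'o \<Rightarrow> 'o \<Rightarrow> 'o \<Rightarrow> 'm"
  LUnit :: "'o \<Rightarrow> 'm"
  RUnit :: "'o \<Rightarrow> 'm"
  Braid :: "'o \<Rightarrow> 'o \<Rightarrow> 'm"

locale symmetric_monoidal_category = category C
  for C :: "('o, 'm, 'x) smcat_scheme" (structure) +
  assumes unit_obj: "UnitObj C \<in> Obj C"
    and tensor_obj: "\<lbrakk>X \<in> Obj C; Y \<in> Obj C\<rbrakk> \<Longrightarrow> X \<boxtimes> Y \<in> Obj C"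
    and tensor_arrow: "\<lbrakk>X \<in> Obj C; X' \<in> Obj C; Y \<in> Obj C; Y' \<in> Obj C; f \<in> Hom C X X'; g \<in> Hom C Y Y'\<rbrakk>
      \<Longrightarrow> f \<boxdot> g \<in> Hom C (X \<boxtimes> Y) (X' \<boxtimes> Y')"
    and tensor_ident: "\<lbrakk>X \<in> Obj C; Y \<in> Obj C\<rbrakk> \<Longrightarrow> Ident C X \<boxdot> Ident C Y = Ident C (X \<boxtimes> Y)"
    and tensor_comp: "\<lbrakk>X \<in> Obj C; X' \<in> Obj C; X'' \<in> Obj C; Y \<in> Obj C; Y' \<in> Obj C; Y'' \<in> Obj C;
        f \<in> Hom C X X'; f' \<in> Hom C X' X''; g \<in> Hom C Y Y'; g' \<in> Hom C Y' Y''\<rbrakk>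
      \<Longrightarrow> (f' \<cdot> f) \<boxdot> (g' \<cdot> g) = (f' \<boxdot> g') \<cdot> (f \<boxdot> g)"
    and assoc_iso: "\<lbrakk>X \<in> Obj C; Y \<in> Obj C; Z \<in> Obj C\<rbrakk>
      \<Longrightarrow> is_iso_arrow C ((X \<boxtimes> Y) \<boxtimes> Z) (X \<boxtimes> (Y \<boxtimes> Z)) (Assoc C X Y Z)"
    and assoc_natural: "\<lbrakk>X \<in> Obj C; X' \<in> Obj C; Y \<in> Obj C; Y' \<in> Obj C; Z \<in> Obj C; Z' \<in> Obj C;
        f \<in> Hom C X X'; g \<in> Hom C Y Y'; h \<in> Hom C Z Z'\<rbrakk>
      \<Longrightarrow> Assoc C X' Y' Z' \<cdot> ((f \<boxdot> g) \<boxdot> h) = (f \<boxdot> (g \<boxdot> h)) \<cdot> Assoc C X Y Z"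
    and lunit_iso: "X \<in> Obj C \<Longrightarrow> is_iso_arrow C (UnitObj C \<boxtimes> X) X (LUnit C X)"
    and lunit_natural: "\<lbrakk>X \<in> Obj C; X' \<in> Obj C; f \<in> Hom C X X'\<rbrakk>
      \<Longrightarrow> LUnit C X' \<cdot> (Ident C (UnitObj C) \<boxdot> f) = f \<cdot> LUnit C X"
    and runit_iso: "X \<in> Obj C \<Longrightarrow> is_iso_arrow C (X \<boxtimes> UnitObj C) X (RUnit C X)"
    and runit_natural: "\<lbrakk>X \<in> Obj C; X' \<in> Obj C; f \<in> Hom C X X'\<rbrakk>
      \<Longrightarrow> RUnit C X' \<cdot> (f \<boxdot> Ident C (UnitObj C)) = f \<cdot> RUnit C X"
    and braid_arrow: "\<lbrakk>X \<in> Obj C; Y \<in> Obj C\<rbrakk> \<Longrightarrow> Braid C X Y \<in> Hom C (X \<boxtimes> Y) (Y \<boxtimes> X)"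
    and braid_natural: "\<lbrakk>X \<in> Obj C; X' \<in> Obj C; Y \<in> Obj C; Y' \<in> Obj C; f \<in> Hom C X X'; g \<in> Hom C Y Y'\<rbrakk>
      \<Longrightarrow> Braid C X' Y' \<cdot> (f \<boxdot> g) = (g \<boxdot> f) \<cdot> Braid C X Y"
    and braid_symmetric: "\<lbrakk>X \<in> Obj C; Y \<in> Obj C\<rbrakk> \<Longrightarrow> Braid C Y X \<cdot> Braid C X Y = Ident C (X \<boxtimes> Y)"
    and pentagon: "\<lbrakk>W \<in> Obj C; X \<in> Obj C; Y \<in> Obj C; Z \<in> Obj C\<rbrakk> \<Longrightarrow>
      Assoc C W X (Y \<boxtimes> Z) \<cdot> Assoc C (W \<boxtimes> X) Y Z =
      (Ident C W \<boxdot> Assoc C X Y Z) \<cdot> Assoc C W (X \<boxtimes> Y) Z \<cdot> (Assoc C W X Y \<boxdot> Ident C Z)"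
    and triangle: "\<lbrakk>X \<in> Obj C; Y \<in> Obj C\<rbrakk> \<Longrightarrow>
      (Ident C X \<boxdot> LUnit C Y) \<cdot> Assoc C X (UnitObj C) Y = RUnit C X \<boxdot> Ident C Y"
    and hexagon: "\<lbrakk>X \<in> Obj C; Y \<in> Obj C; Z \<in> Obj C\<rbrakk> \<Longrightarrow>
      Assoc C Y Z X \<cdot> Braid C X (Y \<boxtimes> Z) \<cdot> Assoc C X Y Z =
      (Ident C Y \<boxdot> Braid C X Z) \<cdot> Assoc C Y X Z \<cdot> (Braid C X Y \<boxdot> Ident C Z)"

definition tensor_preserves_colimits :: "'u itself \<Rightarrow> ('o, 'm, 'x) smcat_scheme \<Rightarrow> bool" where
  "tensor_preserves_colimits U C \<longleftrightarrow> (\<forall>Y\<in>Obj C. \<forall>(J :: ('u, 'u) cat) F G X \<iota>.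
     small_category J \<and> is_functor J C F G \<and> is_colimit J C F G X \<iota> \<longrightarrow>
     is_colimit J C (\<lambda>i. F i \<boxtimes>\<^bsub>C\<^esub> Y) (\<lambda>i j u. G i j u \<boxdot>\<^bsub>C\<^esub> Ident C Y)
       (X \<boxtimes>\<^bsub>C\<^esub> Y) (\<lambda>i. \<iota> i \<boxdot>\<^bsub>C\<^esub> Ident C Y))"


section \<open>Commutative monoid objects and their modules\<close>

record ('o, 'm) monoid_object =
  Car :: "'o"
  Mul :: "'m"
  Unt :: "'m"

definition is_comm_monoid_object :: "('o, 'm, 'x) smcat_scheme \<Rightarrow> ('o, 'm) monoid_object \<Rightarrow> bool" where
  "is_comm_monoid_object C A \<longleftrightarrow>
     Car A \<in> Obj C \<and>
     Mul A \<in> Hom C (Car A \<boxtimes>\<^bsub>C\<^esub> Car A) (Car A) \<and>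
     Unt A \<in> Hom C (UnitObj C) (Car A) \<and>
     Mul A \<cdot>\<^bsub>C\<^esub> (Mul A \<boxdot>\<^bsub>C\<^esub> Ident C (Car A)) =
       Mul A \<cdot>\<^bsub>C\<^esub> (Ident C (Car A) \<boxdot>\<^bsub>C\<^esub> Mul A) \<cdot>\<^bsub>C\<^esub> Assoc C (Car A) (Car A) (Car A) \<and>
     Mul A \<cdot>\<^bsub>C\<^esub> (Unt A \<boxdot>\<^bsub>C\<^esub> Ident C (Car A)) = LUnit C (Car A) \<and>
     Mul A \<cdot>\<^bsub>C\<^esub> (Ident C (Car A) \<boxdot>\<^bsub>C\<^esub> Unt A) = RUnit C (Car A) \<and>
     Mul A \<cdot>\<^bsub>C\<^esub> Braid C (Car A) (Car A) = Mul A"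

definition Comm_cat :: "('o, 'm, 'x) smcat_scheme \<Rightarrow> (('o, 'm) monoid_object, 'm) cat" where
  "Comm_cat C =
     \<lparr>Obj = {A. is_comm_monoid_object C A},
      Hom = (\<lambda>A B. {f \<in> Hom C (Car A) (Car B).
                f \<cdot>\<^bsub>C\<^esub> Mul A = Mul B \<cdot>\<^bsub>C\<^esub> (f \<boxdot>\<^bsub>C\<^esub> f) \<and> f \<cdot>\<^bsub>C\<^esub> Unt A = Unt B}),
      Ident = (\<lambda>A. Ident C (Car A)),
      Comp = Comp C\<rparr>"

record ('o, 'm) module_object =
  MCar :: "'o"
  MAct :: "'m"

definition is_module_object ::
  "('o, 'm, 'x) smcat_scheme \<Rightarrow> ('o, 'm) monoid_object \<Rightarrow> ('o, 'm) module_object \<Rightarrow> bool" where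
  "is_module_object C A M \<longleftrightarrow>
     MCar M \<in> Obj C \<and>
     MAct M \<in> Hom C (Car A \<boxtimes>\<^bsub>C\<^esub> MCar M) (MCar M) \<and>
     MAct M \<cdot>\<^bsub>C\<^esub> (Mul A \<boxdot>\<^bsub>C\<^esub> Ident C (MCar M)) =
       MAct M \<cdot>\<^bsub>C\<^esub> (Ident C (Car A) \<boxdot>\<^bsub>C\<^esub> MAct M) \<cdot>\<^bsub>C\<^esub> Assoc C (Car A) (Car A) (MCar M) \<and>
     MAct M \<cdot>\<^bsub>C\<^esub> (Unt A \<boxdot>\<^bsub>C\<^esub> Ident C (MCar M)) = LUnit C (MCar M)"

definition Mod_cat ::
  "('o, 'm, 'x) smcat_scheme \<Rightarrow> ('o, 'm) monoid_object \<Rightarrow> (('o, 'm) module_object, 'm) addcat" where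
  "Mod_cat C A =
     \<lparr>Obj = {M. is_module_object C A M},
      Hom = (\<lambda>M N. {f \<in> Hom C (MCar M) (MCar N).
                f \<cdot>\<^bsub>C\<^esub> MAct M = MAct N \<cdot>\<^bsub>C\<^esub> (Ident C (Car A) \<boxdot>\<^bsub>C\<^esub> f)}),
      Ident = (\<lambda>M. Ident C (MCar M)),
      Comp = Comp C,
      Add = Add C,
      Zero = (\<lambda>M N. Zero C (MCar M) (MCar N))\<rparr>"

definition self_module :: "('o, 'm) monoid_object \<Rightarrow> ('o, 'm) module_object" where
  "self_module A = \<lparr>MCar = Car A, MAct = Mul A\<rparr>"

text \<open>The monoid \<open>B\<close> as an \<open>A\<close>-module, along a morphism \<open>g : A \<rightarrow> B\<close>.\<close>

definition algebra_module ::
  "('o, 'm, 'x) smcat_scheme \<Rightarrow> ('o, 'm) monoid_object \<Rightarrow> 'm \<Rightarrow> ('o, 'm) module_object" where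
  "algebra_module C B g =
     \<lparr>MCar = Car B, MAct = Mul B \<cdot>\<^bsub>C\<^esub> (g \<boxdot>\<^bsub>C\<^esub> Ident C (Car B))\<rparr>"

definition is_free_module_of_rank ::
  "('o, 'm, 'x) smcat_scheme \<Rightarrow> ('o, 'm) monoid_object \<Rightarrow> nat \<Rightarrow> ('o, 'm) module_object \<Rightarrow> bool" where
  "is_free_module_of_rank C A r M \<longleftrightarrow> (\<exists>\<iota>.
     is_colimit (discrete_category {..<r}) (Mod_cat C A)
       (\<lambda>_. self_module A) (\<lambda>_ _ _. Ident (Mod_cat C A) (self_module A)) M \<iota>)"

text \<open>
  The map \<open>colim\<^sub>i Hom(M, F i) \<rightarrow> Hom(M, X)\<close> induced by a cocone \<open>\<iota>\<close> on a finite diagram is an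
  isomorphism, with the colimit taken in abelian groups: it is the direct sum of the groups
  \<open>Hom(M, F i)\<close> modulo the subgroup generated by all \<open>in\<^sub>i x - in\<^sub>j (G i j u \<cdot> x)\<close>.
  (Unlike for filtered diagrams, this differs from the colimit of the underlying sets. It agrees
  with the colimit of modules over the endomorphism ring of \<open>M\<close>.)
\<close>

definition hom_sum_group ::
  "('o, 'm, 'x) addcat_scheme \<Rightarrow> 'o \<Rightarrow> ('i, 'a, 'y) cat_scheme \<Rightarrow> ('i \<Rightarrow> 'o) \<Rightarrow> ('i \<Rightarrow> 'm) monoid" where
  "hom_sum_group C M J F = sum_group (Obj J) (\<lambda>i. hom_group C M (F i))"

definition hom_sum_inj ::
  "('o, 'm, 'x) addcat_scheme \<Rightarrow> 'o \<Rightarrow> ('i, 'a, 'y) cat_scheme \<Rightarrow> ('i \<Rightarrow> 'o) \<Rightarrow> 'i \<Rightarrow> 'm \<Rightarrow> 'i \<Rightarrow> 'm" where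
  "hom_sum_inj C M J F i x = (\<lambda>j\<in>Obj J. if j = i then x else Zero C M (F j))"

definition hom_sum_relations ::
  "('o, 'm, 'x) addcat_scheme \<Rightarrow> 'o \<Rightarrow> ('i, 'a, 'y) cat_scheme \<Rightarrow> ('i \<Rightarrow> 'o) \<Rightarrow> ('i \<Rightarrow> 'i \<Rightarrow> 'a \<Rightarrow> 'm)
     \<Rightarrow> ('i \<Rightarrow> 'm) set" where
  "hom_sum_relations C M J F G = generate (hom_sum_group C M J F)
     {hom_sum_inj C M J F i x \<otimes>\<^bsub>hom_sum_group C M J F\<^esub>
        inv\<^bsub>hom_sum_group C M J F\<^esub> (hom_sum_inj C M J F j (G i j u \<cdot>\<^bsub>C\<^esub> x)) | i j u x.
        i \<in> Obj J \<and> j \<in> Obj J \<and> u \<in> Hom J i j \<and> x \<in> Hom C M (F i)}"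

definition hom_colimit_comparison_iso ::
  "('o, 'm, 'x) addcat_scheme \<Rightarrow> 'o \<Rightarrow> ('i, 'a, 'y) cat_scheme \<Rightarrow> ('i \<Rightarrow> 'o) \<Rightarrow> ('i \<Rightarrow> 'i \<Rightarrow> 'a \<Rightarrow> 'm)
     \<Rightarrow> 'o \<Rightarrow> ('i \<Rightarrow> 'm) \<Rightarrow> bool" where
  "hom_colimit_comparison_iso C M J F G X \<iota> \<longleftrightarrow>
     (\<exists>\<phi> \<in> iso (hom_sum_group C M J F Mod hom_sum_relations C M J F G) (hom_group C M X).
        \<forall>x \<in> carrier (hom_sum_group C M J F).
          \<phi> (hom_sum_relations C M J F G #>\<^bsub>hom_sum_group C M J F\<^esub> x) =
          finprod (hom_group C M X) (\<lambda>i. \<iota> i \<cdot>\<^bsub>C\<^esub> x i) (Obj J))"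

definition hom_preserves_finite_free_colimits ::
  "'u itself \<Rightarrow> ('o, 'm, 'x) smcat_scheme \<Rightarrow> ('o, 'm) monoid_object \<Rightarrow> bool" where
  "hom_preserves_finite_free_colimits U C A \<longleftrightarrow> (\<forall>(J :: ('u, 'u) cat) F G X \<iota>.
     finite_category J \<and> is_functor J (Mod_cat C A) F G \<and>
     (\<forall>i\<in>Obj J. \<exists>r. is_free_module_of_rank C A r (F i)) \<and>
     is_colimit J (Mod_cat C A) F G X \<iota> \<longrightarrow>
     hom_colimit_comparison_iso (Mod_cat C A) (self_module A) J F G X \<iota>)"


section \<open>Endomorphism rings and base change\<close>

definition endo_ring :: "('o, 'm, 'x) smcat_scheme \<Rightarrow> ('o, 'm) monoid_object \<Rightarrow> 'm ring" where
  "endo_ring C A =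
     \<lparr>carrier = Hom (Mod_cat C A) (self_module A) (self_module A),
      monoid.mult = Comp C,
      one = Ident C (Car A),
      zero = Zero C (Car A) (Car A),
      add = Add C\<rparr>"

text \<open>
  \<open>B \<otimes>\<^sub>A M\<close> for a morphism of monoids \<open>g : A \<rightarrow> B\<close> and an \<open>A\<close>-module \<open>M\<close>: a \<open>B\<close>-module \<open>T\<close> with
  \<open>q : B \<otimes> M \<rightarrow> T\<close>, the coequalizer in \<open>C\<close> of the two arrows \<open>(B \<otimes> A) \<otimes> M \<rightarrow> B \<otimes> M\<close> given by the
  actions of \<open>A\<close> on \<open>B\<close> and on \<open>M\<close>. The action of \<open>B\<close> on \<open>T\<close> comes from the one on the left factor.
\<close>

definition is_base_change ::
  "('o, 'm, 'x) smcat_scheme \<Rightarrow> ('o, 'm) monoid_object \<Rightarrow> ('o, 'm) monoid_object \<Rightarrow> 'm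
     \<Rightarrow> ('o, 'm) module_object \<Rightarrow> ('o, 'm) module_object \<Rightarrow> 'm \<Rightarrow> bool" where
  "is_base_change C A B g M T q \<longleftrightarrow>
     T \<in> Obj (Mod_cat C B) \<and>
     is_coequalizer C ((Car B \<boxtimes>\<^bsub>C\<^esub> Car A) \<boxtimes>\<^bsub>C\<^esub> MCar M) (Car B \<boxtimes>\<^bsub>C\<^esub> MCar M)
       ((Mul B \<cdot>\<^bsub>C\<^esub> (Ident C (Car B) \<boxdot>\<^bsub>C\<^esub> g)) \<boxdot>\<^bsub>C\<^esub> Ident C (MCar M))
       ((Ident C (Car B) \<boxdot>\<^bsub>C\<^esub> MAct M) \<cdot>\<^bsub>C\<^esub> Assoc C (Car B) (Car A) (MCar M))
       (MCar T) q \<and>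
     MAct T \<cdot>\<^bsub>C\<^esub> (Ident C (Car B) \<boxdot>\<^bsub>C\<^esub> q) \<cdot>\<^bsub>C\<^esub> Assoc C (Car B) (Car B) (MCar M) =
       q \<cdot>\<^bsub>C\<^esub> (Mul B \<boxdot>\<^bsub>C\<^esub> Ident C (MCar M))"

definition base_change ::
  "('o, 'm, 'x) smcat_scheme \<Rightarrow> ('o, 'm) monoid_object \<Rightarrow> ('o, 'm) monoid_object \<Rightarrow> 'm
     \<Rightarrow> ('o, 'm) module_object \<Rightarrow> ('o, 'm) module_object \<times> 'm" where
  "base_change C A B g M = (SOME Tq. is_base_change C A B g M (fst Tq) (snd Tq))"

definition base_change_arrow ::
  "('o, 'm, 'x) smcat_scheme \<Rightarrow> ('o, 'm) monoid_object \<Rightarrow> ('o, 'm) monoid_object \<Rightarrow> 'm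
     \<Rightarrow> ('o, 'm) module_object \<Rightarrow> ('o, 'm) module_object \<Rightarrow> 'm \<Rightarrow> 'm" where
  "base_change_arrow C A B g M N f =
     (THE h. h \<in> Hom (Mod_cat C B) (fst (base_change C A B g M)) (fst (base_change C A B g N)) \<and>
        h \<cdot>\<^bsub>C\<^esub> snd (base_change C A B g M) =
          snd (base_change C A B g N) \<cdot>\<^bsub>C\<^esub> (Ident C (Car B) \<boxdot>\<^bsub>C\<^esub> f))"

text \<open>The canonical isomorphism \<open>B \<otimes>\<^sub>A A \<cong> B\<close>.\<close>

definition base_change_self ::
  "('o, 'm, 'x) smcat_scheme \<Rightarrow> ('o, 'm) monoid_object \<Rightarrow> ('o, 'm) monoid_object \<Rightarrow> 'm \<Rightarrow> 'm" where
  "base_change_self C A B g =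
     (THE h. h \<in> Hom (Mod_cat C B) (fst (base_change C A B g (self_module A))) (self_module B) \<and>
        h \<cdot>\<^bsub>C\<^esub> snd (base_change C A B g (self_module A)) = Mul B \<cdot>\<^bsub>C\<^esub> (Ident C (Car B) \<boxdot>\<^bsub>C\<^esub> g))"

definition endo_ring_map ::
  "('o, 'm, 'x) smcat_scheme \<Rightarrow> ('o, 'm) monoid_object \<Rightarrow> ('o, 'm) monoid_object \<Rightarrow> 'm \<Rightarrow> 'm \<Rightarrow> 'm" where
  "endo_ring_map C A B g t =
     base_change_self C A B g \<cdot>\<^bsub>C\<^esub>
     base_change_arrow C A B g (self_module A) (self_module A) t \<cdot>\<^bsub>C\<^esub>
     inverse_arrow (Mod_cat C B) (fst (base_change C A B g (self_module A))) (self_module B)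
       (base_change_self C A B g)"


section \<open>Quotient monoids\<close>

text \<open>
  \<open>Q = A/tA\<close> with canonical morphism of monoids \<open>p : A \<rightarrow> Q\<close>: as an \<open>A\<close>-module, \<open>Q\<close> is the colimit
  of \<open>A \<leftarrow>t\<midarrow> A \<rightarrow> 0\<close>.
\<close>

definition is_principal_quotient ::
  "('o, 'm, 'x) smcat_scheme \<Rightarrow> ('o, 'm) monoid_object \<Rightarrow> 'm \<Rightarrow> ('o, 'm) monoid_object \<Rightarrow> 'm \<Rightarrow> bool" where
  "is_principal_quotient C A t Q p \<longleftrightarrow>
     Q \<in> Obj (Comm_cat C) \<and> p \<in> Hom (Comm_cat C) A Q \<and>
     (\<exists>Z z q. is_zero_object (Mod_cat C A) Z \<and>
        is_pushout (Mod_cat C A) (self_module A) (self_module A) Z t z (algebra_module C Q p) p q)"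

text \<open>\<open>B = A/I\<close> with canonical morphism \<open>b : A \<rightarrow> B\<close>.\<close>

definition is_ideal_quotient ::
  "('o, 'm, 'x) smcat_scheme \<Rightarrow> ('o, 'm) monoid_object \<Rightarrow> 'm set \<Rightarrow> ('o, 'm) monoid_object \<Rightarrow> 'm \<Rightarrow> bool" where
  "is_ideal_quotient C A I B b \<longleftrightarrow>
     (\<exists>Q p \<iota>. (\<forall>t\<in>I. is_principal_quotient C A t (Q t) (p t)) \<and>
        is_colimit (wide_span_category I) (Comm_cat C)
          (\<lambda>i. case i of None \<Rightarrow> A | Some t \<Rightarrow> Q t)
          (\<lambda>i j _. case (i, j) of (None, Some t) \<Rightarrow> p t
             | _ \<Rightarrow> Ident (Comm_cat C) (case i of None \<Rightarrow> A | Some t \<Rightarrow> Q t))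
          B \<iota> \<and>
        b = \<iota> None)"

end

theory Submission
  imports Defs
begin

text \<open>
  Let \<open>T\<close> consist of \<open>0\<close> and of generators of \<open>I\<close>. The quotient of \<open>A\<close> by \<open>I\<close> is the joint coequalizer
  \<open>b : A \<rightarrow> B\<close> of the finitely many parallel arrows in \<open>T\<close>: tensor products preserve it, so \<open>B\<close> is a
  monoid, and it is the colimit both of the wide span defining \<open>A/I\<close> in monoids and of the parallel
  arrows \<open>T\<close> in \<open>A\<close>-modules. The latter diagram has free objects, so (C1) identifies
  \<open>Hom(A, B)\<close> with the cokernel of \<open>\<E>(A)\<^sup>T \<rightarrow> \<E>(A)\<close>, which is \<open>\<E>(A)/I\<close>. Finally \<open>s \<mapsto> s \<cdot> b\<close> identifies
  \<open>\<E>(B)\<close> with \<open>Hom(A, B)\<close>, and the base change of \<open>t\<close> is the unique \<open>B\<close>-linear \<open>t'\<close> with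
  \<open>t' \<cdot> b = b \<cdot> t\<close>.
\<close>

section \<open>Joint coequalizers\<close>

text \<open>(C1) controls homomorphisms from \<open>A\<close> into colimits of finite diagrams of
  free modules, and \<open>\<boxtimes>\<close> is assumed to preserve colimits rather than sums of
  arrows. Both apply to one finite diagram, the parallel arrows of \<open>T\<close>; hence joint
  coequalizers instead of cokernels, and hence the need for finitely many generators. Adjoining
  \<open>0\<close> turns the condition that all arrows of \<open>T\<close> agree after
  \<open>b\<close> into the condition that \<open>b\<close> annihilates \<open>I\<close>, and keeps
  \<open>T\<close> nonempty when there are no generators. Identities between arrows out of
  \<open>B\<close> are verified after precomposition with \<open>b\<close> or its tensor products,
  which stay epic because tensoring preserves the coequalizer. What makes arrows descend to
  \<open>B\<close> is commutativity: endomorphisms of \<open>A\<close> commute with each other and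
  are linear in both factors of the multiplication. A second obstacle is that \<open>A/I\<close> is
  specified only up to isomorphism, and base change by a choice. In each case an explicit model is
  built, and its properties are carried to the given object by uniqueness of universal
  arrows.\<close>

definition is_joint_coequalizer ::
  "('o, 'm, 'x) cat_scheme \<Rightarrow> 'o \<Rightarrow> 'o \<Rightarrow> 'm set \<Rightarrow> 'o \<Rightarrow> 'm \<Rightarrow> bool" where
  "is_joint_coequalizer C X Y T Q q \<longleftrightarrow>
     X \<in> Obj C \<and> Y \<in> Obj C \<and> T \<subseteq> Hom C X Y \<and> Q \<in> Obj C \<and> q \<in> Hom C Y Q \<and>
     (\<forall>s\<in>T. \<forall>t\<in>T. q \<cdot>\<^bsub>C\<^esub> s = q \<cdot>\<^bsub>C\<^esub> t) \<and>
     (\<forall>W\<in>Obj C. \<forall>a\<in>Hom C Y W. (\<forall>s\<in>T. \<forall>t\<in>T. a \<cdot>\<^bsub>C\<^esub> s = a \<cdot>\<^bsub>C\<^esub> t) \<longrightarrow>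
        (\<exists>!h. h \<in> Hom C Q W \<and> h \<cdot>\<^bsub>C\<^esub> q = a))"

lemma joint_coequalizerI:
  assumes "X \<in> Obj C" "Y \<in> Obj C" "T \<subseteq> Hom C X Y" "Q \<in> Obj C" "q \<in> Hom C Y Q"
    and "\<And>s t. s \<in> T \<Longrightarrow> t \<in> T \<Longrightarrow> q \<cdot>\<^bsub>C\<^esub> s = q \<cdot>\<^bsub>C\<^esub> t"
    and "\<And>W a. W \<in> Obj C \<Longrightarrow> a \<in> Hom C Y W \<Longrightarrow> \<forall>s\<in>T. \<forall>t\<in>T. a \<cdot>\<^bsub>C\<^esub> s = a \<cdot>\<^bsub>C\<^esub> t \<Longrightarrow>
      \<exists>!h. h \<in> Hom C Q W \<and> h \<cdot>\<^bsub>C\<^esub> q = a"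
  shows "is_joint_coequalizer C X Y T Q q"
  unfolding is_joint_coequalizer_def by (intro conjI ballI impI assms(1-5)) (rule assms(6,7), assumption+)+

lemma joint_coequalizer_factor:
  assumes "is_joint_coequalizer C X Y T Q q" "W \<in> Obj C" "a \<in> Hom C Y W"
    and "\<And>s t. s \<in> T \<Longrightarrow> t \<in> T \<Longrightarrow> a \<cdot>\<^bsub>C\<^esub> s = a \<cdot>\<^bsub>C\<^esub> t"
  obtains h where "h \<in> Hom C Q W" "h \<cdot>\<^bsub>C\<^esub> q = a"
proof -
  from assms(1) have "\<forall>W\<in>Obj C. \<forall>a\<in>Hom C Y W. (\<forall>s\<in>T. \<forall>t\<in>T. a \<cdot>\<^bsub>C\<^esub> s = a \<cdot>\<^bsub>C\<^esub> t) \<longrightarrow>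
        (\<exists>!h. h \<in> Hom C Q W \<and> h \<cdot>\<^bsub>C\<^esub> q = a)"
    unfolding is_joint_coequalizer_def by (elim conjE)
  with assms(2-) have "\<exists>!h. h \<in> Hom C Q W \<and> h \<cdot>\<^bsub>C\<^esub> q = a"
    by blast
  then show thesis by (elim ex1E conjE) (rule that)
qed

lemma joint_coequalizerD:
  assumes "is_joint_coequalizer C X Y T Q q"
  shows "X \<in> Obj C" "Y \<in> Obj C" "T \<subseteq> Hom C X Y" "Q \<in> Obj C" "q \<in> Hom C Y Q"
    "\<And>s t. s \<in> T \<Longrightarrow> t \<in> T \<Longrightarrow> q \<cdot>\<^bsub>C\<^esub> s = q \<cdot>\<^bsub>C\<^esub> t"
  using assms unfolding is_joint_coequalizer_def by blast+

lemma epiD: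
  assumes "is_epi C X Y f" "W \<in> Obj C" "a \<in> Hom C Y W" "b \<in> Hom C Y W" "a \<cdot>\<^bsub>C\<^esub> f = b \<cdot>\<^bsub>C\<^esub> f"
  shows "a = b"
  using assms unfolding is_epi_def by simp

text \<open>The uniqueness half of the universal property suffices: \<open>a \<cdot> q\<close> again
  equates all arrows of \<open>T\<close>, and both \<open>a\<close> and \<open>b\<close> factor it
  through \<open>q\<close>.\<close>

lemma (in category) joint_coequalizer_epi:
  assumes "is_joint_coequalizer C X Y T Q q"
  shows "is_epi C Y Q q"
  unfolding is_epi_def
proof (intro ballI impI)
  fix W a b
  assume W: "W \<in> Obj C" and a: "a \<in> Hom C Q W" and b: "b \<in> Hom C Q W" and eq: "a \<cdot> q = b \<cdot> q"
  note q = joint_coequalizerD[OF assms]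
  have "(a \<cdot> q) \<cdot> s = (a \<cdot> q) \<cdot> t" if "s \<in> T" "t \<in> T" for s t
    using that q(1-5) q(6)[of s t] W a comp_assoc[of X Y Q W _ q a] by (simp add: subset_iff)
  moreover have "a \<cdot> q \<in> Hom C Y W"
    using q(1-5) W a comp_in_hom[of Y Q W q a] by simp
  moreover have "\<forall>W\<in>Obj C. \<forall>a\<in>Hom C Y W. (\<forall>s\<in>T. \<forall>t\<in>T. a \<cdot>\<^bsub>C\<^esub> s = a \<cdot>\<^bsub>C\<^esub> t) \<longrightarrow>
        (\<exists>!h. h \<in> Hom C Q W \<and> h \<cdot>\<^bsub>C\<^esub> q = a)"
    using assms unfolding is_joint_coequalizer_def by (elim conjE)
  ultimately have "\<exists>!h. h \<in> Hom C Q W \<and> h \<cdot> q = a \<cdot> q"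
    using W by blast
  then show "a = b"
    using a b eq by metis
qed

lemma (in category) joint_coequalizer_unique:
  assumes q: "is_joint_coequalizer C X Y T Q q" and q': "is_joint_coequalizer C X Y T Q' q'"
  obtains k l where "is_inverse C Q Q' k l" "k \<cdot> q = q'" "l \<cdot> q' = q"
proof -
  note obj = joint_coequalizerD[OF q] joint_coequalizerD[OF q']
  obtain k where k: "k \<in> Hom C Q Q'" "k \<cdot> q = q'"
    using joint_coequalizer_factor[OF q obj(10,11,12)] .
  obtain l where l: "l \<in> Hom C Q' Q" "l \<cdot> q' = q"
    using joint_coequalizer_factor[OF q' obj(4,5,6)] .
  have "(l \<cdot> k) \<cdot> q = Ident C Q \<cdot> q" "(k \<cdot> l) \<cdot> q' = Ident C Q' \<cdot> q'"
    using obj(2,4,5,10,11) k l by (simp_all add: comp_assoc[of Y Q Q' Q] comp_assoc[of Y Q' Q Q'] ident_left[of Y])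
  moreover have "l \<cdot> k \<in> Hom C Q Q" "k \<cdot> l \<in> Hom C Q' Q'"
    using k l comp_in_hom[of Q Q' Q] comp_in_hom[of Q' Q Q'] obj(4,10) by simp_all
  ultimately have "l \<cdot> k = Ident C Q" "k \<cdot> l = Ident C Q'"
    using epiD[OF joint_coequalizer_epi[OF q], of Q "l \<cdot> k" "Ident C Q"]
      epiD[OF joint_coequalizer_epi[OF q'], of Q' "k \<cdot> l" "Ident C Q'"] obj(4,10) ident_in_hom by simp_all
  with k l that show thesis
    unfolding is_inverse_def by blast
qed

text \<open>Principal and ideal quotients are known only up to isomorphism; this moves the
  coequalizer property from a constructed model to the given object.\<close>

lemma (in category) joint_coequalizer_iso:
  assumes q: "is_joint_coequalizer C X Y T Q q" and kl: "is_inverse C Q Q' k l" and Q': "Q' \<in> Obj C"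
  shows "is_joint_coequalizer C X Y T Q' (k \<cdot> q)"
proof -
  note obj = joint_coequalizerD(1-5)[OF q] and eq = joint_coequalizerD(6)[OF q]
  have k: "k \<in> Hom C Q Q'" and l: "l \<in> Hom C Q' Q" and lk: "l \<cdot> k = Ident C Q" and kl: "k \<cdot> l = Ident C Q'"
    using kl unfolding is_inverse_def by auto
  have "(k \<cdot> q) \<cdot> s = (k \<cdot> q) \<cdot> t" if "s \<in> T" "t \<in> T" for s t
    using that obj Q' k eq[of s t] comp_assoc[of X Y Q Q' _ q k] by (simp add: subset_iff)
  moreover have "\<exists>!h. h \<in> Hom C Q' W \<and> h \<cdot> (k \<cdot> q) = a"
    if W: "W \<in> Obj C" and a: "a \<in> Hom C Y W" and eqa: "\<forall>s\<in>T. \<forall>t\<in>T. a \<cdot> s = a \<cdot> t" for W a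
  proof (rule ex_ex1I)
    obtain g where g: "g \<in> Hom C Q W" "g \<cdot> q = a"
      using joint_coequalizer_factor[OF q W a] eqa by blast
    have "(g \<cdot> l) \<cdot> (k \<cdot> q) = g \<cdot> (l \<cdot> (k \<cdot> q))"
      using obj Q' k l g W comp_in_hom[of Y Q Q' q k] by (intro comp_assoc) auto
    also have "l \<cdot> (k \<cdot> q) = q"
      using obj lk Q' k l ident_left[of Y Q q] comp_assoc[of Y Q Q' Q q k l] by simp
    finally show "\<exists>h. h \<in> Hom C Q' W \<and> h \<cdot> (k \<cdot> q) = a"
      using g l obj Q' W comp_in_hom[of Q' Q W l g] by auto
  next
    fix h h' assume h: "h \<in> Hom C Q' W \<and> h \<cdot> (k \<cdot> q) = a" "h' \<in> Hom C Q' W \<and> h' \<cdot> (k \<cdot> q) = a"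
    then have "(h \<cdot> k) \<cdot> q = (h' \<cdot> k) \<cdot> q"
      using obj Q' k W comp_assoc[of Y Q Q' W q k] by simp
    then have "h \<cdot> k = h' \<cdot> k"
      using epiD[OF joint_coequalizer_epi[OF q] W] h k obj Q' W comp_in_hom[of Q Q' W k] by simp
    then have "h \<cdot> (k \<cdot> l) = h' \<cdot> (k \<cdot> l)"
      using h k l obj Q' W comp_assoc[of Q' Q Q' W l k] by metis
    then show "h = h'"
      using h kl Q' W ident_right[of Q' W] by simp
  qed
  ultimately show ?thesis
    using obj Q' k comp_in_hom[of Y Q Q' q k] unfolding is_joint_coequalizer_def by blast
qed

section \<open>Uniqueness of inverses and of colimits\<close>

lemma (in category) inverse_arrow_eq:
  assumes "is_inverse C X Y f g" "X \<in> Obj C" "Y \<in> Obj C"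
  shows "inverse_arrow C X Y f = g"
  unfolding inverse_arrow_def
proof (rule the_equality[where P = "is_inverse C X Y f"])
  fix h assume h: "is_inverse C X Y f h"
  have "(h \<cdot> f) \<cdot> g = h \<cdot> (f \<cdot> g)"
    using assms h comp_assoc[of Y X Y X g f h] unfolding is_inverse_def by simp
  then show "h = g"
    using assms h ident_left[of Y X g] ident_right[of Y X h] unfolding is_inverse_def by simp
qed (rule assms)

lemma colimit_ex1:
  assumes "is_colimit J C F G X \<iota>" "is_cocone J C F G Y \<kappa>"
  shows "\<exists>!h. h \<in> Hom C X Y \<and> (\<forall>i\<in>Obj J. h \<cdot>\<^bsub>C\<^esub> \<iota> i = \<kappa> i)"
  using assms unfolding is_colimit_def by blast

lemma (in category) colimit_unique:
  assumes q: "is_colimit J C F G X \<iota>" and q': "is_colimit J C F G X' \<iota>'"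
    and F: "\<And>i. i \<in> Obj J \<Longrightarrow> F i \<in> Obj C"
  obtains k l where "is_inverse C X X' k l" "\<And>i. i \<in> Obj J \<Longrightarrow> k \<cdot> \<iota> i = \<iota>' i"
proof -
  have cc: "is_cocone J C F G X \<iota>" "is_cocone J C F G X' \<iota>'"
    using q q' unfolding is_colimit_def by simp_all
  have obj: "X \<in> Obj C" "X' \<in> Obj C" "\<And>i. i \<in> Obj J \<Longrightarrow> \<iota> i \<in> Hom C (F i) X" "\<And>i. i \<in> Obj J \<Longrightarrow> \<iota>' i \<in> Hom C (F i) X'"
    using cc unfolding is_cocone_def by simp_all
  obtain k where k: "k \<in> Hom C X X'" "\<And>i. i \<in> Obj J \<Longrightarrow> k \<cdot> \<iota> i = \<iota>' i"
    using q cc unfolding is_colimit_def by metis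
  obtain l where l: "l \<in> Hom C X' X" "\<And>i. i \<in> Obj J \<Longrightarrow> l \<cdot> \<iota>' i = \<iota> i"
    using q' cc unfolding is_colimit_def by metis
  have "(l \<cdot> k) \<cdot> \<iota> i = \<iota> i" if "i \<in> Obj J" for i
    using that obj k l F by (simp add: comp_assoc[of "F i" X X' X])
  moreover have "Ident C X \<cdot> \<iota> i = \<iota> i" if "i \<in> Obj J" for i
    using that obj F ident_left[of "F i" X] by simp
  moreover have "l \<cdot> k \<in> Hom C X X" "Ident C X \<in> Hom C X X"
    using obj k l comp_in_hom[of X X' X k l] ident_in_hom by simp_all
  ultimately have lk: "l \<cdot> k = Ident C X"
    using q cc(1) unfolding is_colimit_def by metis
  have "(k \<cdot> l) \<cdot> \<iota>' i = \<iota>' i" if "i \<in> Obj J" for i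
    using that obj k l F by (simp add: comp_assoc[of "F i" X' X X'])
  moreover have "Ident C X' \<cdot> \<iota>' i = \<iota>' i" if "i \<in> Obj J" for i
    using that obj F ident_left[of "F i" X'] by simp
  moreover have "k \<cdot> l \<in> Hom C X' X'" "Ident C X' \<in> Hom C X' X'"
    using obj k l comp_in_hom[of X' X X' l k] ident_in_hom by simp_all
  ultimately have "k \<cdot> l = Ident C X'"
    using q' cc(2) unfolding is_colimit_def by metis
  with k l lk that show thesis
    unfolding is_inverse_def by blast
qed


subsection \<open>Joint coequalizers as colimits\<close>

text \<open>One of two composable arrows is always an identity, represented by \<open>x\<close>.\<close>

definition parallel_category :: "'u \<Rightarrow> 'u \<Rightarrow> 'u set \<Rightarrow> ('u, 'u) cat" where
  "parallel_category x y N =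
     \<lparr>Obj = {x, y},
      Hom = (\<lambda>i j. if i = j then {x} else if i = x \<and> j = y then N else {}),
      Ident = (\<lambda>_. x),
      Comp = (\<lambda>v u. if u = x then v else u)\<rparr>"

lemma Obj_parallel_category [simp]: "Obj (parallel_category x y N) = {x, y}"
  by (simp add: parallel_category_def)

lemma category_parallel_category: "category (parallel_category x y N)"
  by standard (auto simp: parallel_category_def split: if_splits)

lemma finite_parallel_category: "finite N \<Longrightarrow> finite_category (parallel_category x y N)"
  using category_parallel_category[of x y N]
  by (auto simp: finite_category_def parallel_category_def)

lemma small_finite_category:
  fixes J :: "('u, 'u) cat"
  assumes "infinite (UNIV :: 'u set)" "finite_category J"
  shows "small_category J"
  using assms unfolding small_category_def finite_category_def
  by (auto intro!: finite_lesspoll_infinite finite_SigmaI)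

lemma (in category) functor_parallel_category:
  assumes "x \<noteq> y" "X \<in> Obj C" "Y \<in> Obj C" "d ` N \<subseteq> Hom C X Y"
  shows "is_functor (parallel_category x y N) C (\<lambda>i. if i = x then X else Y)
    (\<lambda>i j u. if i = j then Ident C (if i = x then X else Y) else d u)"
  using assms ident_in_hom ident_left ident_right
  by (auto simp: is_functor_def parallel_category_def split: if_splits)

text \<open>A cocone on the parallel diagram is determined by its component at \<open>y\<close>: the
  arrow labelled \<open>u0\<close> forces the component at \<open>x\<close> to be
  \<open>\<iota> y \<cdot> G x y u0\<close>. Without any label the object \<open>F x\<close> would
  contribute a summand of its own.\<close>

lemma (in category) parallel_colimit_joint_coequalizer:
  assumes colim: "is_colimit (parallel_category x y N) C F G Q \<iota>"
    and F: "is_functor (parallel_category x y N) C F G"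
    and xy: "x \<noteq> y" and N: "u0 \<in> N"
  shows "is_joint_coequalizer C (F x) (F y) (G x y ` N) Q (\<iota> y)"
proof -
  have obj: "F x \<in> Obj C" "F y \<in> Obj C" "G x y ` N \<subseteq> Hom C (F x) (F y)"
    and id: "G x x x = Ident C (F x)" "G y y x = Ident C (F y)"
    using F xy by (auto simp: is_functor_def parallel_category_def)
  have cc: "Q \<in> Obj C" "\<iota> x \<in> Hom C (F x) Q" "\<iota> y \<in> Hom C (F y) Q"
    "\<And>u. u \<in> N \<Longrightarrow> \<iota> y \<cdot> G x y u = \<iota> x"
    using colim xy by (auto simp: is_colimit_def is_cocone_def parallel_category_def)
  have "\<exists>!h. h \<in> Hom C Q W \<and> h \<cdot> \<iota> y = a"
    if W: "W \<in> Obj C" and a: "a \<in> Hom C (F y) W"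
      and eq: "\<forall>s\<in>G x y ` N. \<forall>t\<in>G x y ` N. a \<cdot> s = a \<cdot> t" for W a
  proof -
    let ?\<kappa> = "\<lambda>i. if i = y then a else a \<cdot> G x y u0"
    have "a \<cdot> G x y u0 \<in> Hom C (F x) W"
      using obj W a N by (intro comp_in_hom[of _ "F y"]) auto
    moreover have "a \<cdot> G x y u = a \<cdot> G x y u0" if "u \<in> N" for u
      using eq that N by blast
    ultimately have "is_cocone (parallel_category x y N) C F G W ?\<kappa>"
      using W a obj id xy
      by (auto simp: is_cocone_def parallel_category_def ident_right intro!: ident_right)
    from colimit_ex1[OF colim this]
    have ex: "\<exists>!h. h \<in> Hom C Q W \<and> (\<forall>i\<in>{x,y}. h \<cdot> \<iota> i = ?\<kappa> i)"
      by simp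
    have "(\<forall>i\<in>{x,y}. h \<cdot> \<iota> i = ?\<kappa> i) \<longleftrightarrow> h \<cdot> \<iota> y = a" if h: "h \<in> Hom C Q W" for h
    proof -
      have "h \<cdot> \<iota> x = (h \<cdot> \<iota> y) \<cdot> G x y u0"
        using h cc(1-3) cc(4)[OF N] obj N W comp_assoc[of "F x" "F y" Q W "G x y u0" "\<iota> y" h]
        by (simp add: image_subset_iff)
      then show ?thesis using xy by auto
    qed
    with ex show ?thesis by (metis (no_types, lifting))
  qed
  moreover have "\<iota> y \<cdot> s = \<iota> y \<cdot> t" if "s \<in> G x y ` N" "t \<in> G x y ` N" for s t
    using that cc(4) by auto
  ultimately show ?thesis
    by (intro joint_coequalizerI obj cc(1,3))
qed

text \<open>The converse translation serves because preservation by \<open>\<boxtimes>\<close> and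
  (C1) are both formulated for colimits of diagrams. Any label can define the component at
  \<open>x\<close>; the choice of \<open>u0\<close> is left open.\<close>

lemma (in category) joint_coequalizer_parallel_colimit:
  assumes jc: "is_joint_coequalizer C (F x) (F y) (G x y ` N) Q q"
    and F: "is_functor (parallel_category x y N) C F G"
    and xy: "x \<noteq> y" and N: "u0 \<in> N"
  shows "is_colimit (parallel_category x y N) C F G Q (\<lambda>i. if i = y then q else q \<cdot> G x y u0)"
proof -
  have obj: "F x \<in> Obj C" "F y \<in> Obj C" "G x y ` N \<subseteq> Hom C (F x) (F y)"
    and id: "G x x x = Ident C (F x)" "G y y x = Ident C (F y)"
    using F xy by (auto simp: is_functor_def parallel_category_def)
  have q: "Q \<in> Obj C" "q \<in> Hom C (F y) Q" "\<And>u. u \<in> N \<Longrightarrow> q \<cdot> G x y u = q \<cdot> G x y u0"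
    using joint_coequalizerD[OF jc] N by blast+
  have qu: "q \<cdot> G x y u0 \<in> Hom C (F x) Q"
    using obj q N by (intro comp_in_hom[of _ "F y"]) auto
  then have "is_cocone (parallel_category x y N) C F G Q (\<lambda>i. if i = y then q else q \<cdot> G x y u0)"
    using q obj id xy by (auto simp: is_cocone_def parallel_category_def intro!: ident_right)
  moreover have "\<exists>!h. h \<in> Hom C Q W \<and> (\<forall>i\<in>{x,y}. h \<cdot> (if i = y then q else q \<cdot> G x y u0) = \<kappa> i)"
    if \<kappa>: "is_cocone (parallel_category x y N) C F G W \<kappa>" for W \<kappa>
  proof -
    have W: "W \<in> Obj C" "\<kappa> y \<in> Hom C (F y) W" "\<And>u. u \<in> N \<Longrightarrow> \<kappa> y \<cdot> G x y u = \<kappa> x"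
      using \<kappa> xy by (auto simp: is_cocone_def parallel_category_def)
    then have ex: "\<exists>!h. h \<in> Hom C Q W \<and> h \<cdot> q = \<kappa> y"
      using jc unfolding is_joint_coequalizer_def by auto
    have "(\<forall>i\<in>{x,y}. h \<cdot> (if i = y then q else q \<cdot> G x y u0) = \<kappa> i) \<longleftrightarrow> h \<cdot> q = \<kappa> y" if h: "h \<in> Hom C Q W" for h
    proof -
      have "h \<cdot> (q \<cdot> G x y u0) = (h \<cdot> q) \<cdot> G x y u0"
        using h q(1,2) obj N W comp_assoc[of "F x" "F y" Q W "G x y u0" q h] by (simp add: image_subset_iff)
      then show ?thesis using xy W N by auto
    qed
    with ex show ?thesis by (metis (no_types, lifting))
  qed
  ultimately show ?thesis
    by (auto simp: is_colimit_def parallel_category_def)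
qed

text \<open>Diagrams in the hypotheses have indices and arrows in \<open>'u\<close>, whereas
  \<open>T\<close> consists of arrows of \<open>C\<close>. A finite \<open>T\<close> is relabelled
  by equally many elements of the infinite type \<open>'u\<close>; \<open>x\<close> and
  \<open>y\<close> become the two objects.\<close>

lemma obtain_parallel_index:
  fixes T :: "'m set"
  assumes "infinite (UNIV :: 'u set)" "finite T"
  obtains x y :: 'u and N :: "'u set" and d :: "'u \<Rightarrow> 'm" where "x \<noteq> y" "finite N" "d ` N = T"
proof -
  obtain x y :: 'u where "x \<noteq> y"
    using assms(1) by (metis (full_types) UNIV_eq_I finite.emptyI finite_insert insertI1)
  moreover obtain N :: "'u set" where N: "finite N" "card N = card T"
    using infinite_arbitrarily_large[OF assms(1)] by blast
  then obtain d where "d ` N = T"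
    using finite_same_card_bij[OF N(1) assms(2)] unfolding bij_betw_def by blast
  ultimately show thesis using N that by blast
qed

section \<open>Arrows with explicit domain and codomain\<close>

text \<open>
  Arrows of \<open>C\<close> do not determine their domain and codomain. Carrying both along makes the
  side conditions of the categorical laws ground equations, which the simplifier can decide.
\<close>

datatype ('o, 'm) arrow = Arrow (adom: 'o) (acod: 'o) (araw: 'm)

context symmetric_monoidal_category
begin

definition arr :: "('o, 'm) arrow \<Rightarrow> bool" where
  "arr f \<longleftrightarrow> adom f \<in> Obj C \<and> acod f \<in> Obj C \<and> araw f \<in> Hom C (adom f) (acod f)"

definition acomp :: "('o, 'm) arrow \<Rightarrow> ('o, 'm) arrow \<Rightarrow> ('o, 'm) arrow" (infixr \<open>\<bullet>\<close> 70) where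
  "g \<bullet> f = Arrow (adom f) (acod g) (araw g \<cdot> araw f)"

definition atens :: "('o, 'm) arrow \<Rightarrow> ('o, 'm) arrow \<Rightarrow> ('o, 'm) arrow" (infixr \<open>\<star>\<close> 80) where
  "f \<star> g = Arrow (adom f \<boxtimes> adom g) (acod f \<boxtimes> acod g) (araw f \<boxdot> araw g)"

definition idt :: "'o \<Rightarrow> ('o, 'm) arrow" where
  "idt X = Arrow X X (Ident C X)"

definition asc :: "'o \<Rightarrow> 'o \<Rightarrow> 'o \<Rightarrow> ('o, 'm) arrow" where
  "asc X Y Z = Arrow ((X \<boxtimes> Y) \<boxtimes> Z) (X \<boxtimes> Y \<boxtimes> Z) (Assoc C X Y Z)"

definition lun :: "'o \<Rightarrow> ('o, 'm) arrow" where
  "lun X = Arrow (UnitObj C \<boxtimes> X) X (LUnit C X)"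

definition run :: "'o \<Rightarrow> ('o, 'm) arrow" where
  "run X = Arrow (X \<boxtimes> UnitObj C) X (RUnit C X)"

definition brd :: "'o \<Rightarrow> 'o \<Rightarrow> ('o, 'm) arrow" where
  "brd X Y = Arrow (X \<boxtimes> Y) (Y \<boxtimes> X) (Braid C X Y)"

lemma arr_Arrow [simp]: "arr (Arrow X Y f) \<longleftrightarrow> X \<in> Obj C \<and> Y \<in> Obj C \<and> f \<in> Hom C X Y"
  by (simp add: arr_def)

lemma arr_obj: "arr f \<Longrightarrow> adom f \<in> Obj C" "arr f \<Longrightarrow> acod f \<in> Obj C"
  by (simp_all add: arr_def)

lemma adom_acod_simps [simp]:
  "adom (g \<bullet> f) = adom f" "acod (g \<bullet> f) = acod g"
  "adom (f \<star> g) = adom f \<boxtimes> adom g" "acod (f \<star> g) = acod f \<boxtimes> acod g"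
  "adom (idt X) = X" "acod (idt X) = X"
  "adom (asc X Y Z) = (X \<boxtimes> Y) \<boxtimes> Z" "acod (asc X Y Z) = X \<boxtimes> Y \<boxtimes> Z"
  "adom (lun X) = UnitObj C \<boxtimes> X" "acod (lun X) = X"
  "adom (run X) = X \<boxtimes> UnitObj C" "acod (run X) = X"
  "adom (brd X Y) = X \<boxtimes> Y" "acod (brd X Y) = Y \<boxtimes> X"
  by (simp_all add: acomp_def atens_def idt_def asc_def lun_def run_def brd_def)

declare unit_obj [simp] tensor_obj [simp]

lemma arr_idt [simp]: "X \<in> Obj C \<Longrightarrow> arr (idt X)"
  by (simp add: idt_def ident_in_hom)

lemma arr_acomp [simp]: "arr f \<Longrightarrow> arr g \<Longrightarrow> acod f = adom g \<Longrightarrow> arr (g \<bullet> f)"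
  using comp_in_hom[of "adom f" "acod f" "acod g" "araw f" "araw g"] by (simp add: arr_def acomp_def)

lemma arr_atens [simp]: "arr f \<Longrightarrow> arr g \<Longrightarrow> arr (f \<star> g)"
  by (simp add: arr_def atens_def tensor_arrow)

lemma arr_structure [simp]:
  "X \<in> Obj C \<Longrightarrow> Y \<in> Obj C \<Longrightarrow> Z \<in> Obj C \<Longrightarrow> arr (asc X Y Z)"
  "X \<in> Obj C \<Longrightarrow> arr (lun X)" "X \<in> Obj C \<Longrightarrow> arr (run X)"
  "X \<in> Obj C \<Longrightarrow> Y \<in> Obj C \<Longrightarrow> arr (brd X Y)"
  using assoc_iso[of X Y Z] lunit_iso[of X] runit_iso[of X] braid_arrow[of X Y]
  by (auto simp: asc_def lun_def run_def brd_def is_iso_arrow_def is_inverse_def)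

lemma acomp_assoc [simp]:
  "arr f \<Longrightarrow> arr g \<Longrightarrow> arr h \<Longrightarrow> acod f = adom g \<Longrightarrow> acod g = adom h \<Longrightarrow> (h \<bullet> g) \<bullet> f = h \<bullet> g \<bullet> f"
  using comp_assoc[of "adom f" "acod f" "acod g" "acod h" "araw f" "araw g" "araw h"]
  by (simp add: acomp_def arr_def)

lemma acomp_idt [simp]:
  "arr f \<Longrightarrow> X = acod f \<Longrightarrow> idt X \<bullet> f = f" "arr f \<Longrightarrow> X = adom f \<Longrightarrow> f \<bullet> idt X = f"
  using ident_left[of "adom f" "acod f" "araw f"] ident_right[of "adom f" "acod f" "araw f"]
  by (cases f; simp add: acomp_def idt_def)+

lemma atens_idt [simp]: "X \<in> Obj C \<Longrightarrow> Y \<in> Obj C \<Longrightarrow> idt X \<star> idt Y = idt (X \<boxtimes> Y)"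
  by (simp add: atens_def idt_def tensor_ident)

text \<open>The interchange law is oriented so that tensor products of composites are the normal
  form. As composites nest to the right, the second equation is needed to fuse two factors that are
  preceded by a further arrow \<open>h\<close>.\<close>

lemma atens_acomp [simp]:
  assumes "arr f" "arr f'" "arr g" "arr g'" "acod f = adom f'" "acod g = adom g'"
  shows "(f' \<star> g') \<bullet> (f \<star> g) = (f' \<bullet> f) \<star> (g' \<bullet> g)"
    and "arr h \<Longrightarrow> acod h = adom f \<boxtimes> adom g \<Longrightarrow> (f' \<star> g') \<bullet> (f \<star> g) \<bullet> h = (f' \<bullet> f) \<star> (g' \<bullet> g) \<bullet> h"
proof -
  show *: "(f' \<star> g') \<bullet> (f \<star> g) = (f' \<bullet> f) \<star> (g' \<bullet> g)"
    using assms tensor_comp[of "adom f" "acod f" "acod f'" "adom g" "acod g" "acod g'" "araw f" "araw f'" "araw g" "araw g'"]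
    by (simp add: acomp_def atens_def arr_def)
  show "(f' \<star> g') \<bullet> (f \<star> g) \<bullet> h = (f' \<bullet> f) \<star> (g' \<bullet> g) \<bullet> h" if "arr h" "acod h = adom f \<boxtimes> adom g"
    using that assms by (simp flip: acomp_assoc add: *)
qed

lemma asc_natural:
  assumes "arr f" "arr g" "arr h"
  shows "asc (acod f) (acod g) (acod h) \<bullet> ((f \<star> g) \<star> h) = (f \<star> g \<star> h) \<bullet> asc (adom f) (adom g) (adom h)"
  using assms assoc_natural[of "adom f" "acod f" "adom g" "acod g" "adom h" "acod h" "araw f" "araw g" "araw h"]
  by (simp add: acomp_def atens_def arr_def asc_def)

lemma lun_natural:
  assumes "arr f"
  shows "lun (acod f) \<bullet> (idt (UnitObj C) \<star> f) = f \<bullet> lun (adom f)"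
  using assms lunit_natural[of "adom f" "acod f" "araw f"]
  by (simp add: acomp_def atens_def arr_def lun_def idt_def)

lemma run_natural:
  assumes "arr f"
  shows "run (acod f) \<bullet> (f \<star> idt (UnitObj C)) = f \<bullet> run (adom f)"
  using assms runit_natural[of "adom f" "acod f" "araw f"]
  by (simp add: acomp_def atens_def arr_def run_def idt_def)

lemma brd_natural:
  assumes "arr f" "arr g"
  shows "brd (acod f) (acod g) \<bullet> (f \<star> g) = (g \<star> f) \<bullet> brd (adom f) (adom g)"
  using assms braid_natural[of "adom f" "acod f" "adom g" "acod g" "araw f" "araw g"]
  by (simp add: acomp_def atens_def arr_def brd_def)

lemma brd_brd [simp]: "X \<in> Obj C \<Longrightarrow> Y \<in> Obj C \<Longrightarrow> brd Y X \<bullet> brd X Y = idt (X \<boxtimes> Y)"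
  by (simp add: acomp_def brd_def idt_def braid_symmetric)

lemma asc_pentagon:
  assumes "W \<in> Obj C" "X \<in> Obj C" "Y \<in> Obj C" "Z \<in> Obj C"
  shows "asc W X (Y \<boxtimes> Z) \<bullet> asc (W \<boxtimes> X) Y Z =
    (idt W \<star> asc X Y Z) \<bullet> asc W (X \<boxtimes> Y) Z \<bullet> (asc W X Y \<star> idt Z)"
  using assms pentagon[of W X Y Z] by (simp add: acomp_def atens_def asc_def idt_def)

lemma asc_triangle:
  assumes "X \<in> Obj C" "Y \<in> Obj C"
  shows "(idt X \<star> lun Y) \<bullet> asc X (UnitObj C) Y = run X \<star> idt Y"
  using assms triangle[of X Y] by (simp add: acomp_def atens_def asc_def idt_def lun_def run_def)

lemma iso_arrowE:
  assumes "is_iso_arrow C (adom f) (acod f) (araw f)" "arr f"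
  obtains g where "arr g" "adom g = acod f" "acod g = adom f" "g \<bullet> f = idt (adom f)" "f \<bullet> g = idt (acod f)"
proof -
  obtain g where g: "is_inverse C (adom f) (acod f) (araw f) g"
    using assms unfolding is_iso_arrow_def by blast
  show thesis
    by (rule that[of "Arrow (acod f) (adom f) g"])
      (use g assms(2) in \<open>auto simp: is_inverse_def acomp_def idt_def arr_obj\<close>)
qed

declare arr_obj [simp]

section \<open>Epimorphisms and the right unit constraint of a tensor product\<close>

definition epic :: "('o, 'm) arrow \<Rightarrow> bool" where
  "epic q \<longleftrightarrow> arr q \<and> is_epi C (adom q) (acod q) (araw q)"

lemma epic_arr: "epic q \<Longrightarrow> arr q"
  by (simp add: epic_def)

lemma epic_cancel:
  assumes "epic q" "a \<bullet> q = b \<bullet> q" "arr a" "arr b" "adom a = acod q" "adom b = acod q"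
  shows "a = b"
proof -
  have "araw a \<cdot> araw q = araw b \<cdot> araw q" "acod a = acod b"
    using assms(2) by (simp_all add: acomp_def)
  then show ?thesis
    using assms epiD[of C "adom q" "acod q" "araw q" "acod a" "araw a" "araw b"]
    by (simp add: epic_def arr_def arrow.expand del: arr_obj)
qed

lemma epicI:
  assumes "arr q"
    and "\<And>a b. arr a \<Longrightarrow> arr b \<Longrightarrow> adom a = acod q \<Longrightarrow> adom b = acod q \<Longrightarrow> acod a = acod b \<Longrightarrow>
      a \<bullet> q = b \<bullet> q \<Longrightarrow> a = b"
  shows "epic q"
  unfolding epic_def is_epi_def
proof (intro conjI ballI impI)
  fix W a b assume "W \<in> Obj C" "a \<in> Hom C (acod q) W" "b \<in> Hom C (acod q) W" "a \<cdot> araw q = b \<cdot> araw q"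
  then show "a = b"
    using assms(1) assms(2)[of "Arrow (acod q) W a" "Arrow (acod q) W b"] by (simp add: acomp_def)
qed (rule assms(1))

lemma epic_split:
  assumes "arr q" "arr s" "acod s = adom q" "q \<bullet> s = idt (acod q)"
  shows "epic q"
proof (rule epicI[OF assms(1)])
  fix a b assume ab: "arr a" "arr b" "adom a = acod q" "adom b = acod q" "a \<bullet> q = b \<bullet> q"
  have "adom s = acod q"
    using arg_cong[OF assms(4), of adom] by simp
  then have "(a \<bullet> q) \<bullet> s = a" "(b \<bullet> q) \<bullet> s = b"
    using ab(1-4) assms by simp_all
  then show "a = b" using ab(5) by metis
qed

lemma epic_acomp:
  assumes "epic f" "epic g" "acod f = adom g"
  shows "epic (g \<bullet> f)"
proof (rule epicI)
  show "arr (g \<bullet> f)"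
    using assms by (simp add: epic_arr)
  fix a b assume ab: "arr a" "arr b" "adom a = acod (g \<bullet> f)" "adom b = acod (g \<bullet> f)" "a \<bullet> g \<bullet> f = b \<bullet> g \<bullet> f"
  then have "(a \<bullet> g) \<bullet> f = (b \<bullet> g) \<bullet> f"
    using assms by (simp add: epic_arr)
  then have "a \<bullet> g = b \<bullet> g"
    by (rule epic_cancel[OF assms(1)]) (use ab assms in \<open>simp_all add: epic_arr\<close>)
  then show "a = b"
    by (rule epic_cancel[OF assms(2)]) (use ab in simp_all)
qed

lemma epic_asc:
  assumes "X \<in> Obj C" "Y \<in> Obj C" "Z \<in> Obj C"
  shows "epic (asc X Y Z)"
proof -
  have "is_iso_arrow C (adom (asc X Y Z)) (acod (asc X Y Z)) (araw (asc X Y Z))"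
    using assms by (simp add: asc_def assoc_iso)
  then show ?thesis
    using assms by (elim iso_arrowE) (auto intro: epic_split)
qed

lemma run_inverse:
  assumes "X \<in> Obj C"
  obtains r where "arr r" "adom r = X" "acod r = X \<boxtimes> UnitObj C" "r \<bullet> run X = idt (X \<boxtimes> UnitObj C)" "run X \<bullet> r = idt X"
proof -
  have "is_iso_arrow C (adom (run X)) (acod (run X)) (araw (run X))"
    using assms by (simp add: run_def runit_iso)
  then show thesis
    using assms by (elim iso_arrowE) (auto intro: that)
qed

lemma epic_brd: "X \<in> Obj C \<Longrightarrow> Y \<in> Obj C \<Longrightarrow> epic (brd X Y)"
  by (rule epic_split[of _ "brd Y X"]) simp_all

lemma asc_mono:
  assumes "arr f" "arr g" "X \<in> Obj C" "Y \<in> Obj C" "Z \<in> Obj C" "acod f = (X \<boxtimes> Y) \<boxtimes> Z" "acod g = (X \<boxtimes> Y) \<boxtimes> Z"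
    and "asc X Y Z \<bullet> f = asc X Y Z \<bullet> g"
  shows "f = g"
proof -
  have "is_iso_arrow C (adom (asc X Y Z)) (acod (asc X Y Z)) (araw (asc X Y Z))"
    using assms by (simp add: asc_def assoc_iso)
  then obtain a where a: "arr a" "adom a = X \<boxtimes> Y \<boxtimes> Z" "acod a = (X \<boxtimes> Y) \<boxtimes> Z" "a \<bullet> asc X Y Z = idt ((X \<boxtimes> Y) \<boxtimes> Z)"
    using assms by (elim iso_arrowE) auto
  have "(a \<bullet> asc X Y Z) \<bullet> f = (a \<bullet> asc X Y Z) \<bullet> g"
    using assms a(1-3) by simp
  then show ?thesis
    using assms a by simp
qed

text \<open>Kelly's argument: it suffices to compare both sides after applying \<open>- \<boxtimes> 1\<close>.\<close>

lemma run_tensor: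
  assumes X: "X \<in> Obj C" and Y: "Y \<in> Obj C"
  shows "run (X \<boxtimes> Y) = (idt X \<star> run Y) \<bullet> asc X Y (UnitObj C)"
proof -
  let ?U = "UnitObj C" let ?r = "(idt X \<star> run Y) \<bullet> asc X Y (UnitObj C)"
  have "asc X Y ?U \<bullet> (run (X \<boxtimes> Y) \<star> idt ?U) = asc X Y ?U \<bullet> (idt (X \<boxtimes> Y) \<star> lun ?U) \<bullet> asc (X \<boxtimes> Y) ?U ?U"
    using X Y by (simp add: asc_triangle)
  also have "\<dots> = (asc X Y ?U \<bullet> ((idt X \<star> idt Y) \<star> lun ?U)) \<bullet> asc (X \<boxtimes> Y) ?U ?U"
    using X Y by simp
  also have "asc X Y ?U \<bullet> ((idt X \<star> idt Y) \<star> lun ?U) = (idt X \<star> idt Y \<star> lun ?U) \<bullet> asc X Y (?U \<boxtimes> ?U)"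
    using asc_natural[of "idt X" "idt Y" "lun ?U"] X Y by simp
  also have "\<dots> \<bullet> asc (X \<boxtimes> Y) ?U ?U = (idt X \<star> idt Y \<star> lun ?U) \<bullet> (asc X Y (?U \<boxtimes> ?U) \<bullet> asc (X \<boxtimes> Y) ?U ?U)"
    using X Y by simp
  also have "\<dots> = ((idt X \<star> idt Y \<star> lun ?U) \<bullet> (idt X \<star> asc Y ?U ?U)) \<bullet> asc X (Y \<boxtimes> ?U) ?U \<bullet> (asc X Y ?U \<star> idt ?U)"
    using X Y by (simp add: asc_pentagon)
  also have "(idt X \<star> idt Y \<star> lun ?U) \<bullet> (idt X \<star> asc Y ?U ?U) = idt X \<star> run Y \<star> idt ?U"
    using X Y by (simp add: asc_triangle)
  also have "\<dots> \<bullet> asc X (Y \<boxtimes> ?U) ?U \<bullet> (asc X Y ?U \<star> idt ?U) =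
      (asc X Y ?U \<bullet> ((idt X \<star> run Y) \<star> idt ?U)) \<bullet> (asc X Y ?U \<star> idt ?U)"
    using asc_natural[of "idt X" "run Y" "idt ?U"] X Y by simp
  also have "\<dots> = asc X Y ?U \<bullet> (?r \<star> idt ?U)"
    using X Y by simp
  finally have *: "run (X \<boxtimes> Y) \<star> idt ?U = ?r \<star> idt ?U"
    by (rule asc_mono[rotated 7]) (use X Y in simp_all)
  \<comment> \<open>Naturality of \<open>run\<close> turns the equality after tensoring with the
    unit object into one after precomposition with the isomorphism
    \<open>run ((X \<boxtimes> Y) \<boxtimes> ?U)\<close>, which can be cancelled.\<close>
  have "run (X \<boxtimes> Y) \<bullet> run ((X \<boxtimes> Y) \<boxtimes> ?U) = run (X \<boxtimes> Y) \<bullet> (run (X \<boxtimes> Y) \<star> idt ?U)"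
    using run_natural[of "run (X \<boxtimes> Y)"] X Y by simp
  also have "\<dots> = ?r \<bullet> run ((X \<boxtimes> Y) \<boxtimes> ?U)"
    unfolding * using run_natural[of ?r] X Y by simp
  finally have **: "run (X \<boxtimes> Y) \<bullet> run ((X \<boxtimes> Y) \<boxtimes> ?U) = ?r \<bullet> run ((X \<boxtimes> Y) \<boxtimes> ?U)" .
  obtain r where "arr r" "adom r = (X \<boxtimes> Y) \<boxtimes> ?U" "acod r = ((X \<boxtimes> Y) \<boxtimes> ?U) \<boxtimes> ?U"
    "run ((X \<boxtimes> Y) \<boxtimes> ?U) \<bullet> r = idt ((X \<boxtimes> Y) \<boxtimes> ?U)"
    using X Y run_inverse[of "(X \<boxtimes> Y) \<boxtimes> ?U"] by auto
  then have "epic (run ((X \<boxtimes> Y) \<boxtimes> ?U))"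
    using X Y by (intro epic_split[of _ r]) simp_all
  then show ?thesis
    by (rule epic_cancel[OF _ **]) (use X Y in simp_all)
qed

end

section \<open>Monoids and modules\<close>

context symmetric_monoidal_category
begin

text \<open>\<open>mm\<close>, \<open>uu\<close>, \<open>act\<close>, \<open>bar\<close> and
  \<open>mar\<close> lift structure arrows and homomorphisms to the type \<open>arrow\<close>, where
  diagram chases run by simplification; \<open>araw\<close> leads back to \<open>C\<close>.\<close>

definition mm :: "('o, 'm) monoid_object \<Rightarrow> ('o, 'm) arrow" where
  "mm A = Arrow (Car A \<boxtimes> Car A) (Car A) (Mul A)"

definition uu :: "('o, 'm) monoid_object \<Rightarrow> ('o, 'm) arrow" where
  "uu A = Arrow (UnitObj C) (Car A) (Unt A)"

definition act :: "('o, 'm) monoid_object \<Rightarrow> ('o, 'm) module_object \<Rightarrow> ('o, 'm) arrow" where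
  "act A M = Arrow (Car A \<boxtimes> MCar M) (MCar M) (MAct M)"

definition bar :: "('o, 'm) monoid_object \<Rightarrow> ('o, 'm) monoid_object \<Rightarrow> 'm \<Rightarrow> ('o, 'm) arrow" where
  "bar A B f = Arrow (Car A) (Car B) f"

definition mar :: "('o, 'm) module_object \<Rightarrow> ('o, 'm) module_object \<Rightarrow> 'm \<Rightarrow> ('o, 'm) arrow" where
  "mar M N f = Arrow (MCar M) (MCar N) f"

lemma adom_acod_monoid [simp]:
  "adom (mm A) = Car A \<boxtimes> Car A" "acod (mm A) = Car A"
  "adom (uu A) = UnitObj C" "acod (uu A) = Car A"
  "adom (act A M) = Car A \<boxtimes> MCar M" "acod (act A M) = MCar M"
  "adom (bar A B f) = Car A" "acod (bar A B f) = Car B"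
  "adom (mar M N f) = MCar M" "acod (mar M N f) = MCar N"
  by (simp_all add: mm_def uu_def act_def bar_def mar_def)

lemma araw_simps [simp]:
  "araw (g \<bullet> f) = araw g \<cdot> araw f" "araw (f \<star> g) = araw f \<boxdot> araw g" "araw (idt X) = Ident C X"
  "araw (mm A) = Mul A" "araw (uu A) = Unt A" "araw (act A M) = MAct M" "araw (asc X Y Z) = Assoc C X Y Z"
  "araw (lun X) = LUnit C X" "araw (run X) = RUnit C X" "araw (brd X Y) = Braid C X Y"
  "araw (bar A B h) = h" "araw (mar M N h) = h"
  by (simp_all add: acomp_def atens_def idt_def mm_def uu_def act_def bar_def mar_def asc_def lun_def run_def brd_def)

lemma arr_lift:
  "arr (bar A B f) \<longleftrightarrow> Car A \<in> Obj C \<and> Car B \<in> Obj C \<and> f \<in> Hom C (Car A) (Car B)"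
  "arr (mar M N f) \<longleftrightarrow> MCar M \<in> Obj C \<and> MCar N \<in> Obj C \<and> f \<in> Hom C (MCar M) (MCar N)"
  by (simp_all add: bar_def mar_def)

lemma arrow_eq_iff: "f = g \<longleftrightarrow> adom f = adom g \<and> acod f = acod g \<and> araw f = araw g"
  by (auto intro: arrow.expand)

lemma bar_acomp: "bar B D g \<bullet> bar A B f = bar A D (g \<cdot> f)"
  and mar_acomp: "mar N K g \<bullet> mar M N f = mar M K (g \<cdot> f)"
  by (simp_all add: arrow_eq_iff)

lemma comm_monoid_arrow:
  assumes "A \<in> Obj (Comm_cat C)"
  shows Car_obj [simp]: "Car A \<in> Obj C"
    and arr_mm [simp]: "arr (mm A)" and arr_uu [simp]: "arr (uu A)"
    and mm_assoc: "mm A \<bullet> (mm A \<star> idt (Car A)) = mm A \<bullet> (idt (Car A) \<star> mm A) \<bullet> asc (Car A) (Car A) (Car A)"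
    and mm_unit_left: "mm A \<bullet> (uu A \<star> idt (Car A)) = lun (Car A)"
    and mm_unit_right: "mm A \<bullet> (idt (Car A) \<star> uu A) = run (Car A)"
    and mm_comm: "mm A \<bullet> brd (Car A) (Car A) = mm A"
  using assms
  by (auto simp: Comm_cat_def is_comm_monoid_object_def mm_def uu_def arrow_eq_iff acomp_def atens_def)

lemma comm_monoid_objectI:
  assumes "arr (mm A)" "arr (uu A)"
    and "mm A \<bullet> (mm A \<star> idt (Car A)) = mm A \<bullet> (idt (Car A) \<star> mm A) \<bullet> asc (Car A) (Car A) (Car A)"
    and "mm A \<bullet> (uu A \<star> idt (Car A)) = lun (Car A)"
    and "mm A \<bullet> (idt (Car A) \<star> uu A) = run (Car A)"
    and "mm A \<bullet> brd (Car A) (Car A) = mm A"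
  shows "A \<in> Obj (Comm_cat C)"
proof -
  note laws = assms(3-6)[THEN arg_cong[of _ _ araw], unfolded araw_simps]
  have "is_comm_monoid_object C A"
    unfolding is_comm_monoid_object_def
    using assms(1,2) by (intro conjI laws) (auto simp: mm_def uu_def)
  then show ?thesis
    by (simp add: Comm_cat_def)
qed

lemma Comm_hom_iff:
  "f \<in> Hom (Comm_cat C) A B \<longleftrightarrow> f \<in> Hom C (Car A) (Car B) \<and>
     bar A B f \<bullet> mm A = mm B \<bullet> (bar A B f \<star> bar A B f) \<and> bar A B f \<bullet> uu A = uu B"
  by (auto simp: Comm_cat_def arrow_eq_iff)

lemma Comm_homD:
  assumes "f \<in> Hom (Comm_cat C) A B"
  shows "f \<in> Hom C (Car A) (Car B)" "bar A B f \<bullet> mm A = mm B \<bullet> (bar A B f \<star> bar A B f)"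
    "bar A B f \<bullet> uu A = uu B"
  using assms by (simp_all add: Comm_hom_iff)

lemma arr_bar [simp]:
  "A \<in> Obj (Comm_cat C) \<Longrightarrow> B \<in> Obj (Comm_cat C) \<Longrightarrow> f \<in> Hom (Comm_cat C) A B \<Longrightarrow> arr (bar A B f)"
  by (simp add: Comm_hom_iff arr_lift)

lemma Comm_cat_simps [simp]:
  "Ident (Comm_cat C) A = Ident C (Car A)" "Comp (Comm_cat C) = Comp C"
  by (simp_all add: Comm_cat_def)

lemma module_iff:
  assumes "A \<in> Obj (Comm_cat C)"
  shows "M \<in> Obj (Mod_cat C A) \<longleftrightarrow> arr (act A M) \<and>
     act A M \<bullet> (mm A \<star> idt (MCar M)) = act A M \<bullet> (idt (Car A) \<star> act A M) \<bullet> asc (Car A) (Car A) (MCar M) \<and>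
     act A M \<bullet> (uu A \<star> idt (MCar M)) = lun (MCar M)"
  using assms
  by (auto simp: Mod_cat_def is_module_object_def mm_def uu_def act_def acomp_def atens_def idt_def
      asc_def lun_def)

lemma MCar_obj [simp]: "M \<in> Obj (Mod_cat C A) \<Longrightarrow> MCar M \<in> Obj C"
  by (simp add: Mod_cat_def is_module_object_def)

lemma arr_act [simp]: "A \<in> Obj (Comm_cat C) \<Longrightarrow> M \<in> Obj (Mod_cat C A) \<Longrightarrow> arr (act A M)"
  by (simp add: module_iff)

lemma Mod_hom_iff:
  "f \<in> Hom (Mod_cat C A) M N \<longleftrightarrow> f \<in> Hom C (MCar M) (MCar N) \<and>
     mar M N f \<bullet> act A M = act A N \<bullet> (idt (Car A) \<star> mar M N f)"
  by (auto simp: Mod_cat_def arrow_eq_iff)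

lemma Mod_cat_simps [simp]:
  "Ident (Mod_cat C A) M = Ident C (MCar M)" "Comp (Mod_cat C A) = Comp C"
  "Add (Mod_cat C A) = Add C" "Zero (Mod_cat C A) M N = Zero C (MCar M) (MCar N)"
  by (simp_all add: Mod_cat_def)

lemma module_object_simps [simp]:
  "MCar (self_module A) = Car A" "MCar (algebra_module C B g) = Car B"
  by (simp_all add: self_module_def algebra_module_def)

lemma act_self [simp]: "act A (self_module A) = mm A"
  by (simp add: self_module_def act_def mm_def)

lemma act_algebra: "act A (algebra_module C B b) = mm B \<bullet> (bar A B b \<star> idt (Car B))"
  by (simp add: algebra_module_def arrow_eq_iff)

lemma self_module_obj [simp]: "A \<in> Obj (Comm_cat C) \<Longrightarrow> self_module A \<in> Obj (Mod_cat C A)"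
  by (simp add: module_iff mm_assoc mm_unit_left)

lemma algebra_module_obj:
  assumes [simp]: "A \<in> Obj (Comm_cat C)" "B \<in> Obj (Comm_cat C)" and b: "b \<in> Hom (Comm_cat C) A B"
  shows "algebra_module C B b \<in> Obj (Mod_cat C A)"
proof -
  define f where "f = bar A B b"
  have f [simp]: "arr f" "adom f = Car A" "acod f = Car B"
    using b by (simp_all add: f_def)
  have hom: "f \<bullet> mm A = mm B \<bullet> (f \<star> f)" "f \<bullet> uu A = uu B"
    using b by (simp_all add: f_def Comm_hom_iff)
  let ?n = "mm B \<bullet> (f \<star> idt (Car B))"
  have "?n \<bullet> (mm A \<star> idt (Car B)) = mm B \<bullet> ((f \<bullet> mm A) \<star> idt (Car B))"
    by simp
  also have "\<dots> = (mm B \<bullet> (mm B \<star> idt (Car B))) \<bullet> ((f \<star> f) \<star> idt (Car B))"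
    by (simp add: hom)
  also have "\<dots> = mm B \<bullet> (idt (Car B) \<star> mm B) \<bullet> asc (Car B) (Car B) (Car B) \<bullet> ((f \<star> f) \<star> idt (Car B))"
    by (simp add: mm_assoc)
  also have "asc (Car B) (Car B) (Car B) \<bullet> ((f \<star> f) \<star> idt (Car B)) =
      (f \<star> f \<star> idt (Car B)) \<bullet> asc (Car A) (Car A) (Car B)"
    using asc_natural[of f f "idt (Car B)"] by simp
  also have "mm B \<bullet> (idt (Car B) \<star> mm B) \<bullet> \<dots> = ?n \<bullet> (idt (Car A) \<star> ?n) \<bullet> asc (Car A) (Car A) (Car B)"
    by simp
  finally have "?n \<bullet> (mm A \<star> idt (Car B)) = \<dots>" .
  moreover have "?n \<bullet> (uu A \<star> idt (Car B)) = mm B \<bullet> ((f \<bullet> uu A) \<star> idt (Car B))"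
    by simp
  then have "?n \<bullet> (uu A \<star> idt (Car B)) = lun (Car B)"
    by (simp only: hom mm_unit_left assms)
  ultimately show ?thesis
    by (simp add: module_iff act_algebra flip: f_def)
qed

lemma category_Mod:
  assumes [simp]: "A \<in> Obj (Comm_cat C)"
  shows "category (Mod_cat C A)"
proof
  show "Ident (Mod_cat C A) M \<in> Hom (Mod_cat C A) M M" if "M \<in> Obj (Mod_cat C A)" for M
  proof -
    have "mar M M (Ident C (MCar M)) = idt (MCar M)"
      by (simp add: arrow_eq_iff)
    then show ?thesis
      using that by (simp add: Mod_hom_iff ident_in_hom)
  qed
  show "g \<cdot>\<^bsub>Mod_cat C A\<^esub> f \<in> Hom (Mod_cat C A) X Z"
    if [simp]: "X \<in> Obj (Mod_cat C A)" "Y \<in> Obj (Mod_cat C A)" "Z \<in> Obj (Mod_cat C A)"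
      and f: "f \<in> Hom (Mod_cat C A) X Y" and g: "g \<in> Hom (Mod_cat C A) Y Z" for X Y Z f g
  proof -
    have [simp]: "MCar X \<in> Obj C" "MCar Y \<in> Obj C" "MCar Z \<in> Obj C"
      by (rule that(1-3)[THEN MCar_obj])+
    have [simp]: "arr (mar X Y f)" "arr (mar Y Z g)"
      using f g by (simp_all add: Mod_hom_iff arr_lift)
    have "(mar Y Z g \<bullet> mar X Y f) \<bullet> act A X = mar Y Z g \<bullet> (mar X Y f \<bullet> act A X)"
      by simp
    also have "\<dots> = (mar Y Z g \<bullet> act A Y) \<bullet> (idt (Car A) \<star> mar X Y f)"
      using f by (simp add: Mod_hom_iff)
    also have "\<dots> = act A Z \<bullet> (idt (Car A) \<star> (mar Y Z g \<bullet> mar X Y f))"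
      using g by (simp add: Mod_hom_iff)
    finally show ?thesis
      using f g comp_in_hom[of "MCar X" "MCar Y" "MCar Z"] by (simp add: Mod_hom_iff mar_acomp)
  qed
  show "(h \<cdot>\<^bsub>Mod_cat C A\<^esub> g) \<cdot>\<^bsub>Mod_cat C A\<^esub> f = h \<cdot>\<^bsub>Mod_cat C A\<^esub> (g \<cdot>\<^bsub>Mod_cat C A\<^esub> f)"
    if "X \<in> Obj (Mod_cat C A)" "Y \<in> Obj (Mod_cat C A)" "Z \<in> Obj (Mod_cat C A)" "W \<in> Obj (Mod_cat C A)"
      "f \<in> Hom (Mod_cat C A) X Y" "g \<in> Hom (Mod_cat C A) Y Z" "h \<in> Hom (Mod_cat C A) Z W" for X Y Z W f g h
    using that(5-7) comp_assoc[OF that(1-4)[THEN MCar_obj], of f g h] by (simp add: Mod_hom_iff)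
  show "Ident (Mod_cat C A) Y \<cdot>\<^bsub>Mod_cat C A\<^esub> f = f" "f \<cdot>\<^bsub>Mod_cat C A\<^esub> Ident (Mod_cat C A) X = f"
    if "X \<in> Obj (Mod_cat C A)" "Y \<in> Obj (Mod_cat C A)" "f \<in> Hom (Mod_cat C A) X Y" for X Y f
    using that(3) ident_left[OF that(1,2)[THEN MCar_obj], of f] ident_right[OF that(1,2)[THEN MCar_obj], of f]
    by (simp_all add: Mod_hom_iff)
qed

lemma category_Comm: "category (Comm_cat C)"
proof
  show "Ident (Comm_cat C) A \<in> Hom (Comm_cat C) A A" if [simp]: "A \<in> Obj (Comm_cat C)" for A
  proof -
    have "bar A A (Ident C (Car A)) = idt (Car A)"
      by (simp add: arrow_eq_iff)
    then show ?thesis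
      by (simp add: Comm_hom_iff ident_in_hom)
  qed
  show "g \<cdot>\<^bsub>Comm_cat C\<^esub> f \<in> Hom (Comm_cat C) X Z"
    if [simp]: "X \<in> Obj (Comm_cat C)" "Y \<in> Obj (Comm_cat C)" "Z \<in> Obj (Comm_cat C)"
      and f: "f \<in> Hom (Comm_cat C) X Y" and g: "g \<in> Hom (Comm_cat C) Y Z" for X Y Z f g
  proof -
    note [simp] = f g
    have "(bar Y Z g \<bullet> bar X Y f) \<bullet> mm X = bar Y Z g \<bullet> (bar X Y f \<bullet> mm X)"
      by simp
    also have "\<dots> = (bar Y Z g \<bullet> mm Y) \<bullet> (bar X Y f \<star> bar X Y f)"
      by (simp add: Comm_homD(2)[OF f])
    also have "\<dots> = mm Z \<bullet> ((bar Y Z g \<bullet> bar X Y f) \<star> (bar Y Z g \<bullet> bar X Y f))"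
      by (simp add: Comm_homD(2)[OF g])
    finally have "(bar Y Z g \<bullet> bar X Y f) \<bullet> mm X =
      mm Z \<bullet> ((bar Y Z g \<bullet> bar X Y f) \<star> (bar Y Z g \<bullet> bar X Y f))" .
    moreover have "(bar Y Z g \<bullet> bar X Y f) \<bullet> uu X = uu Z"
      by (simp add: Comm_homD(3)[OF f] Comm_homD(3)[OF g])
    ultimately show ?thesis
      using Comm_homD(1)[OF f] Comm_homD(1)[OF g] comp_in_hom[of "Car X" "Car Y" "Car Z"]
      by (simp add: Comm_hom_iff bar_acomp del: f g)
  qed
  show "(h \<cdot>\<^bsub>Comm_cat C\<^esub> g) \<cdot>\<^bsub>Comm_cat C\<^esub> f = h \<cdot>\<^bsub>Comm_cat C\<^esub> (g \<cdot>\<^bsub>Comm_cat C\<^esub> f)"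
    if "X \<in> Obj (Comm_cat C)" "Y \<in> Obj (Comm_cat C)" "Z \<in> Obj (Comm_cat C)" "W \<in> Obj (Comm_cat C)"
      "f \<in> Hom (Comm_cat C) X Y" "g \<in> Hom (Comm_cat C) Y Z" "h \<in> Hom (Comm_cat C) Z W" for X Y Z W f g h
    using comp_assoc[OF that(1-4)[THEN Car_obj] that(5-7)[THEN Comm_homD(1)]] by simp
  show "Ident (Comm_cat C) Y \<cdot>\<^bsub>Comm_cat C\<^esub> f = f" "f \<cdot>\<^bsub>Comm_cat C\<^esub> Ident (Comm_cat C) X = f"
    if "X \<in> Obj (Comm_cat C)" "Y \<in> Obj (Comm_cat C)" "f \<in> Hom (Comm_cat C) X Y" for X Y f
    using ident_left[OF that(1,2)[THEN Car_obj] Comm_homD(1)[OF that(3)]]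
      ident_right[OF that(1,2)[THEN Car_obj] Comm_homD(1)[OF that(3)]]
    by simp_all
qed

section \<open>Endomorphisms of the free module of rank one\<close>

lemma bar_mar: "bar A B f = mar (self_module A) (algebra_module C B b) f"
  "bar A B f = mar (self_module A) (self_module B) f"
  by (simp_all add: arrow_eq_iff)

lemma endo_iff:
  "t \<in> carrier (endo_ring C A) \<longleftrightarrow> t \<in> Hom C (Car A) (Car A) \<and> bar A A t \<bullet> mm A = mm A \<bullet> (idt (Car A) \<star> bar A A t)"
  by (simp add: endo_ring_def Mod_hom_iff bar_mar)

text \<open>The braiding moves \<open>t\<close> from the right factor to the left one, and
  commutativity of \<open>mm A\<close> absorbs the braiding.\<close>

lemma endo_left:
  assumes [simp]: "A \<in> Obj (Comm_cat C)" and t: "t \<in> carrier (endo_ring C A)"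
  shows "bar A A t \<bullet> mm A = mm A \<bullet> (bar A A t \<star> idt (Car A))"
proof -
  define T where "T = bar A A t"
  have T [simp]: "arr T" "adom T = Car A" "acod T = Car A" and lin: "T \<bullet> mm A = mm A \<bullet> (idt (Car A) \<star> T)"
    using t by (simp_all add: T_def endo_iff arr_lift)
  have "T \<bullet> mm A = (T \<bullet> mm A) \<bullet> brd (Car A) (Car A)"
    by (simp add: mm_comm)
  also have "\<dots> = mm A \<bullet> ((idt (Car A) \<star> T) \<bullet> brd (Car A) (Car A))"
    by (simp add: lin)
  also have "(idt (Car A) \<star> T) \<bullet> brd (Car A) (Car A) = brd (Car A) (Car A) \<bullet> (T \<star> idt (Car A))"
    using brd_natural[of T "idt (Car A)"] by simp
  also have "mm A \<bullet> \<dots> = (mm A \<bullet> brd (Car A) (Car A)) \<bullet> (T \<star> idt (Car A))"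
    by simp
  also have "\<dots> = mm A \<bullet> (T \<star> idt (Car A))"
    by (simp only: mm_comm assms)
  finally show ?thesis
    by (simp add: T_def)
qed

text \<open>Inserting the unit on the right, \<open>a \<mapsto> a \<otimes> 1\<close>, is a section
  of the multiplication; \<open>r\<close> is the inverse of the right unit constraint.\<close>

lemma mm_split:
  assumes [simp]: "A \<in> Obj (Comm_cat C)"
  obtains r where "arr r" "adom r = Car A" "acod r = Car A \<boxtimes> UnitObj C"
    "r \<bullet> run (Car A) = idt (Car A \<boxtimes> UnitObj C)" "run (Car A) \<bullet> r = idt (Car A)"
    "mm A \<bullet> (idt (Car A) \<star> uu A) \<bullet> r = idt (Car A)"
proof -
  obtain r where r: "arr r" "adom r = Car A" "acod r = Car A \<boxtimes> UnitObj C"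
    "r \<bullet> run (Car A) = idt (Car A \<boxtimes> UnitObj C)" "run (Car A) \<bullet> r = idt (Car A)"
    using run_inverse[of "Car A"] by auto
  then have "mm A \<bullet> (idt (Car A) \<star> uu A) \<bullet> r = (mm A \<bullet> (idt (Car A) \<star> uu A)) \<bullet> r"
    by simp
  also have "\<dots> = idt (Car A)"
    by (simp only: mm_unit_right assms r)
  finally show thesis
    using r that by blast
qed

lemma epic_mm:
  assumes [simp]: "A \<in> Obj (Comm_cat C)"
  shows "epic (mm A)"
proof -
  obtain r where "arr r" "adom r = Car A" "acod r = Car A \<boxtimes> UnitObj C" "mm A \<bullet> (idt (Car A) \<star> uu A) \<bullet> r = idt (Car A)"
    by (rule mm_split[OF assms])
  then show ?thesis
    by (intro epic_split[of "mm A" "(idt (Car A) \<star> uu A) \<bullet> r"]) simp_all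
qed

text \<open>An argument of Eckmann-Hilton type: \<open>s\<close> can act on the left factor and
  \<open>t\<close> on the right factor of a product, in either order, and the multiplication is
  epic. This commutativity is what later lets endomorphisms descend to quotients.\<close>

lemma endo_commute:
  assumes [simp]: "A \<in> Obj (Comm_cat C)" and s: "s \<in> carrier (endo_ring C A)" and t: "t \<in> carrier (endo_ring C A)"
  shows "s \<cdot> t = t \<cdot> s"
proof -
  define S T where "S = bar A A s" and "T = bar A A t"
  have S [simp]: "arr S" "adom S = Car A" "acod S = Car A" and T [simp]: "arr T" "adom T = Car A" "acod T = Car A"
    using s t by (simp_all add: S_def T_def endo_iff arr_lift)
  have S_right: "S \<bullet> mm A = mm A \<bullet> (idt (Car A) \<star> S)" and T_right: "T \<bullet> mm A = mm A \<bullet> (idt (Car A) \<star> T)"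
    using s t by (simp_all add: S_def T_def endo_iff arr_lift)
  have S_left: "S \<bullet> mm A = mm A \<bullet> (S \<star> idt (Car A))"
    using endo_left[of A s] s by (simp add: S_def)
  have "(S \<bullet> T) \<bullet> mm A = (S \<bullet> mm A) \<bullet> (idt (Car A) \<star> T)"
    by (simp add: T_right)
  also have "\<dots> = (mm A \<bullet> (idt (Car A) \<star> T)) \<bullet> (S \<star> idt (Car A))"
    unfolding S_left by simp
  also have "\<dots> = T \<bullet> (mm A \<bullet> (S \<star> idt (Car A)))"
    unfolding T_right[symmetric] by simp
  also have "\<dots> = (T \<bullet> S) \<bullet> mm A"
    by (simp flip: S_left)
  finally have "S \<bullet> T = T \<bullet> S"
    by (rule epic_cancel[OF epic_mm[OF assms(1)]]) simp_all
  then show ?thesis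
    by (simp add: arrow_eq_iff S_def T_def)
qed

end

section \<open>Base change of the free module of rank one\<close>

text \<open>Base change is specified by a coequalizer of two arrows; this makes the uniqueness
  results for joint coequalizers applicable to it.\<close>

lemma (in category) coequalizer_iff_joint:
  "is_coequalizer C X Y f g Q q \<longleftrightarrow> is_joint_coequalizer C X Y {f, g} Q q"
proof -
  have *: "(\<forall>s\<in>{f, g}. \<forall>t\<in>{f, g}. a \<cdot> s = a \<cdot> t) \<longleftrightarrow> a \<cdot> f = a \<cdot> g" for a
    by auto
  show ?thesis
    unfolding is_coequalizer_def is_joint_coequalizer_def * by blast
qed

context symmetric_monoidal_category
begin

lemma Mod_homD:
  assumes "f \<in> Hom (Mod_cat C A) M N"
  shows "f \<in> Hom C (MCar M) (MCar N)" "mar M N f \<bullet> act A M = act A N \<bullet> (idt (Car A) \<star> mar M N f)"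
  using assms by (simp_all add: Mod_hom_iff)

text \<open>The standard split coequalizer: an arrow \<open>f\<close> with
  \<open>f \<bullet> d0 = f \<bullet> d1\<close> factors as \<open>f \<bullet> s\<close> through
  \<open>e\<close>, because \<open>f = f \<bullet> d1 \<bullet> s' = f \<bullet> d0 \<bullet> s' = f
  \<bullet> s \<bullet> e\<close>.\<close>

lemma split_coequalizer:
  assumes [simp]: "arr d0" "arr d1" "arr e" "arr s" "arr s'"
    "adom d1 = adom d0" "acod d1 = acod d0" "adom e = acod d0" "adom s = acod e" "acod s = acod d0"
    "adom s' = acod d0" "acod s' = adom d0"
    and coeq: "e \<bullet> d0 = e \<bullet> d1" and es: "e \<bullet> s = idt (acod e)" and d0: "d0 \<bullet> s' = s \<bullet> e" and d1: "d1 \<bullet> s' = idt (acod d0)"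
  shows "is_coequalizer C (adom d0) (acod d0) (araw d0) (araw d1) (acod e) (araw e)"
  unfolding is_coequalizer_def
proof (intro conjI ballI impI)
  show "araw e \<cdot> araw d0 = araw e \<cdot> araw d1"
    using arg_cong[OF coeq, of araw] by simp
  show "araw d0 \<in> Hom C (adom d0) (acod d0)" "araw d1 \<in> Hom C (adom d0) (acod d0)" "araw e \<in> Hom C (acod d0) (acod e)"
    using assms(1-3) unfolding arr_def by simp_all
  fix W a
  assume W: "W \<in> Obj C" and a: "a \<in> Hom C (acod d0) W" and eq: "a \<cdot> araw d0 = a \<cdot> araw d1"
  define f where "f = Arrow (acod d0) W a"
  have f [simp]: "arr f" "adom f = acod d0" "acod f = W"
    using W a by (simp_all add: f_def)
  have eq': "f \<bullet> d0 = f \<bullet> d1"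
    using eq by (simp add: arrow_eq_iff f_def)
  have "(f \<bullet> s) \<bullet> e = f \<bullet> (d0 \<bullet> s')"
    by (simp add: d0)
  also have "\<dots> = (f \<bullet> d1) \<bullet> s'"
    by (simp flip: eq')
  also have "\<dots> = f"
    by (simp add: d1)
  finally have fac: "(f \<bullet> s) \<bullet> e = f" .
  show "\<exists>!h. h \<in> Hom C (acod e) W \<and> h \<cdot> araw e = a"
  proof (rule ex1I)
    have "arr (f \<bullet> s)"
      by simp
    then show "araw (f \<bullet> s) \<in> Hom C (acod e) W \<and> araw (f \<bullet> s) \<cdot> araw e = a"
      using arg_cong[OF fac, of araw] unfolding arr_def by (simp add: f_def)
    fix h assume h: "h \<in> Hom C (acod e) W \<and> h \<cdot> araw e = a"
    let ?h = "Arrow (acod e) W h"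
    have arr: "arr ?h" using h W by simp
    have "?h \<bullet> e = (f \<bullet> s) \<bullet> e"
      using h unfolding fac by (simp add: arrow_eq_iff f_def)
    then have "?h = f \<bullet> s"
      by (rule epic_cancel[OF epic_split[of e s], rotated 4]) (use arr in \<open>simp_all add: es\<close>)
    then show "h = araw (f \<bullet> s)"
      by (metis arrow.sel(3))
  qed
qed simp_all

text \<open>An explicit model of \<open>B \<otimes>\<^sub>A A\<close> is \<open>B\<close> itself
  with \<open>e : x \<otimes> a \<mapsto> x f(a)\<close>; the defining fork is split by inserting
  the unit of \<open>A\<close>. The section of \<open>e\<close> and the linearity of
  \<open>e\<close> are recorded for the comparison with an arbitrary base change.\<close>

lemma base_change_self_object:
  assumes [simp]: "A \<in> Obj (Comm_cat C)" "B \<in> Obj (Comm_cat C)" and b [simp]: "b \<in> Hom (Comm_cat C) A B"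
  shows "is_base_change C A B b (self_module A) (self_module B) (Mul B \<cdot> (Ident C (Car B) \<boxdot> b))"
    and "\<exists>s. arr s \<and> adom s = Car B \<and> acod s = Car B \<boxtimes> Car A \<and> (mm B \<bullet> (idt (Car B) \<star> bar A B b)) \<bullet> s = idt (Car B)"
    and "(mm B \<bullet> (idt (Car B) \<star> bar A B b)) \<bullet> (mm B \<star> idt (Car A)) =
      mm B \<bullet> (idt (Car B) \<star> (mm B \<bullet> (idt (Car B) \<star> bar A B b))) \<bullet> asc (Car B) (Car B) (Car A)"
proof -
  define f where "f = bar A B b"
  have f [simp]: "arr f" "adom f = Car A" "acod f = Car B"
    by (simp_all add: f_def)
  have hom: "f \<bullet> mm A = mm B \<bullet> (f \<star> f)" "f \<bullet> uu A = uu B"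
    using Comm_homD[OF b] by (simp_all add: f_def)
  let ?A = "Car A" let ?B = "Car B" let ?U = "UnitObj C"
  define e where "e = mm B \<bullet> (idt ?B \<star> f)"
  have e [simp]: "arr e" "adom e = ?B \<boxtimes> ?A" "acod e = ?B"
    by (simp_all add: e_def)
  define d1 where "d1 = (idt ?B \<star> mm A) \<bullet> asc ?B ?A ?A"
  have d1 [simp]: "arr d1" "adom d1 = (?B \<boxtimes> ?A) \<boxtimes> ?A" "acod d1 = ?B \<boxtimes> ?A"
    by (simp_all add: d1_def)
  have lin: "e \<bullet> (mm B \<star> idt ?A) = mm B \<bullet> (idt ?B \<star> e) \<bullet> asc ?B ?B ?A"
  proof -
    have "e \<bullet> (mm B \<star> idt ?A) = (mm B \<bullet> (mm B \<star> idt ?B)) \<bullet> ((idt ?B \<star> idt ?B) \<star> f)"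
      by (simp add: e_def)
    also have "\<dots> = mm B \<bullet> (idt ?B \<star> mm B) \<bullet> (asc ?B ?B ?B \<bullet> ((idt ?B \<star> idt ?B) \<star> f))"
      unfolding mm_assoc[OF assms(2)] by simp
    also have "asc ?B ?B ?B \<bullet> ((idt ?B \<star> idt ?B) \<star> f) = (idt ?B \<star> idt ?B \<star> f) \<bullet> asc ?B ?B ?A"
      using asc_natural[of "idt ?B" "idt ?B" f] by simp
    also have "mm B \<bullet> (idt ?B \<star> mm B) \<bullet> \<dots> = mm B \<bullet> (idt ?B \<star> e) \<bullet> asc ?B ?B ?A"
      by (simp add: e_def)
    finally show ?thesis .
  qed
  have coeq: "e \<bullet> (e \<star> idt ?A) = e \<bullet> d1"
  proof -
    have "e \<bullet> (e \<star> idt ?A) = (mm B \<bullet> (mm B \<star> idt ?B)) \<bullet> ((idt ?B \<star> f) \<star> f)"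
      by (simp add: e_def)
    also have "\<dots> = mm B \<bullet> (idt ?B \<star> mm B) \<bullet> (asc ?B ?B ?B \<bullet> ((idt ?B \<star> f) \<star> f))"
      unfolding mm_assoc[OF assms(2)] by simp
    also have "asc ?B ?B ?B \<bullet> ((idt ?B \<star> f) \<star> f) = (idt ?B \<star> f \<star> f) \<bullet> asc ?B ?A ?A"
      using asc_natural[of "idt ?B" f f] by simp
    also have "mm B \<bullet> (idt ?B \<star> mm B) \<bullet> \<dots> = mm B \<bullet> (idt ?B \<star> (mm B \<bullet> (f \<star> f))) \<bullet> asc ?B ?A ?A"
      by simp
    also have "\<dots> = e \<bullet> d1"
      by (simp add: e_def d1_def flip: hom)
    finally show ?thesis .
  qed
  obtain r where r: "arr r" "adom r = ?B" "acod r = ?B \<boxtimes> ?U" "r \<bullet> run ?B = idt (?B \<boxtimes> ?U)" "run ?B \<bullet> r = idt ?B"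
    using run_inverse[of ?B] by auto
  obtain r' where r': "arr r'" "adom r' = ?B \<boxtimes> ?A" "acod r' = (?B \<boxtimes> ?A) \<boxtimes> ?U"
      "r' \<bullet> run (?B \<boxtimes> ?A) = idt ((?B \<boxtimes> ?A) \<boxtimes> ?U)" "run (?B \<boxtimes> ?A) \<bullet> r' = idt (?B \<boxtimes> ?A)"
    using run_inverse[of "?B \<boxtimes> ?A"] by auto
  note [simp] = r(1-3) r'(1-3)
  \<comment> \<open>In elements, \<open>s\<close> is \<open>x \<mapsto> x \<otimes> 1\<close>, and
    \<open>s'\<close> below is
    \<open>x \<otimes> a \<mapsto> (x \<otimes> a) \<otimes> 1\<close>.\<close>
  define s where "s = (idt ?B \<star> uu A) \<bullet> r"
  have s [simp]: "arr s" "adom s = ?B" "acod s = ?B \<boxtimes> ?A"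
    by (simp_all add: s_def)
  define s' where "s' = (idt (?B \<boxtimes> ?A) \<star> uu A) \<bullet> r'"
  have s' [simp]: "arr s'" "adom s' = ?B \<boxtimes> ?A" "acod s' = (?B \<boxtimes> ?A) \<boxtimes> ?A"
    by (simp_all add: s'_def)
  have "e \<bullet> s = (mm B \<bullet> (idt ?B \<star> (f \<bullet> uu A))) \<bullet> r"
    by (simp add: e_def s_def)
  also have "\<dots> = idt ?B"
    by (simp only: hom mm_unit_right assms r)
  finally have es: "e \<bullet> s = idt ?B" .
  \<comment> \<open>Inverting the naturality square of \<open>run\<close> yields
    \<open>r \<bullet> e = (e \<star> idt ?U) \<bullet> r'\<close>, the naturality of the inverse
    constraint.\<close>
  have "e \<bullet> run (?B \<boxtimes> ?A) = run ?B \<bullet> (e \<star> idt ?U)"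
    using run_natural[of e] by simp
  then have "(r \<bullet> e) \<bullet> run (?B \<boxtimes> ?A) = (r \<bullet> run ?B) \<bullet> (e \<star> idt ?U)"
    by simp
  also have "\<dots> = (e \<star> idt ?U)"
    by (simp add: r(4))
  finally have "(r \<bullet> e) \<bullet> run (?B \<boxtimes> ?A) \<bullet> r' = (e \<star> idt ?U) \<bullet> r'"
    by (simp flip: acomp_assoc)
  then have re: "r \<bullet> e = (e \<star> idt ?U) \<bullet> r'"
    by (simp add: r'(5))
  have d0: "(e \<star> idt ?A) \<bullet> s' = s \<bullet> e"
    by (simp add: s'_def s_def re)
  \<comment> \<open>The multiplication of \<open>A\<close> absorbs the inserted unit; what remains
    is \<open>(idt ?B \<star> run ?A) \<bullet> asc ?B ?A ?U\<close>, which
    \<open>run_tensor\<close> identifies with the constraint inverted by \<open>r'\<close>.\<close>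
  have "d1 \<bullet> s' = (idt ?B \<star> mm A) \<bullet> (asc ?B ?A ?A \<bullet> ((idt ?B \<star> idt ?A) \<star> uu A)) \<bullet> r'"
    by (simp add: d1_def s'_def)
  also have "asc ?B ?A ?A \<bullet> ((idt ?B \<star> idt ?A) \<star> uu A) = (idt ?B \<star> idt ?A \<star> uu A) \<bullet> asc ?B ?A ?U"
    using asc_natural[of "idt ?B" "idt ?A" "uu A"] by simp
  also have "(idt ?B \<star> mm A) \<bullet> \<dots> \<bullet> r' = ((idt ?B \<star> (mm A \<bullet> (idt ?A \<star> uu A))) \<bullet> asc ?B ?A ?U) \<bullet> r'"
    by simp
  also have "\<dots> = idt (?B \<boxtimes> ?A)"
    by (simp only: mm_unit_right assms run_tensor[symmetric] Car_obj r')
  finally have d1s: "d1 \<bullet> s' = idt (?B \<boxtimes> ?A)" .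
  have e': "araw e = Mul B \<cdot> (Ident C ?B \<boxdot> b)"
    by (simp add: e_def f_def)
  have "is_coequalizer C ((?B \<boxtimes> ?A) \<boxtimes> ?A) (?B \<boxtimes> ?A) (araw (e \<star> idt ?A)) (araw d1) ?B (araw e)"
    using split_coequalizer[of "e \<star> idt ?A" d1 e s s'] by (simp add: coeq es d0 d1s)
  then show "is_base_change C A B b (self_module A) (self_module B) (Mul B \<cdot> (Ident C ?B \<boxdot> b))"
    using arg_cong[OF lin, of araw, unfolded araw_simps] self_module_obj[OF assms(2)]
    unfolding is_base_change_def by (simp add: self_module_def d1_def f_def e')
  show "\<exists>s. arr s \<and> adom s = ?B \<and> acod s = ?B \<boxtimes> ?A \<and> (mm B \<bullet> (idt ?B \<star> bar A B b)) \<bullet> s = idt ?B"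
    by (intro exI[of _ s]) (use es in \<open>simp add: e_def f_def\<close>)
  show "(mm B \<bullet> (idt ?B \<star> bar A B b)) \<bullet> (mm B \<star> idt ?A) =
      mm B \<bullet> (idt ?B \<star> (mm B \<bullet> (idt ?B \<star> bar A B b))) \<bullet> asc ?B ?B ?A"
    using lin by (simp add: e_def f_def)
qed

text \<open>\<open>base_change\<close> is picked by choice, so its object \<open>T\<close> and its
  arrow \<open>q\<close> are arbitrary. Comparison with the explicit model gives a linear
  isomorphism \<open>k : T \<rightarrow> B\<close>, under which the base change of \<open>t\<close>
  becomes \<open>t'\<close>.\<close>

lemma endo_ring_map_eq:
  assumes [simp]: "A \<in> Obj (Comm_cat C)" "B \<in> Obj (Comm_cat C)" and b [simp]: "b \<in> Hom (Comm_cat C) A B"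
    and t: "t \<in> carrier (endo_ring C A)" and t': "t' \<in> carrier (endo_ring C B)" and eq: "t' \<cdot> b = b \<cdot> t"
  shows "endo_ring_map C A B b t = t'"
proof -
  let ?A = "Car A" let ?B = "Car B"
  define T q where "T = fst (base_change C A B b (self_module A))" and "q = snd (base_change C A B b (self_module A))"
  have bcs: "is_base_change C A B b (self_module A) (self_module B) (Mul B \<cdot> (Ident C ?B \<boxdot> b))"
    using base_change_self_object(1)[OF assms(1-3)] .
  have bc: "is_base_change C A B b (self_module A) T q"
    unfolding T_def q_def base_change_def
    by (rule someI[of "\<lambda>Tq. is_base_change C A B b (self_module A) (fst Tq) (snd Tq)"
          "(self_module B, Mul B \<cdot> (Ident C ?B \<boxdot> b))"]) (simp add: bcs)
  have T: "T \<in> Obj (Mod_cat C B)"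
    using bc by (simp add: is_base_change_def)
  have [simp]: "MCar T \<in> Obj C" "arr (act B T)"
    using T by (auto intro: MCar_obj)
  obtain k l where kl: "is_inverse C (MCar T) ?B k l" and kq: "k \<cdot> q = Mul B \<cdot> (Ident C ?B \<boxdot> b)"
      and le: "l \<cdot> (Mul B \<cdot> (Ident C ?B \<boxdot> b)) = q"
    using bc bcs unfolding is_base_change_def coequalizer_iff_joint
    by (auto elim: joint_coequalizer_unique)
  have q: "q \<in> Hom C (?B \<boxtimes> ?A) (MCar T)" and q_epi: "is_epi C (?B \<boxtimes> ?A) (MCar T) q"
    using bc unfolding is_base_change_def coequalizer_iff_joint
    by (auto dest: joint_coequalizerD(5) joint_coequalizer_epi)
  define F Q K L S S' where "F = bar A B b" and "Q = Arrow (?B \<boxtimes> ?A) (MCar T) q"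
    and "K = mar T (self_module B) k" and "L = mar (self_module B) T l"
    and "S = bar A A t" and "S' = bar B B t'"
  have F [simp]: "arr F" "adom F = ?A" "acod F = ?B"
    by (simp_all add: F_def)
  have Q [simp]: "arr Q" "adom Q = ?B \<boxtimes> ?A" "acod Q = MCar T"
    using q by (simp_all add: Q_def)
  have K [simp]: "arr K" "adom K = MCar T" "acod K = ?B" and L [simp]: "arr L" "adom L = ?B" "acod L = MCar T"
    using kl by (simp_all add: K_def L_def arr_lift is_inverse_def)
  have S [simp]: "arr S" "adom S = ?A" "acod S = ?A" and S' [simp]: "arr S'" "adom S' = ?B" "acod S' = ?B"
    using t t' by (simp_all add: S_def S'_def endo_iff arr_lift)
  have S'_lin: "S' \<bullet> mm B = mm B \<bullet> (idt ?B \<star> S')" and SF: "S' \<bullet> F = F \<bullet> S"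
    using t' eq by (simp_all add: S'_def S_def F_def endo_iff bar_acomp)
  define e where "e = mm B \<bullet> (idt ?B \<star> F)"
  have e [simp]: "arr e" "adom e = ?B \<boxtimes> ?A" "acod e = ?B"
    by (simp_all add: e_def)
  have KL: "K \<bullet> L = idt ?B" and LK: "L \<bullet> K = idt (MCar T)"
    using kl by (simp_all add: K_def L_def arrow_eq_iff is_inverse_def)
  have KQ: "K \<bullet> Q = e" and Le: "L \<bullet> e = Q"
    using kq le by (simp_all add: arrow_eq_iff K_def Q_def L_def e_def F_def)
  obtain s where s [simp]: "arr s" "adom s = ?B" "acod s = ?B \<boxtimes> ?A" and es: "e \<bullet> s = idt ?B"
    using base_change_self_object(2)[OF assms(1-3)] unfolding e_def F_def by auto
  have "Q \<bullet> s \<bullet> K = L \<bullet> (e \<bullet> s) \<bullet> K"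
    by (simp flip: Le)
  then have QsK: "Q \<bullet> s \<bullet> K = idt (MCar T)"
    by (simp add: es LK)
  \<comment> \<open>That \<open>idt ?B \<star> Q\<close> is epic comes from the splitting
    \<open>Q \<bullet> s \<bullet> K = idt (MCar T)\<close>, since splittings survive
    tensoring.\<close>
  have epi: "epic ((idt ?B \<star> Q) \<bullet> asc ?B ?B ?A)"
    by (intro epic_acomp epic_asc epic_split[of "idt ?B \<star> Q" "idt ?B \<star> (s \<bullet> K)"]) (simp_all add: QsK)
  have act_Q: "act B T \<bullet> (idt ?B \<star> Q) \<bullet> asc ?B ?B ?A = Q \<bullet> (mm B \<star> idt ?A)"
    using bc by (simp add: is_base_change_def arrow_eq_iff Q_def)
  \<comment> \<open>The comparison of coequalizers only provides an arrow \<open>k\<close> of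
    \<open>C\<close>; its linearity is checked after the epic just obtained.\<close>
  have "(K \<bullet> act B T) \<bullet> (idt ?B \<star> Q) \<bullet> asc ?B ?B ?A = (K \<bullet> Q) \<bullet> (mm B \<star> idt ?A)"
    by (simp add: act_Q)
  also have "\<dots> = mm B \<bullet> (idt ?B \<star> e) \<bullet> asc ?B ?B ?A"
    using base_change_self_object(3)[OF assms(1-3)] unfolding KQ e_def F_def .
  also have "\<dots> = (mm B \<bullet> (idt ?B \<star> K)) \<bullet> (idt ?B \<star> Q) \<bullet> asc ?B ?B ?A"
    by (simp add: KQ)
  finally have K_lin: "K \<bullet> act B T = mm B \<bullet> (idt ?B \<star> K)"
    by (rule epic_cancel[OF epi]) simp_all
  have "L \<bullet> mm B = L \<bullet> (mm B \<bullet> (idt ?B \<star> K)) \<bullet> (idt ?B \<star> L)"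
    by (simp add: KL)
  also have "\<dots> = (L \<bullet> K) \<bullet> act B T \<bullet> (idt ?B \<star> L)"
    unfolding K_lin[symmetric] by simp
  also have "\<dots> = act B T \<bullet> (idt ?B \<star> L)"
    unfolding LK by simp
  finally have L_lin: "L \<bullet> mm B = \<dots>" .
  have k: "k \<in> Hom (Mod_cat C B) T (self_module B)" and l: "l \<in> Hom (Mod_cat C B) (self_module B) T"
    using K_lin L_lin kl by (simp_all add: Mod_hom_iff is_inverse_def flip: K_def L_def)
  have inv: "is_inverse (Mod_cat C B) T (self_module B) k l"
    using k l kl by (simp add: is_inverse_def)
  have bself: "base_change_self C A B b = k"
    unfolding base_change_self_def T_def[symmetric] q_def[symmetric]
  proof (rule the_equality)
    fix h assume "h \<in> Hom (Mod_cat C B) T (self_module B) \<and> h \<cdot> q = Mul B \<cdot> (Ident C ?B \<boxdot> b)"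
    then show "h = k"
      using epiD[OF q_epi, of ?B h k] k kq by (simp add: Mod_hom_iff)
  qed (use k kq in simp)
  \<comment> \<open>The candidate for the base change of \<open>t\<close> is \<open>t'\<close>
    transported to \<open>T\<close> along \<open>k\<close>.\<close>
  let ?h = "l \<cdot> t' \<cdot> k"
  interpret M: category "Mod_cat C B"
    by (rule category_Mod) simp
  have t'M: "t' \<in> Hom (Mod_cat C B) (self_module B) (self_module B)"
    using t' by (simp add: endo_ring_def)
  then have "t' \<cdot> k \<in> Hom (Mod_cat C B) T (self_module B)"
    using M.comp_in_hom[of T "self_module B" "self_module B" k t'] k T by simp
  then have h: "?h \<in> Hom (Mod_cat C B) T T"
    using M.comp_in_hom[of T "self_module B" T "t' \<cdot> k" l] l T by simp
  have "(L \<bullet> S' \<bullet> K) \<bullet> Q = L \<bullet> (S' \<bullet> mm B) \<bullet> (idt ?B \<star> F)"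
    by (simp add: KQ e_def)
  also have "\<dots> = (L \<bullet> e) \<bullet> (idt ?B \<star> S)"
    by (simp add: S'_lin SF e_def)
  finally have hq: "?h \<cdot> q = q \<cdot> (Ident C ?B \<boxdot> t)"
    unfolding Le by (simp add: arrow_eq_iff L_def S'_def K_def Q_def S_def)
  have barrow: "base_change_arrow C A B b (self_module A) (self_module A) t = ?h"
    unfolding base_change_arrow_def T_def[symmetric] q_def[symmetric]
  proof (rule the_equality)
    fix h' assume "h' \<in> Hom (Mod_cat C B) T T \<and> h' \<cdot> q = q \<cdot> (Ident C ?B \<boxdot> t)"
    then show "h' = ?h"
      using epiD[OF q_epi, of "MCar T" h' ?h] h hq by (simp add: Mod_hom_iff)
  qed (use h hq in simp)
  have "K \<bullet> (L \<bullet> S' \<bullet> K) \<bullet> L = (K \<bullet> L) \<bullet> S' \<bullet> (K \<bullet> L)"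
    by simp
  also have "\<dots> = S'"
    by (simp add: KL)
  finally have "k \<cdot> ?h \<cdot> l = t'"
    by (simp add: arrow_eq_iff L_def S'_def K_def)
  moreover have "inverse_arrow (Mod_cat C B) T (self_module B) k = l"
    using M.inverse_arrow_eq[OF inv] T by simp
  ultimately show ?thesis
    unfolding endo_ring_map_def bself barrow T_def[symmetric] by simp
qed

end

section \<open>Quotients of monoids\<close>

locale cocomplete_monoidal_category = abelian_category C + symmetric_monoidal_category C
  for C :: "('o, 'm, 'x) smcat_scheme" (structure) and U :: "'u itself" +
  assumes universe: "infinite (UNIV :: 'u set)"
    and colimits: "has_small_colimits U C"
    and tensor: "tensor_preserves_colimits U C"
begin

section \<open>Finite joint coequalizers, their tensor products, and quotient monoids\<close>

lemma joint_coequalizer_exists: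
  assumes "X \<in> Obj C" "Y \<in> Obj C" "T \<subseteq> Hom C X Y" "finite T" "T \<noteq> {}"
  obtains Q q where "is_joint_coequalizer C X Y T Q q"
proof -
  obtain x y :: 'u and N :: "'u set" and d where N: "x \<noteq> y" "finite N" "d ` N = T"
    using obtain_parallel_index[OF universe assms(4)] .
  let ?J = "parallel_category x y N"
  let ?F = "\<lambda>i. if i = x then X else Y" and ?G = "\<lambda>i j u. if i = j then Ident C (if i = x then X else Y) else d u"
  have J: "small_category ?J"
    using small_finite_category[OF universe finite_parallel_category] N by blast
  have F: "is_functor ?J C ?F ?G"
    using N assms by (intro functor_parallel_category) auto
  obtain Q \<iota> where "is_colimit ?J C ?F ?G Q \<iota>"
    using colimits J F unfolding has_small_colimits_def by blast
  moreover obtain u0 where "u0 \<in> N"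
    using N assms by auto
  ultimately have "is_joint_coequalizer C (?F x) (?F y) (?G x y ` N) Q (\<iota> y)"
    using F N by (intro parallel_colimit_joint_coequalizer)
  then show thesis
    using N that by simp
qed

lemma functor_tensor:
  assumes F: "is_functor J C F G" and W: "W \<in> Obj C"
  shows "is_functor J C (\<lambda>i. F i \<boxtimes> W) (\<lambda>i j u. G i j u \<boxdot> Ident C W)"
proof -
  have "G i k (v \<cdot>\<^bsub>J\<^esub> u) \<boxdot> Ident C W = (G j k v \<boxdot> Ident C W) \<cdot> (G i j u \<boxdot> Ident C W)"
    if "i \<in> Obj J" "j \<in> Obj J" "k \<in> Obj J" "u \<in> Hom J i j" "v \<in> Hom J j k" for i j k u v
  proof -
    have "F i \<in> Obj C" "F j \<in> Obj C" "F k \<in> Obj C" "G i j u \<in> Hom C (F i) (F j)" "G j k v \<in> Hom C (F j) (F k)"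
      "G i k (v \<cdot>\<^bsub>J\<^esub> u) = G j k v \<cdot> G i j u"
      using F that unfolding is_functor_def by blast+
    then show ?thesis
      using tensor_comp[of "F i" "F j" "F k" W W W "G i j u" "G j k v" "Ident C W" "Ident C W"] W
      by (simp add: ident_in_hom ident_left)
  qed
  moreover have "G i j u \<boxdot> Ident C W \<in> Hom C (F i \<boxtimes> W) (F j \<boxtimes> W)"
    if "i \<in> Obj J" "j \<in> Obj J" "u \<in> Hom J i j" for i j u
  proof -
    have "F i \<in> Obj C" "F j \<in> Obj C" "G i j u \<in> Hom C (F i) (F j)"
      using F that unfolding is_functor_def by blast+
    then show ?thesis
      using W by (intro tensor_arrow) (auto simp: ident_in_hom)
  qed
  ultimately show ?thesis
    using F W unfolding is_functor_def by (simp add: tensor_ident)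
qed

text \<open>Preservation by \<open>\<boxtimes>\<close> concerns colimits of small diagrams, so the
  coequalizer is turned into the colimit of a parallel diagram, tensored, and read back as a
  coequalizer.\<close>

lemma joint_coequalizer_tensor:
  assumes jc: "is_joint_coequalizer C X Y T Q q" and T: "finite T" "T \<noteq> {}" and W: "W \<in> Obj C"
  shows "is_joint_coequalizer C (X \<boxtimes> W) (Y \<boxtimes> W) ((\<lambda>t. t \<boxdot> Ident C W) ` T) (Q \<boxtimes> W) (q \<boxdot> Ident C W)"
proof -
  note D = joint_coequalizerD(1-5)[OF jc]
  obtain x y :: 'u and N :: "'u set" and d where N: "x \<noteq> y" "finite N" "d ` N = T"
    using obtain_parallel_index[OF universe T(1)] .
  obtain u0 where u0: "u0 \<in> N"
    using N T by auto
  let ?J = "parallel_category x y N"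
  let ?F = "\<lambda>i. if i = x then X else Y" and ?G = "\<lambda>i j u. if i = j then Ident C (if i = x then X else Y) else d u"
  let ?i = "\<lambda>i. if i = y then q else q \<cdot> ?G x y u0"
  have J: "small_category ?J"
    using small_finite_category[OF universe finite_parallel_category] N by blast
  have F: "is_functor ?J C ?F ?G"
    using N D by (intro functor_parallel_category) auto
  have "is_colimit ?J C ?F ?G Q ?i"
    using jc F N u0 by (intro joint_coequalizer_parallel_colimit) simp_all
  then have "is_colimit ?J C (\<lambda>i. ?F i \<boxtimes> W) (\<lambda>i j u. ?G i j u \<boxdot> Ident C W) (Q \<boxtimes> W) (\<lambda>i. ?i i \<boxdot> Ident C W)"
    using tensor W J F unfolding tensor_preserves_colimits_def by blast
  from parallel_colimit_joint_coequalizer[OF this functor_tensor[OF F W] N(1) u0]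
  have "is_joint_coequalizer C (X \<boxtimes> W) (Y \<boxtimes> W) ((\<lambda>u. d u \<boxdot> Ident C W) ` N) (Q \<boxtimes> W) (q \<boxdot> Ident C W)"
    using N(1) by simp
  then show ?thesis
    using N(3) by (auto simp: image_image)
qed

text \<open>An arbitrary epimorphism need not stay epic under \<open>\<boxtimes>\<close>, but these
  coequalizers remain coequalizers. The hypothesis on tensoring concerns the functors
  \<open>- \<boxtimes> W\<close>; braidings transfer the result to the other variable.\<close>

lemma epic_joint_coequalizer:
  assumes jc: "is_joint_coequalizer C X Y T Q q" and T: "finite T" "T \<noteq> {}"
  shows "epic (Arrow Y Q q)"
    and "W \<in> Obj C \<Longrightarrow> epic (Arrow Y Q q \<star> idt W)"
    and "W \<in> Obj C \<Longrightarrow> epic (idt W \<star> Arrow Y Q q)"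
    and "W \<in> Obj C \<Longrightarrow> V \<in> Obj C \<Longrightarrow> epic ((Arrow Y Q q \<star> idt W) \<star> idt V)"
    and "W \<in> Obj C \<Longrightarrow> V \<in> Obj C \<Longrightarrow> epic ((idt W \<star> Arrow Y Q q) \<star> idt V)"
proof -
  note D = joint_coequalizerD(1-5)[OF jc]
  show "epic (Arrow Y Q q)"
    using D joint_coequalizer_epi[OF jc] by (simp add: epic_def)
  assume W [simp]: "W \<in> Obj C"
  define f where "f = Arrow Y Q q"
  have f [simp]: "arr f" "adom f = Y" "acod f = Q" "araw f = q"
    using D by (simp_all add: f_def)
  have [simp]: "Y \<in> Obj C" "Q \<in> Obj C"
    using D by simp_all
  show fW: "epic (Arrow Y Q q \<star> idt W)"
    unfolding epic_def f_def[symmetric] using joint_coequalizer_epi[OF joint_coequalizer_tensor[OF jc T W]] by simp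
  have "idt W \<star> f = ((idt W \<star> f) \<bullet> brd Y W) \<bullet> brd W Y"
    by simp
  also have "(idt W \<star> f) \<bullet> brd Y W = brd Q W \<bullet> (f \<star> idt W)"
    using brd_natural[of f "idt W"] by simp
  finally have Wf: "idt W \<star> f = brd Q W \<bullet> (f \<star> idt W) \<bullet> brd W Y"
    by simp
  then show "epic (idt W \<star> Arrow Y Q q)"
    using fW unfolding f_def[symmetric] by (auto intro!: epic_acomp epic_brd)
  assume V [simp]: "V \<in> Obj C"
  note jcW = joint_coequalizer_tensor[OF jc T W]
  have "is_epi C ((Y \<boxtimes> W) \<boxtimes> V) ((Q \<boxtimes> W) \<boxtimes> V) ((q \<boxdot> Ident C W) \<boxdot> Ident C V)"
    using joint_coequalizer_epi[OF joint_coequalizer_tensor[OF jcW _ _ V]] T by simp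
  then show fWV: "epic ((Arrow Y Q q \<star> idt W) \<star> idt V)"
    unfolding epic_def f_def[symmetric] by simp
  have brd: "epic (brd X Z \<star> idt V)" if "X \<in> Obj C" "Z \<in> Obj C" for X Z
    using that by (intro epic_split[of _ "brd Z X \<star> idt V"]) simp_all
  have "epic ((brd Q W \<star> idt V) \<bullet> ((f \<star> idt W) \<star> idt V) \<bullet> (brd W Y \<star> idt V))"
    by (intro epic_acomp brd fWV[folded f_def]) simp_all
  then show "epic ((idt W \<star> Arrow Y Q q) \<star> idt V)"
    unfolding f_def[symmetric] by (simp add: Wf)
qed

text \<open>The working form of a quotient: the universal property is required of the underlying
  object in \<open>C\<close> only. Principal quotients correspond to \<open>T = {t, 0}\<close>, and
  ideal quotients to the generators together with \<open>0\<close>.\<close>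

definition monoid_quotient ::
  "('o, 'm) monoid_object \<Rightarrow> 'm set \<Rightarrow> ('o, 'm) monoid_object \<Rightarrow> 'm \<Rightarrow> bool" where
  "monoid_quotient A T B b \<longleftrightarrow> A \<in> Obj (Comm_cat C) \<and> B \<in> Obj (Comm_cat C) \<and> b \<in> Hom (Comm_cat C) A B \<and>
     T \<subseteq> carrier (endo_ring C A) \<and> finite T \<and> T \<noteq> {} \<and> is_joint_coequalizer C (Car A) (Car A) T (Car B) b"

lemma monoid_quotientD:
  assumes "monoid_quotient A T B b"
  shows "A \<in> Obj (Comm_cat C)" "B \<in> Obj (Comm_cat C)" "b \<in> Hom (Comm_cat C) A B"
    "T \<subseteq> carrier (endo_ring C A)" "finite T" "T \<noteq> {}" "is_joint_coequalizer C (Car A) (Car A) T (Car B) b"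
  using assms by (simp_all add: monoid_quotient_def)

lemma monoid_quotient_epic:
  assumes "monoid_quotient A T B b"
  shows "epic (bar A B b)"
    and "W \<in> Obj C \<Longrightarrow> epic (bar A B b \<star> idt W)"
    and "W \<in> Obj C \<Longrightarrow> epic (idt W \<star> bar A B b)"
    and "epic (bar A B b \<star> bar A B b)"
proof -
  note D = monoid_quotientD[OF assms]
  note epics = epic_joint_coequalizer[OF D(7,5,6), folded bar_def]
  show "epic (bar A B b)"
    and *: "W \<in> Obj C \<Longrightarrow> epic (bar A B b \<star> idt W)"
    and **: "W \<in> Obj C \<Longrightarrow> epic (idt W \<star> bar A B b)" for W
    using epics by blast+
  have "epic ((bar A B b \<star> idt (Car B)) \<bullet> (idt (Car A) \<star> bar A B b))"
    using D by (intro epic_acomp * **) simp_all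
  then show "epic (bar A B b \<star> bar A B b)"
    using D by simp
qed

lemma endoD:
  assumes "A \<in> Obj (Comm_cat C)" "t \<in> carrier (endo_ring C A)"
  shows "arr (bar A A t)" "bar A A t \<bullet> mm A = mm A \<bullet> (idt (Car A) \<star> bar A A t)"
    "bar A A t \<bullet> mm A = mm A \<bullet> (bar A A t \<star> idt (Car A))"
  using assms endo_left by (simp_all add: endo_iff arr_lift)

text \<open>The multiplication descends one variable at a time, to \<open>Q \<boxtimes> A\<close>
  and then to \<open>Q \<boxtimes> Q\<close>, because elements of \<open>T\<close> are linear in
  each factor. The monoid laws are checked after precomposition with tensor products involving
  \<open>P\<close>.\<close>

lemma monoid_quotient_exists:
  assumes A [simp]: "A \<in> Obj (Comm_cat C)" and T: "T \<subseteq> carrier (endo_ring C A)" "finite T" "T \<noteq> {}"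
  obtains B b where "monoid_quotient A T B b"
proof -
  let ?A = "Car A"
  have "T \<subseteq> Hom C ?A ?A"
    using T by (auto simp: endo_iff)
  then obtain Q p where jc: "is_joint_coequalizer C ?A ?A T Q p"
    using joint_coequalizer_exists[of ?A ?A T] T by auto
  define P where "P = Arrow ?A Q p"
  have Q [simp]: "Q \<in> Obj C" and P [simp]: "arr P" "adom P = ?A" "acod P = Q" "araw P = p"
    using joint_coequalizerD(4,5)[OF jc] by (simp_all add: P_def)
  note epics = epic_joint_coequalizer[OF jc T(2,3), folded P_def]
  have PT: "P \<bullet> bar A A s = P \<bullet> bar A A t" if "s \<in> T" "t \<in> T" for s t
    using joint_coequalizerD(6)[OF jc that] by (simp add: arrow_eq_iff)
  have E: "arr (bar A A t)" "bar A A t \<bullet> mm A = mm A \<bullet> (idt ?A \<star> bar A A t)"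
    "bar A A t \<bullet> mm A = mm A \<bullet> (bar A A t \<star> idt ?A)" if "t \<in> T" for t
    using endoD[of A t] that T by auto
  \<comment> \<open>Descent in the left variable: \<open>P \<star> idt W\<close> is again a joint
    coequalizer, so it suffices that \<open>f\<close> equates the tensored arrows.\<close>
  have lift: "\<exists>h. arr h \<and> adom h = Q \<boxtimes> W \<and> acod h = V \<and> h \<bullet> (P \<star> idt W) = f"
    if f: "arr f" "adom f = ?A \<boxtimes> W" "acod f = V" and W: "W \<in> Obj C"
      and eq: "\<And>s t. s \<in> T \<Longrightarrow> t \<in> T \<Longrightarrow> f \<bullet> (bar A A s \<star> idt W) = f \<bullet> (bar A A t \<star> idt W)" for f V W
  proof -
    have "V \<in> Obj C" "araw f \<in> Hom C (?A \<boxtimes> W) V"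
      using f unfolding arr_def by auto
    moreover have "araw f \<cdot> s = araw f \<cdot> t"
      if st: "s \<in> (\<lambda>t. t \<boxdot> Ident C W) ` T" "t \<in> (\<lambda>t. t \<boxdot> Ident C W) ` T" for s t
      using eq[THEN arg_cong[of _ _ araw]] st by auto
    ultimately obtain h where "h \<in> Hom C (Q \<boxtimes> W) V" "h \<cdot> (p \<boxdot> Ident C W) = araw f"
      by (rule joint_coequalizer_factor[OF joint_coequalizer_tensor[OF jc T(2,3) W]])
    then show ?thesis
      using f W \<open>V \<in> Obj C\<close> by (intro exI[of _ "Arrow (Q \<boxtimes> W) V h"]) (simp add: arrow_eq_iff)
  qed
  obtain M1 where M1 [simp]: "arr M1" "adom M1 = Q \<boxtimes> ?A" "acod M1 = Q" and M1P: "M1 \<bullet> (P \<star> idt ?A) = P \<bullet> mm A"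
  proof -
    have "(P \<bullet> mm A) \<bullet> (bar A A s \<star> idt ?A) = (P \<bullet> mm A) \<bullet> (bar A A t \<star> idt ?A)"
      if st: "s \<in> T" "t \<in> T" for s t
    proof -
      have "(P \<bullet> mm A) \<bullet> (bar A A t \<star> idt ?A) = (P \<bullet> bar A A t) \<bullet> mm A" if "t \<in> T" for t
        using E(1)[OF that] by (simp add: E(3)[OF that])
      then show ?thesis
        using st PT by metis
    qed
    from lift[of "P \<bullet> mm A" ?A Q, OF _ _ _ _ this] that show thesis by auto
  qed
  \<comment> \<open>The second descent requires that \<open>M1\<close> equate the arrows of
    \<open>T\<close> in its right variable. After \<open>P \<star> idt ?A\<close> this becomes
    \<open>P \<bullet> bar A A s = P \<bullet> bar A A t\<close>.\<close>
  have M1T: "M1 \<bullet> (idt Q \<star> bar A A s) = M1 \<bullet> (idt Q \<star> bar A A t)" if st: "s \<in> T" "t \<in> T" for s t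
  proof (rule epic_cancel)
    show "epic (P \<star> idt ?A)"
      by (rule epics) simp
    have "(M1 \<bullet> (idt Q \<star> bar A A t)) \<bullet> (P \<star> idt ?A) = (P \<bullet> bar A A t) \<bullet> mm A" if "t \<in> T" for t
    proof -
      have "(M1 \<bullet> (idt Q \<star> bar A A t)) \<bullet> (P \<star> idt ?A) = (M1 \<bullet> (P \<star> idt ?A)) \<bullet> (idt ?A \<star> bar A A t)"
        using E(1)[OF that] by simp
      also have "\<dots> = (P \<bullet> bar A A t) \<bullet> mm A"
        unfolding M1P using E(1)[OF that] by (simp add: E(2)[OF that])
      finally show ?thesis .
    qed
    then show "(M1 \<bullet> (idt Q \<star> bar A A s)) \<bullet> (P \<star> idt ?A) = (M1 \<bullet> (idt Q \<star> bar A A t)) \<bullet> (P \<star> idt ?A)"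
      using st PT by metis
  qed (use E(1)[OF st(1)] E(1)[OF st(2)] in simp_all)
  \<comment> \<open>\<open>lift\<close> treats the left variable, so the braiding brings the
    remaining copy of \<open>A\<close> there. \<open>M2\<close> is the multiplication with exchanged
    arguments; \<open>M\<close> restores their order.\<close>
  obtain M2 where M2 [simp]: "arr M2" "adom M2 = Q \<boxtimes> Q" "acod M2 = Q" and M2P: "M2 \<bullet> (P \<star> idt Q) = M1 \<bullet> brd ?A Q"
  proof -
    have "(M1 \<bullet> brd ?A Q) \<bullet> (bar A A s \<star> idt Q) = (M1 \<bullet> brd ?A Q) \<bullet> (bar A A t \<star> idt Q)"
      if st: "s \<in> T" "t \<in> T" for s t
    proof -
      have "(M1 \<bullet> brd ?A Q) \<bullet> (bar A A t \<star> idt Q) = (M1 \<bullet> (idt Q \<star> bar A A t)) \<bullet> brd ?A Q" if "t \<in> T" for t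
        using E(1)[OF that] brd_natural[of "bar A A t" "idt Q"] by simp
      then show ?thesis
        using st M1T by metis
    qed
    from lift[of "M1 \<bullet> brd ?A Q" Q Q, OF _ _ _ _ this] that show thesis by auto
  qed
  define M where "M = M2 \<bullet> brd Q Q"
  have M [simp]: "arr M" "adom M = Q \<boxtimes> Q" "acod M = Q"
    by (simp_all add: M_def)
  have "M \<bullet> (P \<star> P) = M2 \<bullet> (brd Q Q \<bullet> (P \<star> P))"
    by (simp add: M_def)
  also have "brd Q Q \<bullet> (P \<star> P) = (P \<star> P) \<bullet> brd ?A ?A"
    using brd_natural[of P P] by simp
  also have "M2 \<bullet> \<dots> = (M2 \<bullet> (P \<star> idt Q)) \<bullet> (idt ?A \<star> P) \<bullet> brd ?A ?A"
    by simp
  also have "\<dots> = M1 \<bullet> (brd ?A Q \<bullet> (idt ?A \<star> P)) \<bullet> brd ?A ?A"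
    unfolding M2P by simp
  also have "brd ?A Q \<bullet> (idt ?A \<star> P) = (P \<star> idt ?A) \<bullet> brd ?A ?A"
    using brd_natural[of "idt ?A" P] by simp
  also have "M1 \<bullet> \<dots> \<bullet> brd ?A ?A = M1 \<bullet> (P \<star> idt ?A)"
    by simp
  finally have MP: "M \<bullet> (P \<star> P) = P \<bullet> mm A"
    unfolding M1P .
  define B where "B = \<lparr>Car = Q, Mul = araw M, Unt = p \<cdot> Unt A\<rparr>"
  have [simp]: "Car B = Q" and mB [simp]: "mm B = M" and uB: "uu B = P \<bullet> uu A"
    by (simp_all add: B_def arrow_eq_iff)
  have PP: "epic (P \<star> P)"
    using epic_acomp[OF epics(3)[of ?A] epics(2)[of Q]] by simp
  \<comment> \<open>The arrow is decomposed into three factors, each applying \<open>P\<close> in a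
    single slot, to which the epics above apply.\<close>
  have PPP: "epic ((P \<star> P) \<star> P)"
    using epic_acomp[OF epics(3)[of "?A \<boxtimes> ?A"] epic_acomp[OF epics(5)[of ?A Q] epics(4)[of Q Q]]]
    by simp
  have B: "B \<in> Obj (Comm_cat C)"
  proof (rule comm_monoid_objectI)
    show "arr (mm B)" "arr (uu B)"
      by (simp_all add: uB)
    have "(M \<bullet> (M \<star> idt Q)) \<bullet> ((P \<star> P) \<star> P) = M \<bullet> ((M \<bullet> (P \<star> P)) \<star> P)"
      by simp
    also have "\<dots> = M \<bullet> ((P \<bullet> mm A) \<star> P)"
      by (simp only: MP)
    also have "\<dots> = (M \<bullet> (P \<star> P)) \<bullet> (mm A \<star> idt ?A)"
      by simp
    also have "\<dots> = P \<bullet> (mm A \<bullet> (mm A \<star> idt ?A))"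
      unfolding MP by simp
    also have "\<dots> = (P \<bullet> mm A) \<bullet> (idt ?A \<star> mm A) \<bullet> asc ?A ?A ?A"
      unfolding mm_assoc[OF A] by simp
    also have "\<dots> = (M \<bullet> (P \<star> (M \<bullet> (P \<star> P)))) \<bullet> asc ?A ?A ?A"
      unfolding MP by (simp flip: MP)
    also have "\<dots> = M \<bullet> (idt Q \<star> M) \<bullet> ((P \<star> P \<star> P) \<bullet> asc ?A ?A ?A)"
      by simp
    also have "(P \<star> P \<star> P) \<bullet> asc ?A ?A ?A = asc Q Q Q \<bullet> ((P \<star> P) \<star> P)"
      using asc_natural[of P P P] by simp
    also have "M \<bullet> (idt Q \<star> M) \<bullet> \<dots> = (M \<bullet> (idt Q \<star> M) \<bullet> asc Q Q Q) \<bullet> ((P \<star> P) \<star> P)"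
      by simp
    finally show "mm B \<bullet> (mm B \<star> idt (Car B)) = mm B \<bullet> (idt (Car B) \<star> mm B) \<bullet> asc (Car B) (Car B) (Car B)"
      using epic_cancel[OF PPP, of "M \<bullet> (M \<star> idt Q)" "M \<bullet> (idt Q \<star> M) \<bullet> asc Q Q Q"] by simp
    have "(M \<bullet> (uu B \<star> idt Q)) \<bullet> (idt (UnitObj C) \<star> P) = (M \<bullet> (P \<star> P)) \<bullet> (uu A \<star> idt ?A)"
      by (simp add: uB)
    also have "\<dots> = P \<bullet> (mm A \<bullet> (uu A \<star> idt ?A))"
      unfolding MP by simp
    also have "\<dots> = lun Q \<bullet> (idt (UnitObj C) \<star> P)"
      unfolding mm_unit_left[OF A] using lun_natural[of P] by simp
    finally show "mm B \<bullet> (uu B \<star> idt (Car B)) = lun (Car B)"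
      using epic_cancel[OF epics(3)[of "UnitObj C"], of "M \<bullet> (uu B \<star> idt Q)" "lun Q"] by (simp add: uB)
    have "(M \<bullet> (idt Q \<star> uu B)) \<bullet> (P \<star> idt (UnitObj C)) = (M \<bullet> (P \<star> P)) \<bullet> (idt ?A \<star> uu A)"
      by (simp add: uB)
    also have "\<dots> = P \<bullet> (mm A \<bullet> (idt ?A \<star> uu A))"
      unfolding MP by simp
    also have "\<dots> = run Q \<bullet> (P \<star> idt (UnitObj C))"
      unfolding mm_unit_right[OF A] using run_natural[of P] by simp
    finally show "mm B \<bullet> (idt (Car B) \<star> uu B) = run (Car B)"
      using epic_cancel[OF epics(2)[of "UnitObj C"], of "M \<bullet> (idt Q \<star> uu B)" "run Q"] by (simp add: uB)
    have "(M \<bullet> brd Q Q) \<bullet> (P \<star> P) = M \<bullet> (brd Q Q \<bullet> (P \<star> P))"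
      by simp
    also have "brd Q Q \<bullet> (P \<star> P) = (P \<star> P) \<bullet> brd ?A ?A"
      using brd_natural[of P P] by simp
    also have "M \<bullet> \<dots> = (M \<bullet> (P \<star> P)) \<bullet> brd ?A ?A"
      by simp
    also have "\<dots> = P \<bullet> (mm A \<bullet> brd ?A ?A)"
      unfolding MP by simp
    also have "\<dots> = M \<bullet> (P \<star> P)"
      unfolding mm_comm[OF A] MP ..
    finally show "mm B \<bullet> brd (Car B) (Car B) = mm B"
      using epic_cancel[OF PP, of "M \<bullet> brd Q Q" M] by simp
  qed
  have "bar A B p = P"
    by (simp add: arrow_eq_iff)
  then have "p \<in> Hom (Comm_cat C) A B"
    using joint_coequalizerD(5)[OF jc] by (simp add: Comm_hom_iff MP uB)
  then have "monoid_quotient A T B p"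
    using B T jc by (simp add: monoid_quotient_def)
  then show thesis by (rule that)
qed

section \<open>Universal properties of the quotient in modules and in monoids\<close>

lemma algebra_map_linear:
  assumes [simp]: "A \<in> Obj (Comm_cat C)" "B \<in> Obj (Comm_cat C)" and b [simp]: "b \<in> Hom (Comm_cat C) A B"
  shows "b \<in> Hom (Mod_cat C A) (self_module A) (algebra_module C B b)"
  using Comm_homD[OF b] by (simp add: Mod_hom_iff act_algebra flip: bar_mar(1))

text \<open>The factorization \<open>h\<close> exists in \<open>C\<close>. It is
  \<open>A\<close>-linear because both sides of the linearity law agree after
  \<open>idt (Car A) \<star> F\<close>, which is epic.\<close>

lemma monoid_quotient_Mod:
  assumes mq: "monoid_quotient A T B b"
  shows "is_joint_coequalizer (Mod_cat C A) (self_module A) (self_module A) T (algebra_module C B b) b"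
proof (rule joint_coequalizerI)
  note D = monoid_quotientD[OF mq]
  note [simp] = D(1-3) algebra_module_obj[OF D(1-3)]
  define F where "F = bar A B b"
  have F [simp]: "arr F" "adom F = Car A" "acod F = Car B"
    by (simp_all add: F_def)
  show "self_module A \<in> Obj (Mod_cat C A)" "self_module A \<in> Obj (Mod_cat C A)"
    "algebra_module C B b \<in> Obj (Mod_cat C A)" "b \<in> Hom (Mod_cat C A) (self_module A) (algebra_module C B b)"
    by (simp_all add: algebra_map_linear)
  show "T \<subseteq> Hom (Mod_cat C A) (self_module A) (self_module A)"
    using D(4) by (simp add: endo_ring_def)
  show "b \<cdot>\<^bsub>Mod_cat C A\<^esub> s = b \<cdot>\<^bsub>Mod_cat C A\<^esub> t" if "s \<in> T" "t \<in> T" for s t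
    using joint_coequalizerD(6)[OF D(7) that] by simp
  fix W a
  assume W: "W \<in> Obj (Mod_cat C A)" and a: "a \<in> Hom (Mod_cat C A) (self_module A) W"
    and eq: "\<forall>s\<in>T. \<forall>t\<in>T. a \<cdot>\<^bsub>Mod_cat C A\<^esub> s = a \<cdot>\<^bsub>Mod_cat C A\<^esub> t"
  have W' [simp]: "MCar W \<in> Obj C" "arr (act A W)"
    using W by (auto intro: MCar_obj)
  obtain h where h: "h \<in> Hom C (Car B) (MCar W)" "h \<cdot> b = a"
  proof (rule joint_coequalizer_factor[OF D(7) W'(1)])
    show "a \<in> Hom C (Car A) (MCar W)"
      using Mod_homD(1)[OF a] by simp
    show "a \<cdot> s = a \<cdot> t" if "s \<in> T" "t \<in> T" for s t
      using eq that unfolding Mod_cat_simps by blast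
  qed
  define H where "H = mar (algebra_module C B b) W h"
  have H [simp]: "arr H" "adom H = Car B" "acod H = MCar W"
    using h by (simp_all add: H_def arr_lift)
  have HF: "mar (self_module A) W a = H \<bullet> F"
    using h(2) by (simp add: arrow_eq_iff H_def F_def)
  have "(H \<bullet> mm B \<bullet> (F \<star> idt (Car B))) \<bullet> (idt (Car A) \<star> F) = H \<bullet> (mm B \<bullet> (F \<star> F))"
    by simp
  also have "\<dots> = H \<bullet> F \<bullet> mm A"
    using Comm_homD(2)[OF D(3)] by (simp add: F_def)
  also have "\<dots> = act A W \<bullet> (idt (Car A) \<star> (H \<bullet> F))"
    using Mod_homD(2)[OF a] by (simp add: HF)
  also have "\<dots> = (act A W \<bullet> (idt (Car A) \<star> H)) \<bullet> (idt (Car A) \<star> F)"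
    by simp
  finally have "H \<bullet> mm B \<bullet> (F \<star> idt (Car B)) = act A W \<bullet> (idt (Car A) \<star> H)"
    by (rule epic_cancel[OF monoid_quotient_epic(3)[OF mq, folded F_def], rotated]) simp_all
  then have hM: "h \<in> Hom (Mod_cat C A) (algebra_module C B b) W"
    using h(1) by (simp add: Mod_hom_iff act_algebra flip: H_def F_def)
  show "\<exists>!h. h \<in> Hom (Mod_cat C A) (algebra_module C B b) W \<and> h \<cdot>\<^bsub>Mod_cat C A\<^esub> b = a"
  proof (rule ex1I)
    show "h \<in> Hom (Mod_cat C A) (algebra_module C B b) W \<and> h \<cdot>\<^bsub>Mod_cat C A\<^esub> b = a"
      using hM h by simp
    fix h' assume h': "h' \<in> Hom (Mod_cat C A) (algebra_module C B b) W \<and> h' \<cdot>\<^bsub>Mod_cat C A\<^esub> b = a"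
    then have "h' \<in> Hom C (Car B) (MCar W)"
      using Mod_homD(1)[of h' A "algebra_module C B b" W] by simp
    then show "h' = h"
      using epiD[OF joint_coequalizer_epi[OF D(7)] W'(1), of h' h] h h' by simp
  qed
qed

text \<open>Multiplicativity of the factorization is tested after the epic
  \<open>F \<star> F\<close>; thus \<open>B\<close> also has its universal property in
  \<open>Comm_cat C\<close>.\<close>

lemma monoid_quotient_factor:
  assumes mq: "monoid_quotient A T B b" and Y [simp]: "Y \<in> Obj (Comm_cat C)" and f: "f \<in> Hom (Comm_cat C) A Y"
    and eq: "\<And>s t. s \<in> T \<Longrightarrow> t \<in> T \<Longrightarrow> f \<cdot> s = f \<cdot> t"
  obtains h where "h \<in> Hom (Comm_cat C) B Y" "h \<cdot> b = f"
proof -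
  note D = monoid_quotientD[OF mq]
  note [simp] = D(1-3)
  obtain h where h: "h \<in> Hom C (Car B) (Car Y)" "h \<cdot> b = f"
    by (rule joint_coequalizer_factor[OF D(7) Car_obj[OF Y] Comm_homD(1)[OF f] eq])
  define F G H where "F = bar A B b" and "G = bar A Y f" and "H = bar B Y h"
  have F [simp]: "arr F" "adom F = Car A" "acod F = Car B" and G [simp]: "arr G" "adom G = Car A" "acod G = Car Y"
    and H [simp]: "arr H" "adom H = Car B" "acod H = Car Y"
    using f h by (simp_all add: F_def G_def H_def arr_lift Comm_homD(1))
  have HF: "H \<bullet> F = G"
    using h by (simp add: H_def F_def G_def bar_acomp)
  have F_hom: "F \<bullet> mm A = mm B \<bullet> (F \<star> F)" "F \<bullet> uu A = uu B" and G_hom: "G \<bullet> mm A = mm Y \<bullet> (G \<star> G)" "G \<bullet> uu A = uu Y"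
    using Comm_homD[OF f] Comm_homD[OF D(3)] by (simp_all add: F_def G_def)
  have "(H \<bullet> mm B) \<bullet> (F \<star> F) = (H \<bullet> F) \<bullet> mm A"
    by (simp add: F_hom)
  also have "\<dots> = (mm Y \<bullet> (H \<star> H)) \<bullet> (F \<star> F)"
    by (simp add: HF G_hom)
  finally have "H \<bullet> mm B = mm Y \<bullet> (H \<star> H)"
    by (rule epic_cancel[OF monoid_quotient_epic(4)[OF mq, folded F_def], rotated 0]) simp_all
  moreover have "H \<bullet> uu B = (H \<bullet> F) \<bullet> uu A"
    by (simp add: F_hom)
  then have "H \<bullet> uu B = uu Y"
    by (simp only: HF G_hom)
  ultimately have "h \<in> Hom (Comm_cat C) B Y"
    using h(1) by (simp add: Comm_hom_iff H_def)
  with h(2) show thesis by (intro that)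
qed

end

section \<open>Zero arrows and zero modules\<close>

context abelian_category
begin

lemma zero_in_hom [simp]: "X \<in> Obj C \<Longrightarrow> Y \<in> Obj C \<Longrightarrow> Zero C X Y \<in> Hom C X Y"
  using monoid.one_closed[OF group.is_monoid[OF comm_group.axioms(2)[OF hom_comm_group]], of X Y]
  by (simp add: hom_group_def)

lemma add_self_zero:
  assumes "X \<in> Obj C" "Y \<in> Obj C" "f \<in> Hom C X Y" "Add C f f = f"
  shows "f = Zero C X Y"
proof -
  interpret H: comm_group "hom_group C X Y"
    using assms by (intro hom_comm_group)
  show ?thesis
    using H.r_cancel_one[of f f] assms by (simp add: hom_group_def)
qed

lemma zero_add_zero:
  assumes "X \<in> Obj C" "Y \<in> Obj C"
  shows "Add C (Zero C X Y) (Zero C X Y) = Zero C X Y"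
proof -
  interpret H: comm_group "hom_group C X Y"
    using assms by (intro hom_comm_group)
  show ?thesis
    using H.l_one[OF H.one_closed] by (simp add: hom_group_def)
qed

lemma comp_zero_right:
  assumes "X \<in> Obj C" "Y \<in> Obj C" "Z \<in> Obj C" "g \<in> Hom C Y Z"
  shows "g \<cdot> Zero C X Y = Zero C X Z"
  using assms comp_add_right[of X Y Z "Zero C X Y" "Zero C X Y" g] comp_in_hom[of X Y Z "Zero C X Y" g]
  by (intro add_self_zero) (simp_all add: zero_add_zero)

lemma comp_zero_left:
  assumes "X \<in> Obj C" "Y \<in> Obj C" "Z \<in> Obj C" "f \<in> Hom C X Y"
  shows "Zero C Y Z \<cdot> f = Zero C X Z"
  using assms comp_add_left[of X Y Z f "Zero C Y Z" "Zero C Y Z"] comp_in_hom[of X Y Z f "Zero C Y Z"]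
  by (intro add_self_zero) (simp_all add: zero_add_zero)

end

lemma zero_objectD:
  assumes "is_zero_object C Z" "X \<in> Obj C"
  shows "f \<in> Hom C X Z \<Longrightarrow> g \<in> Hom C X Z \<Longrightarrow> f = g" "f' \<in> Hom C Z X \<Longrightarrow> g' \<in> Hom C Z X \<Longrightarrow> f' = g'"
    "\<exists>f. f \<in> Hom C X Z" "\<exists>f. f \<in> Hom C Z X"
  using assms unfolding is_zero_object_def by blast+

context cocomplete_monoidal_category
begin

text \<open>A zero object is the colimit of the empty diagram, so \<open>Z \<boxtimes> W\<close> is
  again initial; the braiding transfers this to \<open>W \<boxtimes> Z\<close>. Legs and arrow maps
  of the empty diagram are never evaluated, hence \<open>undefined\<close>.\<close>

lemma tensor_zero_object:
  assumes Z: "is_zero_object C Z" and W: "W \<in> Obj C" and Y: "Y \<in> Obj C"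
    and f: "f \<in> Hom C (W \<boxtimes> Z) Y" and g: "g \<in> Hom C (W \<boxtimes> Z) Y"
  shows "f = g"
proof -
  define J :: "('u, 'u) cat" where
    "J = \<lparr>Obj = {}, Hom = (\<lambda>_ _. {}), Ident = undefined, Comp = undefined\<rparr>"
  have "category J"
    by standard (auto simp: J_def)
  then have J: "small_category J"
    by (intro small_finite_category[OF universe]) (simp add: finite_category_def J_def)
  have [simp]: "Z \<in> Obj C"
    using Z by (simp add: is_zero_object_def)
  have F: "is_functor J C F G" for F G
    by (simp add: is_functor_def J_def)
  have "is_colimit J C (\<lambda>_. Z) undefined Z undefined"
    using Z unfolding is_colimit_def is_cocone_def is_zero_object_def by (simp add: J_def)
  then have "is_colimit J C (\<lambda>_. Z \<boxtimes> W) (\<lambda>i j u. undefined i j u \<boxdot> Ident C W) (Z \<boxtimes> W) (\<lambda>i. undefined i \<boxdot> Ident C W)"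
    using tensor W J F unfolding tensor_preserves_colimits_def by blast
  moreover have "is_cocone J C (\<lambda>_. Z \<boxtimes> W) (\<lambda>i j u. undefined i j u \<boxdot> Ident C W) Y undefined"
    using Y by (simp add: is_cocone_def J_def)
  ultimately have "\<exists>!h. h \<in> Hom C (Z \<boxtimes> W) Y \<and> (\<forall>i\<in>Obj J. h \<cdot> (undefined i \<boxdot> Ident C W) = undefined i)"
    by (rule colimit_ex1)
  then have ex: "\<exists>!h. h \<in> Hom C (Z \<boxtimes> W) Y"
    by (simp add: J_def)
  let ?f = "Arrow (W \<boxtimes> Z) Y f" let ?g = "Arrow (W \<boxtimes> Z) Y g"
  have fg: "arr ?f" "arr ?g"
    using f g W Y by simp_all
  have "arr (?f \<bullet> brd Z W)" "arr (?g \<bullet> brd Z W)"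
    using fg W by simp_all
  then have "f \<cdot> Braid C Z W \<in> Hom C (Z \<boxtimes> W) Y" "g \<cdot> Braid C Z W \<in> Hom C (Z \<boxtimes> W) Y"
    by (simp_all add: arr_def)
  then have "?f \<bullet> brd Z W = ?g \<bullet> brd Z W"
    using ex by (auto simp: arrow_eq_iff)
  then have "?f = ?g"
    by (rule epic_cancel[OF epic_brd, rotated 2]) (use fg W in simp_all)
  then show ?thesis by simp
qed

definition zero_module :: "('o, 'm) monoid_object \<Rightarrow> 'o \<Rightarrow> ('o, 'm) module_object" where
  "zero_module A Z = \<lparr>MCar = Z, MAct = Zero C (Car A \<boxtimes> Z) Z\<rparr>"

text \<open>Each module or linearity law to be checked is an equation between arrows into
  \<open>Z\<close> or out of \<open>Car A \<boxtimes> Z\<close>, and parallel arrows of these kinds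
  agree.\<close>

lemma zero_module:
  assumes A [simp]: "A \<in> Obj (Comm_cat C)" and Z: "is_zero_object C Z"
  shows "is_zero_object (Mod_cat C A) (zero_module A Z)"
proof -
  have [simp]: "Z \<in> Obj C"
    using Z by (simp add: is_zero_object_def)
  have [simp]: "MCar (zero_module A Z) = Z"
    by (simp add: zero_module_def)
  have into: "f = g" if "arr f" "arr g" "adom f = adom g" "acod f = Z" "acod g = Z" for f g
    using that zero_objectD(1)[OF Z, of "adom f" "araw f" "araw g"]
    by (simp add: arrow_eq_iff arr_def del: arr_obj)
  have out: "f = g" if "arr f" "arr g" "adom f = Car A \<boxtimes> Z" "adom g = Car A \<boxtimes> Z" "acod f = acod g" for f g
    using that tensor_zero_object[OF Z, of "Car A" "acod f" "araw f" "araw g"]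
    by (simp add: arrow_eq_iff arr_def del: arr_obj)
  have a [simp]: "arr (act A (zero_module A Z))"
    by (simp add: act_def zero_module_def)
  have "zero_module A Z \<in> Obj (Mod_cat C A)"
    unfolding module_iff[OF A] by (intro conjI into) simp_all
  moreover have "(\<exists>!f. f \<in> Hom (Mod_cat C A) M (zero_module A Z)) \<and> (\<exists>!f. f \<in> Hom (Mod_cat C A) (zero_module A Z) M)"
    if M: "M \<in> Obj (Mod_cat C A)" for M
  proof -
    have [simp]: "MCar M \<in> Obj C" "arr (act A M)"
      using M by (auto intro: MCar_obj)
    have [simp]: "arr (mar M (zero_module A Z) (Zero C (MCar M) Z))" "arr (mar (zero_module A Z) M (Zero C Z (MCar M)))"
      by (simp_all add: arr_lift)
    have "Zero C (MCar M) Z \<in> Hom (Mod_cat C A) M (zero_module A Z)"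
      unfolding Mod_hom_iff by (intro conjI into) simp_all
    moreover have "Zero C Z (MCar M) \<in> Hom (Mod_cat C A) (zero_module A Z) M"
      unfolding Mod_hom_iff by (intro conjI out) simp_all
    moreover have "f = g" if "f \<in> Hom (Mod_cat C A) M (zero_module A Z)" "g \<in> Hom (Mod_cat C A) M (zero_module A Z)" for f g
      using that[THEN Mod_homD(1)] zero_objectD(1)[OF Z, of "MCar M" f g] by simp
    moreover have "f = g" if "f \<in> Hom (Mod_cat C A) (zero_module A Z) M" "g \<in> Hom (Mod_cat C A) (zero_module A Z) M" for f g
      using that[THEN Mod_homD(1)] zero_objectD(2)[OF Z, of "MCar M" f g] by simp
    ultimately show ?thesis by blast
  qed
  ultimately show ?thesis
    unfolding is_zero_object_def by blast
qed

text \<open>The zero arrow is a composite of two linear arrows through the zero module. A direct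
  check would call for \<open>idt \<star> 0 = 0\<close>.\<close>

lemma zero_linear:
  assumes A: "A \<in> Obj (Comm_cat C)" and M: "M \<in> Obj (Mod_cat C A)" and N: "N \<in> Obj (Mod_cat C A)"
  shows "Zero C (MCar M) (MCar N) \<in> Hom (Mod_cat C A) M N"
proof -
  interpret M: category "Mod_cat C A"
    by (rule category_Mod[OF A])
  obtain Z where Z: "is_zero_object C Z"
    using zero_object by blast
  note ZM = zero_module[OF A Z]
  have [simp]: "MCar M \<in> Obj C" "MCar N \<in> Obj C"
    using M N by (auto intro: MCar_obj)
  have ZO: "Z \<in> Obj C" "zero_module A Z \<in> Obj (Mod_cat C A)" "MCar (zero_module A Z) = Z"
    using Z ZM by (simp_all add: is_zero_object_def zero_module_def)
  obtain f g where fg: "f \<in> Hom (Mod_cat C A) M (zero_module A Z)" "g \<in> Hom (Mod_cat C A) (zero_module A Z) N"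
    using zero_objectD(3,4)[OF ZM] M N by blast
  then have "f = Zero C (MCar M) Z"
    using fg[THEN Mod_homD(1)] ZO by (intro zero_objectD(1)[OF Z, of "MCar M"]) simp_all
  moreover have "g \<cdot> f \<in> Hom (Mod_cat C A) M N"
    using M.comp_in_hom[of M "zero_module A Z" N f g] fg M N ZO by simp
  ultimately show ?thesis
    using comp_zero_right[of "MCar M" Z "MCar N" g] fg(2)[THEN Mod_homD(1)] ZO by simp
qed

lemma zero_endo: "A \<in> Obj (Comm_cat C) \<Longrightarrow> Zero C (Car A) (Car A) \<in> carrier (endo_ring C A)"
  using zero_linear[of A "self_module A" "self_module A"] by (simp add: endo_ring_def)

section \<open>Principal quotients\<close>

lemma zero_module_factor:
  assumes A: "A \<in> Obj (Comm_cat C)" and Z: "is_zero_object (Mod_cat C A) Z"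
    and M: "M \<in> Obj (Mod_cat C A)" and N: "N \<in> Obj (Mod_cat C A)"
    and f: "f \<in> Hom (Mod_cat C A) M Z" and g: "g \<in> Hom (Mod_cat C A) Z N"
  shows "g \<cdot> f = Zero C (MCar M) (MCar N)"
proof -
  have ZO: "Z \<in> Obj (Mod_cat C A)"
    using Z by (simp add: is_zero_object_def)
  have "f = Zero C (MCar M) (MCar Z)"
    by (rule zero_objectD(1)[OF Z M f]) (rule zero_linear[OF A M ZO])
  then show ?thesis
    using comp_zero_right[OF M[THEN MCar_obj] ZO[THEN MCar_obj] N[THEN MCar_obj] Mod_homD(1)[OF g]] by simp
qed

text \<open>The pushout of \<open>t\<close> along \<open>A \<rightarrow> 0\<close> is the
  coequalizer of \<open>t\<close> and \<open>0\<close>, but the pushout lives in modules and the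
  coequalizer in \<open>C\<close>. To pass from \<open>C\<close> to modules,
  \<open>monoid_quotient_Mod\<close> suffices. In the other direction the pushout is compared with a
  quotient constructed in \<open>C\<close>, and the comparison isomorphism carries the property
  over.\<close>

lemma principal_quotient_iff:
  assumes A [simp]: "A \<in> Obj (Comm_cat C)" and t: "t \<in> carrier (endo_ring C A)"
  shows "is_principal_quotient C A t Q p \<longleftrightarrow> monoid_quotient A {t, Zero C (Car A) (Car A)} Q p"
proof -
  let ?S = "self_module A" let ?M = "Mod_cat C A" let ?z0 = "Zero C (Car A) (Car A)"
  interpret M: category ?M
    by (rule category_Mod) simp
  have t': "t \<in> Hom ?M ?S ?S" "t \<in> Hom C (Car A) (Car A)"
    using t endo_iff[of t A] by (auto simp: endo_ring_def)
  have T: "{t, ?z0} \<subseteq> carrier (endo_ring C A)"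
    using t zero_endo by simp
  have const: "(\<forall>u\<in>{t, ?z0}. \<forall>v\<in>{t, ?z0}. a \<cdot> u = a \<cdot> v) \<longleftrightarrow> a \<cdot> t = Zero C (Car A) W"
    if "a \<in> Hom C (Car A) W" "W \<in> Obj C" for a W
    using comp_zero_right[of "Car A" "Car A" W a] that by auto
  show ?thesis
  proof
    assume mq: "monoid_quotient A {t, ?z0} Q p"
    note D = monoid_quotientD[OF mq]
    let ?Q = "algebra_module C Q p"
    have jM: "is_joint_coequalizer ?M ?S ?S {t, ?z0} ?Q p"
      by (rule monoid_quotient_Mod[OF mq])
    have Q: "?Q \<in> Obj ?M" "p \<in> Hom ?M ?S ?Q" "p \<in> Hom C (Car A) (Car Q)" "Car Q \<in> Obj C"
      using joint_coequalizerD(4,5)[OF jM] D by (simp_all add: Comm_homD)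
    have pt: "p \<cdot> t = Zero C (Car A) (Car Q)"
      using joint_coequalizerD(6)[OF D(7), of t ?z0] comp_zero_right[of "Car A" "Car A" "Car Q" p] Q by simp
    obtain Z where Z: "is_zero_object C Z"
      using zero_object by blast
    let ?Z = "zero_module A Z"
    note ZM = zero_module[OF A Z]
    have ZO: "?Z \<in> Obj ?M"
      using ZM by (simp add: is_zero_object_def)
    obtain z q where z: "z \<in> Hom ?M ?S ?Z" and q: "q \<in> Hom ?M ?Z ?Q"
      using zero_objectD(3)[OF ZM self_module_obj[OF A]] zero_objectD(4)[OF ZM Q(1)] by blast
    have "is_pushout ?M ?S ?S ?Z t z ?Q p q"
      unfolding is_pushout_def
    proof (intro conjI ballI impI)
      show "p \<cdot>\<^bsub>?M\<^esub> t = q \<cdot>\<^bsub>?M\<^esub> z"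
        using zero_module_factor[OF A ZM _ Q(1) z q] pt by simp
      fix W a c
      assume W: "W \<in> Obj ?M" and a: "a \<in> Hom ?M ?S W" and c: "c \<in> Hom ?M ?Z W" and eq: "a \<cdot>\<^bsub>?M\<^esub> t = c \<cdot>\<^bsub>?M\<^esub> z"
      have "a \<cdot> t = Zero C (Car A) (MCar W)"
        using eq zero_module_factor[OF A ZM _ W z c] by simp
      then have "\<forall>u\<in>{t, ?z0}. \<forall>v\<in>{t, ?z0}. a \<cdot> u = a \<cdot> v"
        by (rule iffD2[OF const[OF Mod_homD(1)[OF a, unfolded module_object_simps] MCar_obj[OF W]]])
      then have "\<exists>!h. h \<in> Hom ?M ?Q W \<and> h \<cdot> p = a"
        using jM W a unfolding is_joint_coequalizer_def Mod_cat_simps by blast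
      \<comment> \<open>Arrows out of the zero module are unique, so compatibility with the second
        leg of the pushout is automatic.\<close>
      moreover have "h \<cdot> q = c" if "h \<in> Hom ?M ?Q W" for h
        using zero_objectD(2)[OF ZM W _ c] M.comp_in_hom[OF ZO Q(1) W q that] by simp
      ultimately show "\<exists>!h. h \<in> Hom ?M ?Q W \<and> h \<cdot>\<^bsub>?M\<^esub> p = a \<and> h \<cdot>\<^bsub>?M\<^esub> q = c"
        unfolding Mod_cat_simps by blast
    qed (use t' z q Q ZO in simp_all)
    then show "is_principal_quotient C A t Q p"
      unfolding is_principal_quotient_def using D ZM by blast
  next
    assume "is_principal_quotient C A t Q p"
    then obtain Z z q where Q [simp]: "Q \<in> Obj (Comm_cat C)" and p: "p \<in> Hom (Comm_cat C) A Q"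
      and ZM: "is_zero_object ?M Z" and po: "is_pushout ?M ?S ?S Z t z (algebra_module C Q p) p q"
      unfolding is_principal_quotient_def by blast
    let ?Q = "algebra_module C Q p"
    have zq: "z \<in> Hom ?M ?S Z" "q \<in> Hom ?M Z ?Q" "?Q \<in> Obj ?M" "p \<in> Hom ?M ?S ?Q" "Z \<in> Obj ?M" "p \<cdot> t = q \<cdot> z"
      using po unfolding is_pushout_def by simp_all
    have "is_joint_coequalizer ?M ?S ?S {t, ?z0} ?Q p"
    proof (rule joint_coequalizerI)
      show "{t, ?z0} \<subseteq> Hom ?M ?S ?S"
        using T by (simp add: endo_ring_def)
      have "p \<cdot> t = Zero C (Car A) (Car Q)"
        using zero_module_factor[OF A ZM _ zq(3,1,2)] zq(6) by simp
      then have "\<forall>u\<in>{t, ?z0}. \<forall>v\<in>{t, ?z0}. p \<cdot> u = p \<cdot> v"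
        by (rule iffD2[OF const[OF Comm_homD(1)[OF p] Car_obj[OF Q]]])
      then show "p \<cdot>\<^bsub>?M\<^esub> u = p \<cdot>\<^bsub>?M\<^esub> v" if "u \<in> {t, ?z0}" "v \<in> {t, ?z0}" for u v
        using that unfolding Mod_cat_simps by blast
      fix W a
      assume W: "W \<in> Obj ?M" and a: "a \<in> Hom ?M ?S W" and eq: "\<forall>u\<in>{t, ?z0}. \<forall>v\<in>{t, ?z0}. a \<cdot>\<^bsub>?M\<^esub> u = a \<cdot>\<^bsub>?M\<^esub> v"
      obtain c where c: "c \<in> Hom ?M Z W"
        using zero_objectD(4)[OF ZM W] by blast
      have "a \<cdot> t = Zero C (Car A) (MCar W)"
        by (rule iffD1[OF const[OF Mod_homD(1)[OF a, unfolded module_object_simps] MCar_obj[OF W]]])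
          (use eq in \<open>unfold Mod_cat_simps\<close>)
      then have "a \<cdot> t = c \<cdot> z"
        using zero_module_factor[OF A ZM _ W zq(1) c] by simp
      then have "\<exists>!h. h \<in> Hom ?M ?Q W \<and> h \<cdot> p = a \<and> h \<cdot> q = c"
        using po W a c unfolding is_pushout_def Mod_cat_simps by blast
      moreover have "h \<cdot> q = c" if "h \<in> Hom ?M ?Q W" for h
        using zero_objectD(2)[OF ZM W _ c] M.comp_in_hom[OF zq(5,3) W zq(2) that] by simp
      ultimately show "\<exists>!h. h \<in> Hom ?M ?Q W \<and> h \<cdot>\<^bsub>?M\<^esub> p = a"
        unfolding Mod_cat_simps by blast
    qed (use zq in simp_all)
    note jQ = this
    obtain B b where mq: "monoid_quotient A {t, ?z0} B b"
      using monoid_quotient_exists[OF A T] by auto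
    note D = monoid_quotientD[OF mq]
    obtain k l where kl: "is_inverse ?M (algebra_module C B b) ?Q k l" and kb: "k \<cdot> b = p"
      by (rule M.joint_coequalizer_unique[OF monoid_quotient_Mod[OF mq] jQ, unfolded Mod_cat_simps])
    have "is_inverse C (Car B) (Car Q) k l"
      using kl by (auto simp: is_inverse_def dest: Mod_homD(1))
    then have "is_joint_coequalizer C (Car A) (Car A) {t, ?z0} (Car Q) p"
      using joint_coequalizer_iso[OF D(7), of "Car Q" k l] kb by simp
    then show "monoid_quotient A {t, ?z0} Q p"
      using p T by (simp add: monoid_quotient_def)
  qed
qed

section \<open>Wide spans, annihilators and quotients by ideals\<close>

lemma Obj_wide_span_category [simp]: "Obj (wide_span_category I) = insert None (Some ` I)"
  by (simp add: wide_span_category_def relation_category_def)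

text \<open>The conditions at the identities of the wide span are trivial, which leaves one
  compatibility for each \<open>t\<close>.\<close>

lemma wide_span_cocone_iff:
  assumes A: "A \<in> Obj (Comm_cat C)" and Q: "\<forall>t\<in>I. Q t \<in> Obj (Comm_cat C)"
  shows "is_cocone (wide_span_category I) (Comm_cat C)
      (\<lambda>i. case i of None \<Rightarrow> A | Some t \<Rightarrow> Q t)
      (\<lambda>i j _. case (i, j) of (None, Some t) \<Rightarrow> p t
         | _ \<Rightarrow> Ident (Comm_cat C) (case i of None \<Rightarrow> A | Some t \<Rightarrow> Q t)) Y \<kappa> \<longleftrightarrow>
    Y \<in> Obj (Comm_cat C) \<and> \<kappa> None \<in> Hom (Comm_cat C) A Y \<and>
    (\<forall>t\<in>I. \<kappa> (Some t) \<in> Hom (Comm_cat C) (Q t) Y \<and> \<kappa> (Some t) \<cdot> p t = \<kappa> None)"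
proof -
  have id: "f \<cdot> Ident C (Car X) = f"
    if "X \<in> Obj (Comm_cat C)" "Y \<in> Obj (Comm_cat C)" "f \<in> Hom (Comm_cat C) X Y" for X f
    using category.ident_right[OF category_Comm that] by simp
  show ?thesis
    unfolding is_cocone_def
    by (auto simp: wide_span_category_def relation_category_def id A Q)
qed

text \<open>A cocone on the wide span is a morphism \<open>A \<rightarrow> Y\<close> that factors
  through every \<open>A/tA\<close>. It then annihilates \<open>I\<close>, in particular
  \<open>T\<close>, so it factors through \<open>B\<close>. The remaining legs agree because each
  \<open>p t\<close> is epic. In this way the finite set \<open>T\<close> controls a colimit over
  all of \<open>I\<close>.\<close>

lemma ideal_quotient_colimit:
  assumes A: "A \<in> Obj (Comm_cat C)" and mq: "monoid_quotient A T B b"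
    and T: "Zero C (Car A) (Car A) \<in> T" "T \<subseteq> I" and I: "I \<subseteq> carrier (endo_ring C A)"
    and kills: "\<And>t. t \<in> I \<Longrightarrow> b \<cdot> t = Zero C (Car A) (Car B)"
    and Q: "\<And>t. t \<in> I \<Longrightarrow> monoid_quotient A {t, Zero C (Car A) (Car A)} (Q t) (p t)"
  obtains \<iota> where "\<iota> None = b"
    and "is_colimit (wide_span_category I) (Comm_cat C)
      (\<lambda>i. case i of None \<Rightarrow> A | Some t \<Rightarrow> Q t)
      (\<lambda>i j _. case (i, j) of (None, Some t) \<Rightarrow> p t
         | _ \<Rightarrow> Ident (Comm_cat C) (case i of None \<Rightarrow> A | Some t \<Rightarrow> Q t)) B \<iota>"
proof -
  let ?z = "Zero C (Car A) (Car A)"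
  note D = monoid_quotientD[OF mq]
  have DQ: "Q t \<in> Obj (Comm_cat C)" "p t \<in> Hom (Comm_cat C) A (Q t)" if "t \<in> I" for t
    using monoid_quotientD[OF Q[OF that]] by simp_all
  then have DQ': "\<forall>t\<in>I. Q t \<in> Obj (Comm_cat C)"
    by blast
  have bz: "b \<cdot> ?z = Zero C (Car A) (Car B)"
    using T kills by blast
  have "\<exists>h. h \<in> Hom (Comm_cat C) (Q t) B \<and> h \<cdot> p t = b" if t: "t \<in> I" for t
  proof -
    have "b \<cdot> u = b \<cdot> v" if "u \<in> {t, ?z}" "v \<in> {t, ?z}" for u v
      using that t bz kills by auto
    then show ?thesis
      by (rule monoid_quotient_factor[OF Q[OF t] D(2,3)]) blast+
  qed
  then obtain h where h: "\<And>t. t \<in> I \<Longrightarrow> h t \<in> Hom (Comm_cat C) (Q t) B \<and> h t \<cdot> p t = b"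
    by metis
  let ?F = "\<lambda>i. case i of None \<Rightarrow> A | Some t \<Rightarrow> Q t"
  let ?G = "\<lambda>i j _. case (i, j) of (None, Some t) \<Rightarrow> p t
         | _ \<Rightarrow> Ident (Comm_cat C) (case i of None \<Rightarrow> A | Some t \<Rightarrow> Q t)"
  let ?\<iota> = "\<lambda>i. case i of None \<Rightarrow> b | Some t \<Rightarrow> h t"
  have ex1: "\<exists>!k. k \<in> Hom (Comm_cat C) B Y \<and> (\<forall>i\<in>Obj (wide_span_category I). k \<cdot>\<^bsub>Comm_cat C\<^esub> ?\<iota> i = \<kappa> i)"
    if "is_cocone (wide_span_category I) (Comm_cat C) ?F ?G Y \<kappa>" for Y \<kappa>
  proof -
    have Y: "Y \<in> Obj (Comm_cat C)" and f: "\<kappa> None \<in> Hom (Comm_cat C) A Y"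
      and \<kappa>: "\<And>t. t \<in> I \<Longrightarrow> \<kappa> (Some t) \<in> Hom (Comm_cat C) (Q t) Y \<and> \<kappa> (Some t) \<cdot> p t = \<kappa> None"
      using that unfolding wide_span_cocone_iff[OF A DQ'] by simp_all
    \<comment> \<open>Since \<open>p t\<close> equates \<open>t\<close> with the zero arrow, so does
      every arrow that factors through it.\<close>
    have fz: "\<kappa> None \<cdot> t = \<kappa> None \<cdot> ?z" if t: "t \<in> I" for t
    proof -
      have h: "t \<in> Hom C (Car A) (Car A)" "?z \<in> Hom C (Car A) (Car A)"
        using t I A by (auto simp: endo_iff)
      have "\<kappa> (Some t) \<cdot> (p t \<cdot> t) = \<kappa> (Some t) \<cdot> (p t \<cdot> ?z)"
        using joint_coequalizerD(6)[OF monoid_quotientD(7)[OF Q[OF t]], of t ?z] by simp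
      then show ?thesis
        using comp_assoc[of "Car A" "Car A" "Car (Q t)" "Car Y" _ "p t" "\<kappa> (Some t)"] h \<kappa>[OF t] DQ[OF t] A Y
        by (simp add: Comm_homD(1))
    qed
    have "\<kappa> None \<cdot> u = \<kappa> None \<cdot> v" if "u \<in> T" "v \<in> T" for u v
      using that T fz by (metis subsetD)
    then obtain k where k: "k \<in> Hom (Comm_cat C) B Y" "k \<cdot> b = \<kappa> None"
      by (rule monoid_quotient_factor[OF mq Y f])
    have kh: "k \<cdot> h t = \<kappa> (Some t)" if t: "t \<in> I" for t
    proof -
      have "(k \<cdot> h t) \<cdot> p t = \<kappa> (Some t) \<cdot> p t"
        using comp_assoc[of "Car A" "Car (Q t)" "Car B" "Car Y" "p t" "h t" k] h[OF t] k \<kappa>[OF t] DQ[OF t] A Y D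
        by (simp add: Comm_homD(1))
      moreover have "k \<cdot> h t \<in> Hom C (Car (Q t)) (Car Y)"
        using comp_in_hom[of "Car (Q t)" "Car B" "Car Y" "h t" k] h[OF t] k DQ[OF t] Y D by (simp add: Comm_homD(1))
      ultimately show ?thesis
        using epiD[OF joint_coequalizer_epi[OF monoid_quotientD(7)[OF Q[OF t]]], of "Car Y"] \<kappa>[OF t] Y
        by (simp add: Comm_homD(1))
    qed
    show ?thesis
    proof (intro ex1I[of _ k] conjI ballI)
      show "k \<cdot>\<^bsub>Comm_cat C\<^esub> ?\<iota> i = \<kappa> i" if "i \<in> Obj (wide_span_category I)" for i
        using that kh k(2) unfolding Comm_cat_simps by auto
      fix k' assume "k' \<in> Hom (Comm_cat C) B Y \<and> (\<forall>i\<in>Obj (wide_span_category I). k' \<cdot>\<^bsub>Comm_cat C\<^esub> ?\<iota> i = \<kappa> i)"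
      then have "k' \<in> Hom (Comm_cat C) B Y" "k' \<cdot>\<^bsub>Comm_cat C\<^esub> ?\<iota> None = \<kappa> None"
        by simp_all
      then show "k' = k"
        using epiD[OF joint_coequalizer_epi[OF D(7)], of "Car Y" k' k] k Y by (simp add: Comm_homD(1))
    qed (rule k(1))
  qed
  show thesis
  proof (rule that[of ?\<iota>])
    show "is_colimit (wide_span_category I) (Comm_cat C) ?F ?G B ?\<iota>"
      unfolding is_colimit_def
    proof (intro conjI allI impI)
      show "is_cocone (wide_span_category I) (Comm_cat C) ?F ?G B ?\<iota>"
        unfolding wide_span_cocone_iff[OF A DQ'] using D h by simp
    qed (rule ex1)
  qed simp
qed

text \<open>The purpose is to pass from generators to the ideal they generate. Composing with
  \<open>t\<close> on the right preserves \<open>f \<cdot> s = 0\<close> directly; composing on the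
  left reduces to this by \<open>endo_commute\<close>.\<close>

lemma annihilator_ideal:
  assumes A [simp]: "A \<in> Obj (Comm_cat C)" and R: "ring (endo_ring C A)"
    and W [simp]: "W \<in> Obj C" and f: "f \<in> Hom C (Car A) W"
  shows "ideal {t \<in> carrier (endo_ring C A). f \<cdot> t = Zero C (Car A) W} (endo_ring C A)"
proof -
  let ?R = "endo_ring C A" let ?J = "{t \<in> carrier ?R. f \<cdot> t = Zero C (Car A) W}"
  interpret R: ring ?R by (rule R)
  have hom: "t \<in> Hom C (Car A) (Car A)" if "t \<in> carrier ?R" for t
    using that by (simp add: endo_iff)
  have add: "add ?R = Add C" and mult: "monoid.mult ?R = Comp C" and zero: "zero ?R = Zero C (Car A) (Car A)"
    by (simp_all add: endo_ring_def)
  have f_add: "f \<cdot> Add C s t = Add C (f \<cdot> s) (f \<cdot> t)" if "s \<in> carrier ?R" "t \<in> carrier ?R" for s t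
    using comp_add_right[of "Car A" "Car A" W s t f] that hom f by simp
  interpret H: comm_group "hom_group C (Car A) W"
    by (rule hom_comm_group) simp_all
  have H: "carrier (hom_group C (Car A) W) = Hom C (Car A) W" "monoid.mult (hom_group C (Car A) W) = Add C"
    "one (hom_group C (Car A) W) = Zero C (Car A) W"
    by (simp_all add: hom_group_def)
  have f0: "f \<cdot> Zero C (Car A) (Car A) = Zero C (Car A) W"
    using comp_zero_right[of "Car A" "Car A" W f] f by simp
  show ?thesis
  proof (rule idealI[OF R])
    show "subgroup ?J (add_monoid ?R)"
    proof (rule R.add.subgroupI)
      show "?J \<noteq> {}"
        using f0 R.zero_closed by (auto simp: zero)
      fix s assume s: "s \<in> ?J"
      then have neg: "\<ominus>\<^bsub>?R\<^esub> s \<in> carrier ?R" "Add C s (\<ominus>\<^bsub>?R\<^esub> s) = Zero C (Car A) (Car A)"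
        using R.r_neg[of s] by (simp_all add: add zero)
      have "Add C (f \<cdot> s) (f \<cdot> \<ominus>\<^bsub>?R\<^esub> s) = f \<cdot> Add C s (\<ominus>\<^bsub>?R\<^esub> s)"
        using f_add[of s "\<ominus>\<^bsub>?R\<^esub> s"] s neg(1) by simp
      also have "\<dots> = Zero C (Car A) W"
        unfolding neg(2) by (rule f0)
      finally have "Add C (f \<cdot> s) (f \<cdot> \<ominus>\<^bsub>?R\<^esub> s) = Zero C (Car A) W" .
      moreover have "f \<cdot> \<ominus>\<^bsub>?R\<^esub> s \<in> Hom C (Car A) W"
        using comp_in_hom[of "Car A" "Car A" W _ f] hom[OF neg(1)] f by simp
      ultimately show "\<ominus>\<^bsub>?R\<^esub> s \<in> ?J"
        using H.l_one[of "f \<cdot> \<ominus>\<^bsub>?R\<^esub> s"] s neg by (simp add: H)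
      fix t assume t: "t \<in> ?J"
      show "s \<oplus>\<^bsub>?R\<^esub> t \<in> ?J"
        using s t f_add[of s t] R.add.m_closed[of s t] zero_add_zero[of "Car A" W] by (simp add: add)
    qed auto
    fix s t assume s: "s \<in> ?J" and t: "t \<in> carrier ?R"
    have "f \<cdot> s \<cdot> t = Zero C (Car A) W"
      using comp_assoc[of "Car A" "Car A" "Car A" W t s f] hom[of s] hom[of t] s t f
        comp_zero_left[of "Car A" "Car A" W t] by simp
    then show "s \<otimes>\<^bsub>?R\<^esub> t \<in> ?J" "t \<otimes>\<^bsub>?R\<^esub> s \<in> ?J"
      using s t R.m_closed[of s t] endo_commute[OF A _ t, of s] by (auto simp: mult)
  qed
qed

text \<open>The annihilator of \<open>f\<close> is an ideal containing \<open>S\<close>, hence it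
  contains the ideal generated by \<open>S\<close>.\<close>

lemma annihilates_ideal:
  assumes A: "A \<in> Obj (Comm_cat C)" and R: "ring (endo_ring C A)" and S: "S \<subseteq> carrier (endo_ring C A)"
    and W: "W \<in> Obj C" and f: "f \<in> Hom C (Car A) W"
    and fS: "\<And>s. s \<in> S \<Longrightarrow> f \<cdot> s = Zero C (Car A) W" and t: "t \<in> Idl\<^bsub>endo_ring C A\<^esub> S"
  shows "f \<cdot> t = Zero C (Car A) W"
  using ring.genideal_minimal[OF R annihilator_ideal[OF A R W f], of S] S fS t by blast

text \<open>From right to left, the wide span is assembled from chosen principal quotients. From
  left to right, the given colimit is compared with a constructed quotient over the same principal
  quotients; this is why \<open>ideal_quotient_colimit\<close> allows arbitrary \<open>Q\<close> and
  \<open>p\<close>.\<close>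

lemma ideal_quotient_iff:
  assumes A: "A \<in> Obj (Comm_cat C)" and R: "ring (endo_ring C A)"
    and S: "finite S" "S \<subseteq> carrier (endo_ring C A)" and I: "I = Idl\<^bsub>endo_ring C A\<^esub> S"
  shows "is_ideal_quotient C A I B b \<longleftrightarrow> monoid_quotient A (insert (Zero C (Car A) (Car A)) S) B b"
proof -
  let ?z = "Zero C (Car A) (Car A)" let ?T = "insert ?z S"
  interpret R: ring "endo_ring C A" by (rule R)
  have IR: "ideal I (endo_ring C A)"
    unfolding I by (rule R.genideal_ideal[OF S(2)])
  have SI: "S \<subseteq> I"
    unfolding I by (rule R.genideal_self[OF S(2)])
  have Icar: "I \<subseteq> carrier (endo_ring C A)"
    using ideal.Icarr[OF IR] by blast
  have zI: "?z \<in> I"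
    using additive_subgroup.zero_closed[OF ideal.axioms(1)[OF IR]] by (simp add: endo_ring_def)
  have T: "?T \<subseteq> carrier (endo_ring C A)" "finite ?T" "?T \<noteq> {}" "?T \<subseteq> I"
    using S SI zI Icar by auto
  have kills: "b \<cdot> t = Zero C (Car A) (Car B)" if mq: "monoid_quotient A ?T B b" and t: "t \<in> I" for B b t
  proof (rule annihilates_ideal[OF A R S(2) _ _ _ t[unfolded I]])
    note D = monoid_quotientD[OF mq]
    show "Car B \<in> Obj C" "b \<in> Hom C (Car A) (Car B)"
      using D by (simp_all add: Comm_homD(1))
    then show "b \<cdot> s = Zero C (Car A) (Car B)" if "s \<in> S" for s
      using joint_coequalizerD(6)[OF D(7), of s ?z] that A comp_zero_right[of "Car A" "Car A" "Car B" b] by simp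
  qed
  show ?thesis
  proof
    assume mq: "monoid_quotient A ?T B b"
    have "\<exists>Q p. monoid_quotient A {t, ?z} Q p" if "t \<in> I" for t
      by (rule monoid_quotient_exists[OF A, of "{t, ?z}"]) (use that Icar zI in blast)+
    then obtain Q p where Qp: "\<And>t. t \<in> I \<Longrightarrow> monoid_quotient A {t, ?z} (Q t) (p t)"
      by metis
    have "\<forall>t\<in>I. is_principal_quotient C A t (Q t) (p t)"
      using Qp principal_quotient_iff[OF A] Icar by blast
    moreover obtain \<iota> where "\<iota> None = b"
      "is_colimit (wide_span_category I) (Comm_cat C)
      (\<lambda>i. case i of None \<Rightarrow> A | Some t \<Rightarrow> Q t)
      (\<lambda>i j _. case (i, j) of (None, Some t) \<Rightarrow> p t
         | _ \<Rightarrow> Ident (Comm_cat C) (case i of None \<Rightarrow> A | Some t \<Rightarrow> Q t)) B \<iota>"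
      by (rule ideal_quotient_colimit[OF A mq _ T(4) Icar kills[OF mq] Qp]) simp_all
    ultimately show "is_ideal_quotient C A I B b"
      unfolding is_ideal_quotient_def by blast
  next
    assume "is_ideal_quotient C A I B b"
    then obtain Q p \<iota> where Qp: "\<forall>t\<in>I. is_principal_quotient C A t (Q t) (p t)"
      and col: "is_colimit (wide_span_category I) (Comm_cat C)
      (\<lambda>i. case i of None \<Rightarrow> A | Some t \<Rightarrow> Q t)
      (\<lambda>i j _. case (i, j) of (None, Some t) \<Rightarrow> p t
         | _ \<Rightarrow> Ident (Comm_cat C) (case i of None \<Rightarrow> A | Some t \<Rightarrow> Q t)) B \<iota>" and b: "b = \<iota> None"
      unfolding is_ideal_quotient_def by blast
    have Qp': "monoid_quotient A {t, ?z} (Q t) (p t)" if "t \<in> I" for t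
      using Qp principal_quotient_iff[OF A] Icar that by blast
    obtain B' b' where mq: "monoid_quotient A ?T B' b'"
      using monoid_quotient_exists[OF A T(1-3)] .
    note D = monoid_quotientD[OF mq]
    obtain \<iota>' where \<iota>': "\<iota>' None = b'"
      and col': "is_colimit (wide_span_category I) (Comm_cat C)
      (\<lambda>i. case i of None \<Rightarrow> A | Some t \<Rightarrow> Q t)
      (\<lambda>i j _. case (i, j) of (None, Some t) \<Rightarrow> p t
         | _ \<Rightarrow> Ident (Comm_cat C) (case i of None \<Rightarrow> A | Some t \<Rightarrow> Q t)) B' \<iota>'"
      by (rule ideal_quotient_colimit[OF A mq _ T(4) Icar kills[OF mq] Qp']) simp_all
    have Q: "\<forall>t\<in>I. Q t \<in> Obj (Comm_cat C)"
      using monoid_quotientD(2)[OF Qp'] by blast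
    have B: "B \<in> Obj (Comm_cat C)" "b \<in> Hom (Comm_cat C) A B"
      using col wide_span_cocone_iff[OF A Q] unfolding is_colimit_def b by blast+
    obtain k l where kl: "is_inverse (Comm_cat C) B' B k l"
      and k: "\<And>i. i \<in> Obj (wide_span_category I) \<Longrightarrow> k \<cdot>\<^bsub>Comm_cat C\<^esub> \<iota>' i = \<iota> i"
      by (rule category.colimit_unique[OF category_Comm col' col]) (use A Q in auto)
    have "k \<cdot> b' = b"
      using k[of None] \<iota>' b by simp
    moreover have "is_inverse C (Car B') (Car B) k l"
      using kl by (simp add: is_inverse_def Comm_homD(1))
    ultimately have "is_joint_coequalizer C (Car A) (Car A) ?T (Car B) b"
      using joint_coequalizer_iso[OF D(7), of "Car B" k l] B by simp
    then show "monoid_quotient A ?T B b"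
      using A B T by (simp add: monoid_quotient_def)
  qed
qed

end

section \<open>Endomorphisms of quotients\<close>

lemma comm_group_sum_group:
  assumes "\<And>i. i \<in> I \<Longrightarrow> comm_group (G i)"
  shows "comm_group (sum_group I G)"
proof (rule group.group_comm_groupI)
  have grp: "\<And>i. i \<in> I \<Longrightarrow> group (G i)"
    using assms by (simp add: comm_group_def)
  then show "group (sum_group I G)"
    by (rule sum_group)
  fix x y assume "x \<in> carrier (sum_group I G)" "y \<in> carrier (sum_group I G)"
  then show "x \<otimes>\<^bsub>sum_group I G\<^esub> y = y \<otimes>\<^bsub>sum_group I G\<^esub> x"
    using assms by (auto simp: carrier_sum_group[OF grp] PiE_iff comm_monoid.m_comm comm_group_def
        intro!: restrict_ext)
qed

context cocomplete_monoidal_category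
begin

text \<open>(C1) asks for free objects in the diagram; rank one is the colimit over a discrete
  category with one object.\<close>

lemma self_module_free:
  assumes A: "A \<in> Obj (Comm_cat C)"
  shows "is_free_module_of_rank C A 1 (self_module A)"
proof -
  let ?S = "self_module A" let ?M = "Mod_cat C A" let ?J = "discrete_category {..<1::nat}"
  interpret M: category ?M
    by (rule category_Mod[OF A])
  have S: "?S \<in> Obj ?M" "Ident ?M ?S \<in> Hom ?M ?S ?S"
    using A by (simp_all add: M.ident_in_hom del: Mod_cat_simps)
  have J: "Obj ?J = {0}" "Hom ?J 0 0 = UNIV"
    by (auto simp: discrete_category_def relation_category_def)
  have "is_colimit ?J ?M (\<lambda>_. ?S) (\<lambda>_ _ _. Ident ?M ?S) ?S (\<lambda>_. Ident ?M ?S)"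
    unfolding is_colimit_def is_cocone_def J
    using S M.ident_right[OF S(1)] by (auto simp: J simp del: Mod_cat_simps)
  then show ?thesis
    unfolding is_free_module_of_rank_def by blast
qed

text \<open>(C1) presents the linear maps \<open>A \<rightarrow> B\<close> as
  \<open>(\<E>(A) \<oplus> \<E>(A))/K\<close>, one summand for each object of the parallel diagram,
  and the class of \<open>v\<close> corresponds to \<open>b \<cdot> v y\<close>. Surjectivity gives
  the first claim. For the second, every generator of \<open>K\<close> has its
  \<open>y\<close>-component in \<open>I\<close>, so an element of the summand at \<open>y\<close>
  whose class vanishes lies in \<open>I\<close>.\<close>

lemma hom_to_quotient:
  assumes mq: "monoid_quotient A T B b" and z: "Zero C (Car A) (Car A) \<in> T"
    and I: "ideal I (endo_ring C A)" and TI: "T \<subseteq> I"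
    and C1: "hom_preserves_finite_free_colimits U C A"
  shows "g \<in> Hom (Mod_cat C A) (self_module A) (algebra_module C B b) \<Longrightarrow> \<exists>x\<in>carrier (endo_ring C A). g = b \<cdot> x"
    and "t \<in> carrier (endo_ring C A) \<Longrightarrow> b \<cdot> t = Zero C (Car A) (Car B) \<Longrightarrow> t \<in> I"
proof -
  note D = monoid_quotientD[OF mq]
  note [simp] = D(1-3)
  let ?M = "Mod_cat C A" let ?S = "self_module A" let ?Q = "algebra_module C B b"
  let ?z = "Zero C (Car A) (Car A)" let ?R = "endo_ring C A"
  interpret M: category ?M
    by (rule category_Mod) simp
  interpret I: ideal I ?R by (rule I)
  obtain x y :: 'u and N :: "'u set" and d where N: "x \<noteq> y" "finite N" "d ` N = T"
    using obtain_parallel_index[OF universe D(5)] .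
  \<comment> \<open>With the label of the zero arrow as \<open>u0\<close>, the leg
    \<open>\<iota> x\<close> is \<open>b \<cdot> 0 = 0\<close>, and the summand at \<open>x\<close>
    disappears from the comparison map.\<close>
  obtain u0 where u0: "u0 \<in> N" "d u0 = ?z"
    using N(3) z by force
  let ?J = "parallel_category x y N"
  define F :: "'u \<Rightarrow> ('o, 'm) module_object" where "F = (\<lambda>_. ?S)"
  define G :: "'u \<Rightarrow> 'u \<Rightarrow> 'u \<Rightarrow> 'm" where "G = (\<lambda>i j u. if i = j then Ident ?M ?S else d u)"
  define \<iota> where "\<iota> = (\<lambda>i. if i = y then b else b \<cdot> G x y u0)"
  have jc: "is_joint_coequalizer ?M ?S ?S T ?Q b"
    by (rule monoid_quotient_Mod[OF mq])
  note DM = joint_coequalizerD[OF jc]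
  have F: "is_functor ?J ?M F G"
    using M.functor_parallel_category[of x y ?S ?S d N, unfolded if_cancel] N DM(1-3)
    unfolding F_def G_def by blast
  have "G x y ` N = T"
    using N by (auto simp: G_def)
  then have colim: "is_colimit ?J ?M F G ?Q \<iota>"
    using M.joint_coequalizer_parallel_colimit[of F x y G N ?Q b u0, unfolded Mod_cat_simps] jc F N(1) u0(1)
    unfolding \<iota>_def by (simp add: F_def)
  have "hom_colimit_comparison_iso ?M ?S ?J F G ?Q \<iota>"
    using C1 F colim finite_parallel_category[OF N(2)] self_module_free[OF D(1)]
    unfolding hom_preserves_finite_free_colimits_def F_def by blast
  moreover define Sg where "Sg = hom_sum_group ?M ?S ?J F"
  moreover define K where "K = hom_sum_relations ?M ?S ?J F G"
  moreover define H where "H = hom_group ?M ?S ?Q"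
  ultimately obtain \<phi> where \<phi>: "\<phi> \<in> iso (Sg Mod K) H"
    and \<phi>_eq: "\<And>v. v \<in> carrier Sg \<Longrightarrow> \<phi> (K #>\<^bsub>Sg\<^esub> v) = finprod H (\<lambda>i. \<iota> i \<cdot> v i) {x, y}"
    unfolding hom_colimit_comparison_iso_def by auto
  have hgR: "hom_group ?M ?S ?S = add_monoid ?R"
    by (simp add: hom_group_def endo_ring_def)
  have Sg_def': "Sg = sum_group {x, y} (\<lambda>_. add_monoid ?R)"
    unfolding Sg_def hom_sum_group_def F_def hgR by simp
  have cgR: "comm_group (add_monoid ?R)"
    by (rule I.a_comm_group)
  interpret Sg: comm_group Sg
    unfolding Sg_def' by (rule comm_group_sum_group[OF cgR])
  have grpR: "group (add_monoid ?R)"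
    using cgR by (simp add: comm_group_def)
  have carSg: "v \<in> carrier Sg \<longleftrightarrow> v \<in> {x, y} \<rightarrow>\<^sub>E carrier ?R" for v
    unfolding Sg_def' by (subst carrier_sum_group[OF grpR]) auto
  have multSg: "v \<otimes>\<^bsub>Sg\<^esub> w = (\<lambda>i\<in>{x, y}. v i \<oplus>\<^bsub>?R\<^esub> w i)" and oneSg: "\<one>\<^bsub>Sg\<^esub> = (\<lambda>i\<in>{x, y}. \<zero>\<^bsub>?R\<^esub>)" for v w
    unfolding Sg_def' by simp_all
  have invSg: "inv\<^bsub>Sg\<^esub> v = (\<lambda>i\<in>{x, y}. \<ominus>\<^bsub>?R\<^esub> v i)" if "v \<in> carrier Sg" for v
    using that inv_sum_group[OF grpR] unfolding Sg_def' by (simp add: a_inv_def)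
  let ?in = "hom_sum_inj ?M ?S ?J F"
  have z_R: "\<zero>\<^bsub>?R\<^esub> = ?z"
    by (simp add: endo_ring_def)
  have in_def: "?in i v = (\<lambda>j\<in>{x, y}. if j = i then v else \<zero>\<^bsub>?R\<^esub>)" for i v
    unfolding hom_sum_inj_def F_def z_R Mod_cat_simps module_object_simps Obj_parallel_category ..
  have in_car: "?in i v \<in> carrier Sg" if "v \<in> carrier ?R" for i v
    using that unfolding carSg in_def by auto
  let ?rel = "{?in i v \<otimes>\<^bsub>Sg\<^esub> inv\<^bsub>Sg\<^esub> ?in j (G i j u \<cdot> v) | i j u v.
        i \<in> {x, y} \<and> j \<in> {x, y} \<and> u \<in> Hom ?J i j \<and> v \<in> carrier ?R}"
  have K_def': "K = generate Sg ?rel"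
    unfolding K_def hom_sum_relations_def Sg_def F_def by (simp add: endo_ring_def)
  have Gv: "G i j u \<cdot> v \<in> carrier ?R" if "i \<in> {x, y}" "j \<in> {x, y}" "u \<in> Hom ?J i j" "v \<in> carrier ?R" for i j u v
  proof (cases "i = j")
    case True
    then show ?thesis
      using that(4) ident_left[of "Car A" "Car A" v] by (simp add: G_def endo_iff)
  next
    case False
    then have "d u \<in> carrier ?R"
      using that(3) N(3) D(4) by (auto simp: parallel_category_def split: if_splits)
    then show ?thesis
      using I.m_closed[of "d u" v] that(4) False by (simp add: G_def endo_ring_def)
  qed
  have rel: "?rel \<subseteq> carrier Sg"
    using in_car Gv by auto
  have K: "subgroup K Sg"
    unfolding K_def' by (rule Sg.generate_is_subgroup[OF rel])
  interpret K: normal K Sg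
    by (rule Sg.subgroup_imp_normal[OF K])
  interpret Q: group "Sg Mod K"
    by (rule K.factorgroup_is_group)
  \<comment> \<open>\<open>L\<close> is the preimage of \<open>I\<close> under projection to the
    summand at \<open>y\<close>; it serves as an upper bound for \<open>K\<close>.\<close>
  define L where "L = {v \<in> carrier Sg. v y \<in> I}"
  have "subgroup L Sg"
  proof (rule Sg.subgroupI)
    show "L \<noteq> {}"
      using Sg.one_closed by (auto simp: L_def oneSg)
  next
    fix v assume "v \<in> L"
    then show "inv\<^bsub>Sg\<^esub> v \<in> L"
      using Sg.inv_closed[of v] by (simp add: L_def invSg)
  next
    fix v w assume "v \<in> L" "w \<in> L"
    then show "v \<otimes>\<^bsub>Sg\<^esub> w \<in> L"
      using Sg.m_closed[of v w] by (simp add: L_def multSg)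
  qed (auto simp: L_def)
  moreover have "?rel \<subseteq> L"
  proof clarify
    fix i j u v assume ij: "i \<in> {x, y}" "j \<in> {x, y}" "u \<in> Hom ?J i j" and v: "v \<in> carrier ?R"
    \<comment> \<open>An identity arrow gives the trivial relation. An arrow labelled
      \<open>u\<close> gives the \<open>y\<close>-component \<open>- (d u \<cdot> v)\<close>, which
      lies in \<open>I\<close> because \<open>d u\<close> does.\<close>
    have "(?in i v \<otimes>\<^bsub>Sg\<^esub> inv\<^bsub>Sg\<^esub> ?in j (G i j u \<cdot> v)) y \<in> I"
    proof (cases "i = j")
      case True
      then have "G i j u \<cdot> v = v"
        using v ident_left[of "Car A" "Car A" v] by (simp add: G_def endo_iff)
      then show ?thesis
        using True v invSg[OF in_car[OF v, of i]] by (auto simp: multSg in_def I.r_neg)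
    next
      case False
      then have j: "i = x" "j = y" "u \<in> N"
        using ij by (auto simp: parallel_category_def split: if_splits)
      then have "d u \<otimes>\<^bsub>?R\<^esub> v \<in> I"
        using N(3) TI v by (intro I.I_r_closed) auto
      then have "G i j u \<cdot> v \<in> I"
        using False by (simp add: G_def endo_ring_def)
      then show ?thesis
        using j N(1) invSg[OF in_car[OF Gv[OF ij v], of j]] by (auto simp: multSg in_def)
    qed
    moreover have "?in i v \<otimes>\<^bsub>Sg\<^esub> inv\<^bsub>Sg\<^esub> ?in j (G i j u \<cdot> v) \<in> carrier Sg"
      using in_car[OF v] in_car[OF Gv[OF ij v]] by simp
    ultimately show "?in i v \<otimes>\<^bsub>Sg\<^esub> inv\<^bsub>Sg\<^esub> ?in j (G i j u \<cdot> v) \<in> L"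
      by (simp add: L_def)
  qed
  ultimately have KL: "K \<subseteq> L"
    unfolding K_def' by (intro Sg.generate_subgroup_incl)
  have H_simps: "carrier H = Hom ?M ?S ?Q" "monoid.mult H = Add C" "\<one>\<^bsub>H\<^esub> = Zero C (Car A) (Car B)"
    by (simp_all add: H_def hom_group_def)
  have bz: "b \<cdot> ?z = Zero C (Car A) (Car B)"
    using comp_zero_right[of "Car A" "Car A" "Car B" b] by (simp add: Comm_homD(1))
  \<comment> \<open>Additivity of \<open>\<boxtimes>\<close> has not been established, so closure under addition is transported along \<open>\<phi>\<close>.\<close>
  have H_closed: "Add C f g \<in> carrier H" if fg: "f \<in> carrier H" "g \<in> carrier H" for f g
  proof -
    obtain v w where "v \<in> carrier (Sg Mod K)" "w \<in> carrier (Sg Mod K)" "f = \<phi> v" "g = \<phi> w"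
      using \<phi> fg unfolding iso_def bij_betw_def by blast
    then have "Add C f g = \<phi> (v \<otimes>\<^bsub>Sg Mod K\<^esub> w)" "v \<otimes>\<^bsub>Sg Mod K\<^esub> w \<in> carrier (Sg Mod K)"
      using \<phi> Q.m_closed by (auto simp: iso_def hom_def H_simps)
    then show ?thesis
      using \<phi> unfolding iso_def hom_def by auto
  qed
  interpret HC: comm_group "hom_group C (Car A) (Car B)"
    by (rule hom_comm_group) simp_all
  have HC: "carrier (hom_group C (Car A) (Car B)) = Hom C (Car A) (Car B)"
    "monoid.mult (hom_group C (Car A) (Car B)) = Add C" "\<one>\<^bsub>hom_group C (Car A) (Car B)\<^esub> = Zero C (Car A) (Car B)"
    by (simp_all add: hom_group_def)
  have H_sub: "f \<in> Hom C (Car A) (Car B)" if "f \<in> carrier H" for f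
    using Mod_homD(1)[of f A ?S ?Q] that by (simp add: H_simps)
  \<comment> \<open>Evaluating \<open>finprod H\<close> requires a commutative monoid; apart from
    closure and the unit, its laws are inherited from the group of all arrows
    \<open>Car A \<rightarrow> Car B\<close>.\<close>
  interpret H: comm_monoid H
  proof (rule comm_monoidI)
    show "\<one>\<^bsub>H\<^esub> \<in> carrier H"
      using zero_linear[of A ?S ?Q] DM(4) by (simp add: H_simps)
    fix f g h assume "f \<in> carrier H" "g \<in> carrier H" "h \<in> carrier H"
    then show "f \<otimes>\<^bsub>H\<^esub> g \<otimes>\<^bsub>H\<^esub> h = f \<otimes>\<^bsub>H\<^esub> (g \<otimes>\<^bsub>H\<^esub> h)" "f \<otimes>\<^bsub>H\<^esub> g = g \<otimes>\<^bsub>H\<^esub> f" "\<one>\<^bsub>H\<^esub> \<otimes>\<^bsub>H\<^esub> f = f" "f \<otimes>\<^bsub>H\<^esub> g \<in> carrier H"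
      using HC.m_assoc[of f g h] HC.m_comm[of f g] HC.l_one[of f] H_sub H_closed[of f g]
      by (simp_all add: H_simps(2,3) HC)
  qed
  have eval: "\<phi> (K #>\<^bsub>Sg\<^esub> v) = b \<cdot> v y" if v: "v \<in> carrier Sg" for v
  proof -
    have vxy: "v x \<in> carrier ?R" "v y \<in> carrier ?R"
      using v carSg by auto
    have "\<iota> x \<cdot> v x = Zero C (Car A) (Car B)"
      using comp_zero_left[of "Car A" "Car A" "Car B" "v x"] vxy N(1) u0
      by (simp add: \<iota>_def G_def bz endo_iff)
    moreover have "b \<cdot> v y \<in> carrier H"
      using M.comp_in_hom[of ?S ?S ?Q "v y" b] vxy DM by (simp add: H_simps endo_ring_def)
    ultimately show ?thesis
      using \<phi>_eq[OF v] N(1) H.one_closed H.l_one[of "b \<cdot> v y"] H.r_one[of "b \<cdot> v y"]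
      by (simp add: \<iota>_def H_simps)
  qed
  show "\<exists>x\<in>carrier ?R. g = b \<cdot> x" if g: "g \<in> Hom ?M ?S ?Q"
  proof -
    have "g \<in> \<phi> ` carrier (Sg Mod K)"
      using \<phi> g by (simp add: iso_def bij_betw_def H_simps)
    then obtain v where "v \<in> carrier Sg" "g = \<phi> (K #>\<^bsub>Sg\<^esub> v)"
      unfolding carrier_FactGroup by blast
    then show ?thesis
      using eval carSg by auto
  qed
  show "t \<in> I" if t: "t \<in> carrier ?R" and bt: "b \<cdot> t = Zero C (Car A) (Car B)"
  proof -
    \<comment> \<open>Placed in the summand at \<open>y\<close>, the element \<open>t\<close> is
      sent to \<open>b \<cdot> t = 0\<close>. Injectivity of \<open>\<phi>\<close> puts it into
      \<open>K\<close>, hence into \<open>L\<close>, and its \<open>y\<close>-component is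
      \<open>t\<close> itself.\<close>
    have "\<phi> (K #>\<^bsub>Sg\<^esub> ?in y t) = \<phi> (K #>\<^bsub>Sg\<^esub> \<one>\<^bsub>Sg\<^esub>)"
      using eval[OF in_car[OF t]] eval[OF Sg.one_closed] bt bz by (simp add: in_def oneSg z_R)
    then have "K #>\<^bsub>Sg\<^esub> ?in y t = K #>\<^bsub>Sg\<^esub> \<one>\<^bsub>Sg\<^esub>"
      using \<phi> in_car[OF t] unfolding iso_def bij_betw_def inj_on_def by (auto simp: carrier_FactGroup)
    then have "?in y t \<in> K"
      using Sg.rcos_self[OF in_car[OF t] K] Sg.coset_mult_one[of K] subgroup.subset[OF K] by auto
    then show ?thesis
      using KL by (auto simp: L_def in_def)
  qed
qed

section \<open>The endomorphism ring of the quotient\<close>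

lemma endo_eqI:
  assumes mq: "monoid_quotient A T B b"
    and "s \<in> Hom C (Car B) (Car B)" "t \<in> Hom C (Car B) (Car B)" "s \<cdot> b = t \<cdot> b"
  shows "s = t"
  using epiD[OF joint_coequalizer_epi[OF monoid_quotientD(7)[OF mq]] _ assms(2-4)] monoid_quotientD(2)[OF mq]
  by simp

text \<open>\<open>b \<cdot> t\<close> equates the arrows of \<open>T\<close> because these commute
  with \<open>t\<close>; linearity of the descended arrow follows by cancelling the epic
  \<open>F \<star> F\<close>.\<close>

lemma endo_descends:
  assumes mq: "monoid_quotient A T B b" and t: "t \<in> carrier (endo_ring C A)"
  shows "\<exists>t'\<in>carrier (endo_ring C B). t' \<cdot> b = b \<cdot> t"
proof -
  note D = monoid_quotientD[OF mq]
  note [simp] = D(1-3)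
  let ?A = "Car A" let ?B = "Car B"
  have b: "b \<in> Hom C ?A ?B" and t': "t \<in> Hom C ?A ?A" and bt: "b \<cdot> t \<in> Hom C ?A ?B"
    using t comp_in_hom[of ?A ?A ?B t b] by (simp_all add: Comm_homD(1) endo_iff)
  have eq: "(b \<cdot> t) \<cdot> s = (b \<cdot> t) \<cdot> s'" if s: "s \<in> T" "s' \<in> T" for s s'
  proof -
    have "(b \<cdot> t) \<cdot> u = (b \<cdot> u) \<cdot> t" if "u \<in> T" for u
    proof -
      have u: "u \<in> carrier (endo_ring C A)"
        using D(4) that by blast
      then show ?thesis
        using comp_assoc[of ?A ?A ?A ?B u t b] comp_assoc[of ?A ?A ?A ?B t u b] b t' endo_commute[OF D(1) t u]
        by (simp add: endo_iff)
    qed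
    then show ?thesis
      using s joint_coequalizerD(6)[OF D(7) s] by simp
  qed
  obtain t' where t'_hom: "t' \<in> Hom C ?B ?B" and t'b: "t' \<cdot> b = b \<cdot> t"
    by (rule joint_coequalizer_factor[OF D(7) Car_obj[OF D(2)] bt eq])
  define F S S' where "F = bar A B b" and "S = bar A A t" and "S' = bar B B t'"
  have [simp]: "arr F" "adom F = ?A" "acod F = ?B" "arr S" "adom S = ?A" "acod S = ?A"
    "arr S'" "adom S' = ?B" "acod S' = ?B"
    using t t'_hom by (simp_all add: F_def S_def S'_def arr_lift endo_iff Comm_homD(1))
  have SF: "S' \<bullet> F = F \<bullet> S"
    using t'b by (simp add: F_def S_def S'_def bar_acomp)
  have F_hom: "F \<bullet> mm A = mm B \<bullet> (F \<star> F)" and S_lin: "S \<bullet> mm A = mm A \<bullet> (idt ?A \<star> S)"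
    using Comm_homD(2)[OF D(3)] t by (simp_all add: F_def S_def endo_iff)
  have "(S' \<bullet> mm B) \<bullet> (F \<star> F) = (S' \<bullet> F) \<bullet> mm A"
    by (simp add: F_hom)
  also have "\<dots> = (F \<bullet> mm A) \<bullet> (idt ?A \<star> S)"
    unfolding SF by (simp add: S_lin)
  also have "\<dots> = (mm B \<bullet> (idt ?B \<star> S')) \<bullet> (F \<star> F)"
    unfolding F_hom by (simp add: SF)
  finally have "S' \<bullet> mm B = mm B \<bullet> (idt ?B \<star> S')"
    by (rule epic_cancel[OF monoid_quotient_epic(4)[OF mq, folded F_def]]) simp_all
  then have "t' \<in> carrier (endo_ring C B)"
    using t'_hom by (simp add: endo_iff S'_def)
  with t'b show ?thesis by blast
qed

text \<open>Existence of a descended endomorphism is combined with its identification as the base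
  change. Afterwards the ring map is handled through the equation with \<open>b\<close>
  alone.\<close>

lemma endo_ring_map_quotient:
  assumes mq: "monoid_quotient A T B b" and t: "t \<in> carrier (endo_ring C A)"
  shows "endo_ring_map C A B b t \<in> carrier (endo_ring C B)" "endo_ring_map C A B b t \<cdot> b = b \<cdot> t"
proof -
  note D = monoid_quotientD[OF mq]
  obtain t' where "t' \<in> carrier (endo_ring C B)" "t' \<cdot> b = b \<cdot> t"
    using endo_descends[OF mq t] by blast
  with endo_ring_map_eq[OF D(1-3) t this]
  show "endo_ring_map C A B b t \<in> carrier (endo_ring C B)" "endo_ring_map C A B b t \<cdot> b = b \<cdot> t"
    by simp_all
qed

text \<open>Compatibility with the ring operations follows by cancelling the epic \<open>b\<close>
  in \<open>endo_ring_map C A B b t \<cdot> b = b \<cdot> t\<close>. The same equation reduces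
  surjectivity, and the inclusion of the kernel in \<open>I\<close>, to the two claims of
  \<open>hom_to_quotient\<close>.\<close>

lemma endo_ring_quotient_iso:
  assumes mq: "monoid_quotient A T B b" and z: "Zero C (Car A) (Car A) \<in> T"
    and I: "ideal I (endo_ring C A)" and TI: "T \<subseteq> I"
    and kills: "\<And>t. t \<in> I \<Longrightarrow> b \<cdot> t = Zero C (Car A) (Car B)"
    and C1: "hom_preserves_finite_free_colimits U C A"
  shows "endo_ring_map C A B b \<in> ring_hom (endo_ring C A) (endo_ring C B)"
    and "\<exists>\<phi> \<in> ring_iso (endo_ring C A Quot I) (endo_ring C B).
      \<forall>t \<in> carrier (endo_ring C A). \<phi> (I +>\<^bsub>endo_ring C A\<^esub> t) = endo_ring_map C A B b t"
proof -
  note D = monoid_quotientD[OF mq]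
  note [simp] = D(1-3)
  let ?A = "Car A" let ?B = "Car B" let ?R = "endo_ring C A" let ?S = "endo_ring C B"
  let ?h = "endo_ring_map C A B b"
  interpret I: ideal I ?R by (rule I)
  have b: "b \<in> Hom C ?A ?B"
    by (simp add: Comm_homD(1))
  have h: "?h t \<in> carrier ?S" "?h t \<in> Hom C ?B ?B" "?h t \<cdot> b = b \<cdot> t" "t \<in> Hom C ?A ?A" if "t \<in> carrier ?R" for t
    using endo_ring_map_quotient[OF mq that] that by (simp_all add: endo_iff)
  have ops: "monoid.mult ?R = Comp C" "add ?R = Add C" "\<one>\<^bsub>?R\<^esub> = Ident C ?A" "\<zero>\<^bsub>?R\<^esub> = Zero C ?A ?A"
    "monoid.mult ?S = Comp C" "add ?S = Add C" "\<one>\<^bsub>?S\<^esub> = Ident C ?B" "\<zero>\<^bsub>?S\<^esub> = Zero C ?B ?B"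
    by (simp_all add: endo_ring_def)
  have Add_hom: "Add C f g \<in> Hom C ?B ?B" if "f \<in> Hom C ?B ?B" "g \<in> Hom C ?B ?B" for f g
  proof -
    interpret HB: comm_group "hom_group C ?B ?B"
      by (rule hom_comm_group) simp_all
    show ?thesis
      using HB.m_closed[of f g] that by (simp add: hom_group_def)
  qed
  show hom: "?h \<in> ring_hom ?R ?S"
  proof (rule ring_hom_memI)
    show "?h t \<in> carrier ?S" if "t \<in> carrier ?R" for t
      using h that by blast
  next
    fix s t assume s: "s \<in> carrier ?R" and t: "t \<in> carrier ?R"
    have "?h (s \<cdot> t) \<cdot> b = b \<cdot> s \<cdot> t"
      using h(3)[of "s \<cdot> t"] I.m_closed[OF s t] by (simp add: ops)
    also have "\<dots> = (?h s \<cdot> b) \<cdot> t"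
      using comp_assoc[of ?A ?A ?A ?B t s b] h[OF s] h[OF t] b by simp
    also have "\<dots> = ?h s \<cdot> ?h t \<cdot> b"
      using comp_assoc[of ?A ?A ?B ?B t b "?h s"] h[OF s] h[OF t] b by simp
    also have "\<dots> = (?h s \<cdot> ?h t) \<cdot> b"
      using comp_assoc[of ?A ?B ?B ?B b "?h t" "?h s"] h[OF s] h[OF t] b by simp
    finally have "?h (s \<cdot> t) = ?h s \<cdot> ?h t"
      by (rule endo_eqI[OF mq, rotated 2])
        (use h(2)[of "s \<cdot> t"] I.m_closed[OF s t] comp_in_hom[of ?B ?B ?B "?h t" "?h s"] h[OF s] h[OF t]
          in \<open>simp_all add: ops\<close>)
    then show "?h (s \<otimes>\<^bsub>?R\<^esub> t) = ?h s \<otimes>\<^bsub>?S\<^esub> ?h t"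
      by (simp add: ops)
    have "?h (Add C s t) \<cdot> b = b \<cdot> Add C s t"
      using h(3)[of "Add C s t"] I.a_closed[OF s t] by (simp add: ops)
    also have "\<dots> = Add C (?h s \<cdot> b) (?h t \<cdot> b)"
      using comp_add_right[of ?A ?A ?B s t b] h[OF s] h[OF t] b by simp
    also have "\<dots> = Add C (?h s) (?h t) \<cdot> b"
      using comp_add_left[of ?A ?B ?B b "?h s" "?h t"] h[OF s] h[OF t] b by simp
    finally have "?h (Add C s t) = Add C (?h s) (?h t)"
      by (rule endo_eqI[OF mq, rotated 2])
        (use h(2)[of "Add C s t"] I.a_closed[OF s t] Add_hom h[OF s] h[OF t] in \<open>simp_all add: ops\<close>)
    then show "?h (s \<oplus>\<^bsub>?R\<^esub> t) = ?h s \<oplus>\<^bsub>?S\<^esub> ?h t"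
      by (simp add: ops)
  next
    have "?h (Ident C ?A) \<cdot> b = Ident C ?B \<cdot> b"
      using h(3)[of "Ident C ?A"] I.one_closed b by (simp add: ops ident_left[of ?A ?B] ident_right[of ?A ?B])
    then have "?h (Ident C ?A) = Ident C ?B"
      by (rule endo_eqI[OF mq, rotated 2])
        (use h(2)[of "Ident C ?A"] I.one_closed in \<open>simp_all add: ops ident_in_hom\<close>)
    then show "?h \<one>\<^bsub>?R\<^esub> = \<one>\<^bsub>?S\<^esub>"
      by (simp add: ops)
  qed
  have h_zero: "?h t = Zero C ?B ?B \<longleftrightarrow> t \<in> I" if t: "t \<in> carrier ?R" for t
  proof
    assume "?h t = Zero C ?B ?B"
    then have "b \<cdot> t = Zero C ?A ?B"
      using h(3)[OF t] comp_zero_left[of ?A ?B ?B b] b by simp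
    then show "t \<in> I"
      by (rule hom_to_quotient(2)[OF mq z I TI C1 t])
  next
    assume "t \<in> I"
    then have "?h t \<cdot> b = Zero C ?B ?B \<cdot> b"
      using h(3)[OF t] kills comp_zero_left[of ?A ?B ?B b] b by simp
    then show "?h t = Zero C ?B ?B"
      by (rule endo_eqI[OF mq, rotated 2]) (use h(2)[OF t] in simp_all)
  qed
  have surj: "?h ` carrier ?R = carrier ?S"
  proof (intro equalityI subsetI)
    fix s assume s: "s \<in> carrier ?S"
    define F S where "F = bar A B b" and "S = bar B B s"
    have [simp]: "arr F" "adom F = ?A" "acod F = ?B" "arr S" "adom S = ?B" "acod S = ?B"
      using s b by (simp_all add: F_def S_def arr_lift endo_iff)
    \<comment> \<open>Restriction of scalars along \<open>b\<close>: since \<open>s\<close> is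
      \<open>B\<close>-linear, \<open>s \<cdot> b\<close> is an \<open>A\<close>-linear arrow into
      \<open>B\<close> viewed as an \<open>A\<close>-module.\<close>
    have "(S \<bullet> F) \<bullet> mm A = (S \<bullet> mm B) \<bullet> (F \<star> F)"
      using Comm_homD(2)[OF D(3)] by (simp add: F_def)
    also have "\<dots> = (mm B \<bullet> (F \<star> idt ?B)) \<bullet> (idt ?A \<star> (S \<bullet> F))"
      using s by (simp add: endo_iff flip: S_def)
    finally have "s \<cdot> b \<in> Hom (Mod_cat C A) (self_module A) (algebra_module C B b)"
      using s b comp_in_hom[of ?A ?B ?B b s]
      by (simp add: Mod_hom_iff act_algebra endo_iff F_def S_def bar_acomp flip: bar_mar(1))
    then obtain x where x: "x \<in> carrier ?R" "s \<cdot> b = b \<cdot> x"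
      using hom_to_quotient(1)[OF mq z I TI C1] by blast
    have "?h x = s"
      by (rule endo_eqI[OF mq]) (use h[OF x(1)] s x(2) in \<open>simp_all add: endo_iff\<close>)
    then show "s \<in> ?h ` carrier ?R"
      using x by blast
  qed (use h in blast)
  \<comment> \<open>\<open>\<E>(B)\<close> receives its ring axioms as the image of the ring
    \<open>\<E>(A)\<close>. The zero of the image is the image of zero, which has to be matched with
    the zero arrow of \<open>B\<close>.\<close>
  have "ring ?S"
  proof -
    have "?h \<zero>\<^bsub>?R\<^esub> = \<zero>\<^bsub>?S\<^esub>"
      using h_zero[OF I.zero_closed] z TI by (auto simp: ops)
    then have "?S\<lparr>carrier := ?h ` carrier ?R, zero := ?h \<zero>\<^bsub>?R\<^esub>\<rparr> = ?S"
      by (simp add: surj)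
    then show ?thesis
      using I.ring_hom_imp_img_ring[OF hom] by simp
  qed
  then interpret h: ring_hom_ring ?R ?S ?h
    using hom I.ring_axioms by (intro ring_hom_ringI2)
  have ker: "a_kernel ?R ?S ?h = I"
    using h_zero I.Icarr unfolding a_kernel_def' by (auto simp: ops)
  show "\<exists>\<phi> \<in> ring_iso (?R Quot I) ?S. \<forall>t \<in> carrier ?R. \<phi> (I +>\<^bsub>?R\<^esub> t) = ?h t"
    using h.the_elem_simp unfolding ker
    by (intro bexI[OF _ h.FactRing_iso_set[OF surj, unfolded ker]]) simp
qed

end

text \<open>\<open>is_ideal_quotient\<close> fixes the quotient only up to isomorphism, so the
  isomorphism is claimed for every such quotient; the existence part excludes vacuity.\<close>

theorem mainTheorem8:
  fixes C :: "('o, 'm) smcat" and U :: "'u itself"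
    and A :: "('o, 'm) monoid_object" and I :: "'m set"
  assumes universe: "infinite (UNIV :: 'u set)"
    and abelian: "abelian_category C"
    and monoidal: "symmetric_monoidal_category C"
    and limits: "has_small_limits U C"
    and colimits: "has_small_colimits U C"
    and tensor: "tensor_preserves_colimits U C"
    and exact: "\<And>R. R \<in> Obj (Comm_cat C) \<Longrightarrow>
      filtered_colimits_commute_finite_limits U (Mod_cat C R)"
    and C1_unit: "hom_preserves_filtered_colimits U C (UnitObj C)"
    and C1_free: "\<And>R. R \<in> Obj (Comm_cat C) \<Longrightarrow> hom_preserves_finite_free_colimits U C R"
    and C2: "\<And>R. R \<in> Obj (Comm_cat C) \<Longrightarrow>
      directed_colimits_of_finitely_presented U (Mod_cat C R)"
    and A: "A \<in> Obj (Comm_cat C)"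
    and I: "ideal I (endo_ring C A)"
    and I_fg: "\<exists>S. finite S \<and> S \<subseteq> carrier (endo_ring C A) \<and> I = Idl\<^bsub>endo_ring C A\<^esub> S"
  shows "(\<exists>B b. is_ideal_quotient C A I B b) \<and>
    (\<forall>B b. is_ideal_quotient C A I B b \<longrightarrow>
       endo_ring_map C A B b \<in> ring_hom (endo_ring C A) (endo_ring C B) \<and>
       (\<exists>\<phi> \<in> ring_iso (endo_ring C A Quot I) (endo_ring C B).
          \<forall>t \<in> carrier (endo_ring C A).
            \<phi> (I +>\<^bsub>endo_ring C A\<^esub> t) = endo_ring_map C A B b t))"
proof -
  interpret cocomplete_monoidal_category C U
    using universe abelian monoidal colimits tensor
    by (simp add: cocomplete_monoidal_category_def cocomplete_monoidal_category_axioms_def)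
  obtain S where S: "finite S" "S \<subseteq> carrier (endo_ring C A)" and IS: "I = Idl\<^bsub>endo_ring C A\<^esub> S"
    using I_fg by blast
  let ?z = "Zero C (Car A) (Car A)" let ?T = "insert ?z S"
  have R: "ring (endo_ring C A)"
    using I by (rule ideal.axioms(2))
  note quotient_iff = ideal_quotient_iff[OF A R S IS]
  have SI: "?T \<subseteq> I"
    using ring.genideal_self[OF R S(2)] additive_subgroup.zero_closed[OF ideal.axioms(1)[OF I]]
    unfolding IS by (simp add: endo_ring_def)
  obtain B b where "monoid_quotient A ?T B b"
    using monoid_quotient_exists[OF A, of ?T] S zero_endo[OF A] by auto
  then have "is_ideal_quotient C A I B b"
    by (simp add: quotient_iff)
  moreover have "endo_ring_map C A B b \<in> ring_hom (endo_ring C A) (endo_ring C B) \<and>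
       (\<exists>\<phi> \<in> ring_iso (endo_ring C A Quot I) (endo_ring C B).
          \<forall>t \<in> carrier (endo_ring C A). \<phi> (I +>\<^bsub>endo_ring C A\<^esub> t) = endo_ring_map C A B b t)"
    if "is_ideal_quotient C A I B b" for B b
  proof -
    have mq: "monoid_quotient A ?T B b"
      using that by (simp add: quotient_iff)
    note D = monoid_quotientD[OF mq]
    have b: "Car B \<in> Obj C" "b \<in> Hom C (Car A) (Car B)"
      using D by (simp_all add: Comm_homD(1))
    have "b \<cdot>\<^bsub>C\<^esub> s = Zero C (Car A) (Car B)" if "s \<in> S" for s
      using joint_coequalizerD(6)[OF D(7), of s ?z] that b A comp_zero_right[of "Car A" "Car A" "Car B" b] by simp
    then have kills: "b \<cdot>\<^bsub>C\<^esub> t = Zero C (Car A) (Car B)" if "t \<in> I" for t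
      using annihilates_ideal[OF A R S(2) b] that unfolding IS by blast
    show ?thesis
      using endo_ring_quotient_iso[OF mq _ I SI kills C1_free[OF A]] by simp
  qed
  ultimately show ?thesis by blast
qed

end
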